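(* Let $(\mathbf{U},P,\boldsymbol{\sigma}_{F},\boldsymbol{\Psi},\boldsymbol{\Xi},\boldsymbol{\sigma}_{S})$ (fluid velocity, fluid pressure, fluid stress, structure displacement, structure velocity, structure stress) solve the linearized fluid–structure system (FSI) of the context for $0\le t\le T$, and let $(\boldsymbol{u}^{n+1},p^{n+1},\boldsymbol{\sigma}_f^{n+1},\boldsymbol{\eta}^{n+1},\boldsymbol{\xi}^{n+1},\boldsymbol{\sigma}_s^{n+1})$ denote the solution of the decoupled continuous-in-time Robin systems (F) and (S) of the context for $n=0,1,\dots,N-1$. If $T=N\Delta t$ with $N\ge1$, then, with a positive constant $C$ independent of $\Delta t$, $N$, $T$, $L$ and of the solutions, $$\boldsymbol{E}^N+\sum_{n=1}^N\boldsymbol{T}^n+\boldsymbol{S}^N\le C\,T\,\Delta t\Big(L\|\partial_t\mathbf{U}\|_{L^2(0,T;L^2(\Gamma))}^2+L\|\partial_t\boldsymbol{\Xi}\|_{L^2(0,T;L^2(\Gamma))}^2+\tfrac1L\|\partial_t\boldsymbol{\sigma}_F\boldsymbol{n}_f\|_{L^2(0,T;L^2(\Gamma))}^2+\tfrac1L\|\partial_t\boldsymbol{\sigma}_S\boldsymbol{n}_f\|_{L^2(0,T;L^2(\Gamma))}^2\Big),$$ where $\boldsymbol{E}^n,\boldsymbol{T}^n,\boldsymbol{S}^n$ are the error quantities defined in the context.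
   Context: Setting. $\Omega_f,\Omega_s\subset\mathbb{R}^d$, $d\in\{2,3\}$, are fixed regular bounded domains (fluid and structure) sharing an interface $\Gamma$; $\boldsymbol{n}_f$ and $\boldsymbol{n}_s$ are their outward unit normals, with $\boldsymbol{n}_f=-\boldsymbol{n}_s$ on $\Gamma$. The constants $\rho_f,\mu_f,\rho_s,\mu_s,\lambda_s$ are positive, and $L>0$ is a constant (the Robin parameter). On the parts of $\partial\Omega_f$ and $\partial\Omega_s$ other than $\Gamma$, either homogeneous Dirichlet conditions or homogeneous natural (zero-traction) conditions are imposed, the same for all the systems below. Put $\mathbb{D}(\boldsymbol{v})=\frac12(\nabla\boldsymbol{v}+(\nabla\boldsymbol{v})^T)$, $\boldsymbol{\sigma}_f(\boldsymbol{u},p)=-p\boldsymbol{I}+2\mu_f\mathbb{D}(\boldsymbol{u})$, $\boldsymbol{\sigma}_s(\boldsymbol{\eta})=2\mu_s\mathbb{D}(\boldsymbol{\eta})+\lambda_s(\nabla\cdot\boldsymbol{\eta})\boldsymbol{I}$. (FSI) The linearized coupled system for $(\boldsymbol{u},p,\boldsymbol{\eta},\boldsymbol{\xi})$ on $[0,T]$: $$\rho_f\partial_t\boldsymbol{u}-\nabla\cdot\boldsymbol{\sigma}_f(\boldsymbol{u},p)=0,\quad\nabla\cdot\boldsymbol{u}=0\ \text{ in }\Omega_f,\qquad \rho_s\partial_t\boldsymbol{\xi}-\nabla\cdot\boldsymbol{\sigma}_s(\boldsymbol{\eta})=0,\quad\partial_t\boldsymbol{\eta}=\boldsymbol{\xi}\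 \text{ in }\Omega_s,$$ $$\boldsymbol{u}=\boldsymbol{\xi},\qquad \boldsymbol{\sigma}_f\boldsymbol{n}_f=\boldsymbol{\sigma}_s\boldsymbol{n}_f\ \text{ on }\Gamma.$$ Its exact solution is written $(\mathbf{U},P,\boldsymbol{\Psi},\boldsymbol{\Xi})$, with $\boldsymbol{\sigma}_F=\boldsymbol{\sigma}_f(\mathbf{U},P)$, $\boldsymbol{\sigma}_S=\boldsymbol{\sigma}_s(\boldsymbol{\Psi})$. It is assumed that $\partial_t\mathbf{U},\ \partial_t\boldsymbol{\sigma}_F\boldsymbol{n},\ \partial_t\boldsymbol{\Xi},\ \partial_t\boldsymbol{\sigma}_S\boldsymbol{n}\in L^2(0,T;L^2(\Gamma))$. Time partition: $\Delta t=T/N$, $t_n=n\Delta t$. The functions with superscript $n+1$ in (F), (S) are functions of space and of $t\in[t_n,t_{n+1}]$; $\boldsymbol{\sigma}_f^{n+1}=\boldsymbol{\sigma}_f(\boldsymbol{u}^{n+1},p^{n+1})$ and $\boldsymbol{\sigma}_s^{n+1}=\boldsymbol{\sigma}_s(\boldsymbol{\eta}^{n+1})$. Superscript $0$ denotes initial data at $t_0=0$ (including initial stresses), which coincide with the values of the exact solution at $t_0$. Time shift: for $n\ge1$ and any quantity $v^n$ defined on $[t_{n-1},t_n]$, $\tilde v^n(t)=v^n(t-\Delta t)$ for $t\in[t_n,t_{n+1}]$; for $n=0$, $\tilde v^0(t)=v^0(t_0)$. (F) Fluid subproblem on $[t_n,t_{n+1}]$: find $\boldsymbol{u}^{n+1},p^{n+1}$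 with $$\rho_f\partial_t\boldsymbol{u}^{n+1}-\nabla\cdot\boldsymbol{\sigma}_f^{n+1}=0,\quad \nabla\cdot\boldsymbol{u}^{n+1}=0\ \text{ in }\Omega_f\times[t_n,t_{n+1}],\qquad \boldsymbol{u}^{n+1}(\cdot,t_n)=\boldsymbol{u}^n(\cdot,t_n)\ \text{ in }\Omega_f,$$ $$L\boldsymbol{u}^{n+1}+\boldsymbol{\sigma}_f^{n+1}\boldsymbol{n}_f=\tfrac L2\tilde{\boldsymbol{u}}^n+\tfrac L2\tilde{\boldsymbol{\xi}}^n+\tfrac12\tilde{\boldsymbol{\sigma}}_f^n\boldsymbol{n}_f+\tfrac12\tilde{\boldsymbol{\sigma}}_s^n\boldsymbol{n}_f\ \text{ on }\Gamma\times[t_n,t_{n+1}].$$ (S) Structure subproblem on $[t_n,t_{n+1}]$: find $\boldsymbol{\eta}^{n+1},\boldsymbol{\xi}^{n+1}$ with $$\partial_t\boldsymbol{\eta}^{n+1}=\boldsymbol{\xi}^{n+1},\quad \rho_s\partial_t\boldsymbol{\xi}^{n+1}-\nabla\cdot\boldsymbol{\sigma}_s^{n+1}=0\ \text{ in }\Omega_s\times[t_n,t_{n+1}],$$ $$\boldsymbol{\xi}^{n+1}(\cdot,t_n)=\boldsymbol{\xi}^n(\cdot,t_n),\quad \boldsymbol{\eta}^{n+1}(\cdot,t_n)=\boldsymbol{\eta}^n(\cdot,t_n)\ \text{ in }\Omega_s,$$ $$L\boldsymbol{\xi}^{n+1}+\boldsymbol{\sigma}_s^{n+1}\boldsymbol{n}_s=\tfrac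 L2\tilde{\boldsymbol{u}}^n+\tfrac L2\tilde{\boldsymbol{\xi}}^n+\tfrac12\tilde{\boldsymbol{\sigma}}_f^n\boldsymbol{n}_s+\tfrac12\tilde{\boldsymbol{\sigma}}_s^n\boldsymbol{n}_s\ \text{ on }\Gamma\times[t_n,t_{n+1}].$$ Standing regularity: these subproblems are assumed well-posed with sufficiently regular solutions; in particular $\boldsymbol{u}^{n+1},\ \boldsymbol{\sigma}_f^{n+1}\boldsymbol{n},\ \boldsymbol{\xi}^{n+1},\ \boldsymbol{\sigma}_s^{n+1}\boldsymbol{n}$ are in $L^2(t_n,t_{n+1};L^2(\Gamma))$. Norms: $\|\cdot\|_f,\|\cdot\|_s,\|\cdot\|_\Gamma$ are the $L^2$ norms on $\Omega_f,\Omega_s,\Gamma$, and $\|\boldsymbol{\eta}\|_E^2=2\mu_s\|\mathbb{D}(\boldsymbol{\eta})\|_s^2+\lambda_s\|\nabla\cdot\boldsymbol{\eta}\|_s^2$. Errors. On $[t_{n-1},t_n]$, $1\le n\le N$: $\boldsymbol{e}_u^n=\mathbf{U}-\boldsymbol{u}^n$, $\boldsymbol{e}_f^n=\boldsymbol{\sigma}_F-\boldsymbol{\sigma}_f^n$, $\boldsymbol{e}_\eta^n=\boldsymbol{\Psi}-\boldsymbol{\eta}^n$, $\boldsymbol{e}_\xi^n=\boldsymbol{\Xi}-\boldsymbol{\xi}^n$, $\boldsymbol{e}_s^n=\boldsymbol{\sigma}_S-\boldsymbol{\sigma}_s^n$, and $$\boldsymbol{E}^n=\tfrac{\rho_f}{2}\|\boldsymbol{e}_u^n(t_n)\|_f^2+\tfrac{\rho_s}{2}\|\boldsymbol{e}_\xi^n(t_n)\|_s^2+\tfrac12\|\boldsymbol{e}_\eta^n(t_n)\|_E^2,\qquad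 \boldsymbol{T}^n=2\mu_f\int_{t_{n-1}}^{t_n}\|\mathbb{D}(\boldsymbol{e}_u^n(s))\|_f^2\,ds,$$ $$\boldsymbol{S}^n=\tfrac L2\int_{t_{n-1}}^{t_n}\big(\|\boldsymbol{e}_u^n(s)\|_\Gamma^2+\|\boldsymbol{e}_\xi^n(s)\|_\Gamma^2\big)ds+\tfrac1{2L}\int_{t_{n-1}}^{t_n}\big(\|\boldsymbol{e}_f^n(s)\boldsymbol{n}_f\|_\Gamma^2+\|\boldsymbol{e}_s^n(s)\boldsymbol{n}_f\|_\Gamma^2\big)ds,$$ with $\boldsymbol{E}^0=\boldsymbol{S}^0=0$. *)

theory Defs
  imports "HOL-Analysis.Analysis"
begin

section \<open>Lebesgue spaces\<close>

definition L2 :: "'a measure \<Rightarrow> ('a \<Rightarrow> 'b::euclidean_space) \<Rightarrow> bool" where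
  "L2 M f \<longleftrightarrow> f \<in> borel_measurable M \<and> integrable M (\<lambda>x. (norm (f x))\<^sup>2)"

definition L2norm :: "'a measure \<Rightarrow> ('a \<Rightarrow> 'b::euclidean_space) \<Rightarrow> real" where
  "L2norm M f = sqrt (LINT x|M. (norm (f x))\<^sup>2)"

text \<open>The space \<open>L\<^sup>2(a,b; L\<^sup>2(M))\<close> is rendered as the space of square integrable functions
  on the product of the interval and \<open>M\<close>.\<close>

definition L2L2 :: "'a measure \<Rightarrow> real \<Rightarrow> real \<Rightarrow> (real \<Rightarrow> 'a \<Rightarrow> 'b::euclidean_space) \<Rightarrow> bool" where
  "L2L2 M a b v \<longleftrightarrow> L2 (restrict_space lborel {a..b} \<Otimes>\<^sub>M M) (\<lambda>(t, x). v t x)"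

definition L2L2norm :: "'a measure \<Rightarrow> real \<Rightarrow> real \<Rightarrow> (real \<Rightarrow> 'a \<Rightarrow> 'b::euclidean_space) \<Rightarrow> real" where
  "L2L2norm M a b v = sqrt (LINT t:{a..b}|lborel. (L2norm M (v t))\<^sup>2)"

abbreviation vol :: "(real ^ 'd::finite) set \<Rightarrow> (real ^ 'd) measure" where
  "vol \<Omega> \<equiv> restrict_space lborel \<Omega>"


section \<open>Derivatives\<close>

definition C1 :: "(real ^ 'd::finite \<Rightarrow> 'b::real_normed_vector) \<Rightarrow> bool" where
  "C1 f \<longleftrightarrow> (\<exists>f'. (\<forall>x. (f has_derivative f' x) (at x)) \<and> (\<forall>h. continuous_on UNIV (\<lambda>x. f' x h)))"

definition pd :: "'d::finite \<Rightarrow> (real ^ 'd \<Rightarrow> 'b::real_normed_vector) \<Rightarrow> real ^ 'd \<Rightarrow> 'b" where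
  "pd i f x = frechet_derivative f (at x) (axis i 1)"

definition test_fun :: "(real ^ 'd::finite) set \<Rightarrow> (real ^ 'd \<Rightarrow> real) \<Rightarrow> bool" where
  "test_fun \<Omega> \<phi> \<longleftrightarrow> C1 \<phi> \<and> compact (closure {x. \<phi> x \<noteq> 0}) \<and> closure {x. \<phi> x \<noteq> 0} \<subseteq> \<Omega>"

definition has_weak_pd ::
    "(real ^ 'd::finite) set \<Rightarrow> 'd \<Rightarrow> (real ^ 'd \<Rightarrow> 'b::euclidean_space) \<Rightarrow> (real ^ 'd \<Rightarrow> 'b) \<Rightarrow> bool" where
  "has_weak_pd \<Omega> i v g \<longleftrightarrow> L2 (vol \<Omega>) v \<and> L2 (vol \<Omega>) g \<and>
     (\<forall>\<phi>. test_fun \<Omega> \<phi> \<longrightarrow>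
        (LINT x|vol \<Omega>. pd i \<phi> x *\<^sub>R v x) = - (LINT x|vol \<Omega>. \<phi> x *\<^sub>R g x))"

text \<open>Weak derivatives are determined almost everywhere; \<open>SOME\<close> picks a representative.\<close>

definition wpd :: "(real ^ 'd::finite) set \<Rightarrow> 'd \<Rightarrow> (real ^ 'd \<Rightarrow> 'b::euclidean_space) \<Rightarrow> real ^ 'd \<Rightarrow> 'b" where
  "wpd \<Omega> i v = (SOME g. has_weak_pd \<Omega> i v g)"

definition wdiv :: "(real ^ 'd::finite) set \<Rightarrow> (real ^ 'd \<Rightarrow> real ^ 'd) \<Rightarrow> real ^ 'd \<Rightarrow> real" where
  "wdiv \<Omega> v x = (\<Sum>i\<in>UNIV. wpd \<Omega> i v x $ i)"

definition symgrad :: "(real ^ 'd::finite) set \<Rightarrow> (real ^ 'd \<Rightarrow> real ^ 'd) \<Rightarrow> real ^ 'd \<Rightarrow> real ^ 'd ^ 'd" where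
  "symgrad \<Omega> v x = (\<chi> i j. (wpd \<Omega> j v x $ i + wpd \<Omega> i v x $ j) / 2)"

definition has_weak_tdiv ::
    "(real ^ 'd::finite) set \<Rightarrow> (real ^ 'd \<Rightarrow> real ^ 'd ^ 'd) \<Rightarrow> (real ^ 'd \<Rightarrow> real ^ 'd) \<Rightarrow> bool" where
  "has_weak_tdiv \<Omega> \<sigma> g \<longleftrightarrow> L2 (vol \<Omega>) \<sigma> \<and> L2 (vol \<Omega>) g \<and>
     (\<forall>\<phi>. test_fun \<Omega> \<phi> \<longrightarrow>
        (LINT x|vol \<Omega>. \<sigma> x *v (\<chi> j. pd j \<phi> x)) = - (LINT x|vol \<Omega>. \<phi> x *\<^sub>R g x))"

definition wtdiv :: "(real ^ 'd::finite) set \<Rightarrow> (real ^ 'd \<Rightarrow> real ^ 'd ^ 'd) \<Rightarrow> real ^ 'd \<Rightarrow> real ^ 'd" where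
  "wtdiv \<Omega> \<sigma> = (SOME g. has_weak_tdiv \<Omega> \<sigma> g)"

text \<open>\<open>v \<in> H\<^sup>1(a,b; L\<^sup>2(M))\<close> with time derivative \<open>dv\<close>: \<open>v\<close> is the representative that is
  absolutely continuous in time, so that \<open>v t\<close> is meaningful for every \<open>t\<close>, end points
  included.\<close>

definition has_tderiv ::
    "'a measure \<Rightarrow> real \<Rightarrow> real \<Rightarrow> (real \<Rightarrow> 'a \<Rightarrow> 'b::euclidean_space) \<Rightarrow> (real \<Rightarrow> 'a \<Rightarrow> 'b) \<Rightarrow> bool" where
  "has_tderiv M a b v dv \<longleftrightarrow> L2L2 M a b v \<and> L2L2 M a b dv \<and> L2 M (v a) \<and>
     (AE x in M. \<forall>t\<in>{a..b}. v t x = v a x + (LINT s:{a..t}|lborel. dv s x))"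

definition H1t :: "'a measure \<Rightarrow> real \<Rightarrow> real \<Rightarrow> (real \<Rightarrow> 'a \<Rightarrow> 'b::euclidean_space) \<Rightarrow> bool" where
  "H1t M a b v \<longleftrightarrow> (\<exists>dv. has_tderiv M a b v dv)"

definition tderiv ::
    "'a measure \<Rightarrow> real \<Rightarrow> real \<Rightarrow> (real \<Rightarrow> 'a \<Rightarrow> 'b::euclidean_space) \<Rightarrow> real \<Rightarrow> 'a \<Rightarrow> 'b" where
  "tderiv M a b v = (SOME dv. has_tderiv M a b v dv)"


section \<open>Domains, surface measure and outward normal\<close>

text \<open>Near each boundary point, \<open>\<Omega>\<close> is the region below the graph of a Lipschitz function \<open>g\<close>
  of the coordinates orthogonal to some unit vector \<open>e\<close>.\<close>

definition lipschitz_boundary :: "(real ^ 'd::finite) set \<Rightarrow> bool" where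
  "lipschitz_boundary \<Omega> \<longleftrightarrow> (\<forall>z\<in>frontier \<Omega>. \<exists>e r K. \<exists>g :: real ^ 'd \<Rightarrow> real.
     norm e = 1 \<and> r > 0 \<and> K-lipschitz_on UNIV g \<and> (\<forall>y s. g (y + s *\<^sub>R e) = g y) \<and>
     \<Omega> \<inter> ball z r = {y \<in> ball z r. y \<bullet> e < g y})"

definition regular_domain :: "(real ^ 'd::finite) set \<Rightarrow> bool" where
  "regular_domain \<Omega> \<longleftrightarrow> open \<Omega> \<and> connected \<Omega> \<and> \<Omega> \<noteq> {} \<and> bounded \<Omega> \<and> lipschitz_boundary \<Omega>"

text \<open>De Giorgi's definition of the perimeter measure of \<open>\<Omega>\<close> (here: \<open>S\<close> restricted to the
  boundary) and of the outward unit normal \<open>n\<close>, as the polar decomposition of minus the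
  distributional gradient of the indicator function of \<open>\<Omega>\<close>. By uniqueness of the polar
  decomposition it determines \<open>S\<close> on \<open>\<partial>\<Omega>\<close>, and \<open>n\<close> almost everywhere; for a Lipschitz domain
  they are the \<open>(d-1)\<close>-dimensional surface (Hausdorff) measure on \<open>\<partial>\<Omega>\<close> and the classical
  outward unit normal. As \<open>\<Omega>\<close> is bounded, the fields \<open>\<phi>\<close> need not have compact support.\<close>

definition surface_normal ::
    "(real ^ 'd::finite) measure \<Rightarrow> (real ^ 'd) set \<Rightarrow> (real ^ 'd \<Rightarrow> real ^ 'd) \<Rightarrow> bool" where
  "surface_normal S \<Omega> n \<longleftrightarrow> sets S = sets borel \<and> emeasure S (frontier \<Omega>) < \<infinity> \<and>
     n \<in> borel_measurable borel \<and> (AE x in restrict_space S (frontier \<Omega>). norm (n x) = 1) \<and>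
     (\<forall>\<phi> :: real ^ 'd \<Rightarrow> real ^ 'd. C1 \<phi> \<longrightarrow>
        (LINT x|vol \<Omega>. (\<Sum>i\<in>UNIV. pd i \<phi> x $ i)) =
        (LINT x|restrict_space S (frontier \<Omega>). \<phi> x \<bullet> n x))"


section \<open>Sobolev spaces with boundary values\<close>

text \<open>Throughout, a function on the closure of \<open>\<Omega>\<close> encodes both a function on \<open>\<Omega>\<close> (its values
  on \<open>\<Omega>\<close>) and its trace (its values on \<open>frontier \<Omega>\<close>, which is a Lebesgue null set).
  \<open>H\<^sup>1(\<Omega>)\<close> is the closure of \<open>C\<^sup>1\<close> functions, and the trace is the limit of their boundary
  values in \<open>L\<^sup>2(\<partial>\<Omega>)\<close>.\<close>

definition H1 :: "(real ^ 'd::finite) measure \<Rightarrow> (real ^ 'd) set \<Rightarrow> (real ^ 'd \<Rightarrow> 'b::euclidean_space) \<Rightarrow> bool" where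
  "H1 S \<Omega> v \<longleftrightarrow> L2 (restrict_space S (frontier \<Omega>)) v \<and> (\<forall>i. \<exists>g. has_weak_pd \<Omega> i v g) \<and>
     (\<exists>w :: nat \<Rightarrow> real ^ 'd \<Rightarrow> 'b. (\<forall>k. C1 (w k)) \<and>
        (\<lambda>k. L2norm (vol \<Omega>) (\<lambda>x. w k x - v x)) \<longlonglongrightarrow> 0 \<and>
        (\<forall>i. (\<lambda>k. L2norm (vol \<Omega>) (\<lambda>x. pd i (w k) x - wpd \<Omega> i v x)) \<longlonglongrightarrow> 0) \<and>
        (\<lambda>k. L2norm (restrict_space S (frontier \<Omega>)) (\<lambda>x. w k x - v x)) \<longlonglongrightarrow> 0)"

text \<open>Tensor fields with divergence in \<open>L\<^sup>2(\<Omega>)\<close> and normal trace in \<open>L\<^sup>2(\<partial>\<Omega>)\<close>. Of the values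
  of \<open>\<sigma>\<close> on \<open>frontier \<Omega>\<close> only the normal component \<open>\<sigma> n\<close> is meaningful.\<close>

definition Hdiv ::
    "(real ^ 'd::finite) measure \<Rightarrow> (real ^ 'd) set \<Rightarrow> (real ^ 'd \<Rightarrow> real ^ 'd) \<Rightarrow> (real ^ 'd \<Rightarrow> real ^ 'd ^ 'd) \<Rightarrow> bool" where
  "Hdiv S \<Omega> n \<sigma> \<longleftrightarrow> L2 (restrict_space S (frontier \<Omega>)) (\<lambda>x. \<sigma> x *v n x) \<and> (\<exists>g. has_weak_tdiv \<Omega> \<sigma> g) \<and>
     (\<exists>w :: nat \<Rightarrow> real ^ 'd \<Rightarrow> real ^ 'd ^ 'd. (\<forall>k. C1 (w k)) \<and>
        (\<lambda>k. L2norm (vol \<Omega>) (\<lambda>x. w k x - \<sigma> x)) \<longlonglongrightarrow> 0 \<and>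
        (\<lambda>k. L2norm (vol \<Omega>) (\<lambda>x. (\<chi> i. \<Sum>j\<in>UNIV. pd j (w k) x $ i $ j) - wtdiv \<Omega> \<sigma> x)) \<longlonglongrightarrow> 0 \<and>
        (\<lambda>k. L2norm (restrict_space S (frontier \<Omega>)) (\<lambda>x. w k x *v n x - \<sigma> x *v n x)) \<longlonglongrightarrow> 0)"

definition L2H1 ::
    "(real ^ 'd::finite) measure \<Rightarrow> (real ^ 'd) set \<Rightarrow> real \<Rightarrow> real \<Rightarrow> (real \<Rightarrow> real ^ 'd \<Rightarrow> 'b::euclidean_space) \<Rightarrow> bool" where
  "L2H1 S \<Omega> a b v \<longleftrightarrow> L2L2 (vol \<Omega>) a b v \<and> (AE t in restrict_space lborel {a..b}. H1 S \<Omega> (v t)) \<and>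
     (\<forall>i. \<exists>G. L2L2 (vol \<Omega>) a b G \<and>
        (AE t in restrict_space lborel {a..b}. has_weak_pd \<Omega> i (v t) (G t)))"


section \<open>The coupled system and its splitting\<close>

text \<open>\<open>Dir_f\<close> and \<open>Dir_s\<close> are the parts of the outer boundaries carrying homogeneous Dirichlet
  conditions; the remaining parts carry zero-traction conditions.\<close>

record ('d::finite) fsi_data =
  \<Omega>\<^sub>f :: "(real ^ 'd) set"
  \<Omega>\<^sub>s :: "(real ^ 'd) set"
  \<Gamma> :: "(real ^ 'd) set"
  Dir_f :: "(real ^ 'd) set"
  Dir_s :: "(real ^ 'd) set"
  surf :: "(real ^ 'd) measure"
  n\<^sub>f :: "real ^ 'd \<Rightarrow> real ^ 'd"
  n\<^sub>s :: "real ^ 'd \<Rightarrow> real ^ 'd"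
  \<rho>\<^sub>f :: real
  \<mu>\<^sub>f :: real
  \<rho>\<^sub>s :: real
  \<mu>\<^sub>s :: real
  lam\<^sub>s :: real

abbreviation on_\<Gamma> :: "'d::finite fsi_data \<Rightarrow> (real ^ 'd) measure" where
  "on_\<Gamma> X \<equiv> restrict_space (surf X) (\<Gamma> X)"

definition fsi_setting :: "'d::finite fsi_data \<Rightarrow> bool" where
  "fsi_setting X \<longleftrightarrow> CARD('d) \<in> {2, 3} \<and>
     regular_domain (\<Omega>\<^sub>f X) \<and> regular_domain (\<Omega>\<^sub>s X) \<and>
     \<Gamma> X \<in> sets borel \<and> \<Gamma> X \<subseteq> frontier (\<Omega>\<^sub>f X) \<inter> frontier (\<Omega>\<^sub>s X) \<and>
     Dir_f X \<in> sets borel \<and> Dir_f X \<subseteq> frontier (\<Omega>\<^sub>f X) - \<Gamma> X \<and>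
     Dir_s X \<in> sets borel \<and> Dir_s X \<subseteq> frontier (\<Omega>\<^sub>s X) - \<Gamma> X \<and>
     surface_normal (surf X) (\<Omega>\<^sub>f X) (n\<^sub>f X) \<and> surface_normal (surf X) (\<Omega>\<^sub>s X) (n\<^sub>s X) \<and>
     (AE x in on_\<Gamma> X. n\<^sub>f X x = - n\<^sub>s X x) \<and>
     \<rho>\<^sub>f X > 0 \<and> \<mu>\<^sub>f X > 0 \<and> \<rho>\<^sub>s X > 0 \<and> \<mu>\<^sub>s X > 0 \<and> lam\<^sub>s X > 0"

type_synonym 'd sfield = "real \<Rightarrow> real ^ 'd \<Rightarrow> real"
type_synonym 'd vfield = "real \<Rightarrow> real ^ 'd \<Rightarrow> real ^ 'd"
type_synonym 'd tfield = "real \<Rightarrow> real ^ 'd \<Rightarrow> real ^ 'd ^ 'd"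

text \<open>Strong solutions: the equations hold almost everywhere with square integrable terms, and
  the boundary conditions hold for the traces.\<close>

definition fluid_eqs ::
    "'d::finite fsi_data \<Rightarrow> real \<Rightarrow> real \<Rightarrow> 'd vfield \<Rightarrow> 'd sfield \<Rightarrow> 'd tfield \<Rightarrow> bool" where
  "fluid_eqs X a b u p \<sigma> \<longleftrightarrow>
     H1t (vol (\<Omega>\<^sub>f X)) a b u \<and> L2H1 (surf X) (\<Omega>\<^sub>f X) a b u \<and>
     L2L2 (vol (\<Omega>\<^sub>f X)) a b p \<and> L2L2 (vol (\<Omega>\<^sub>f X)) a b \<sigma> \<and>
     (AE t in restrict_space lborel {a..b}.
        Hdiv (surf X) (\<Omega>\<^sub>f X) (n\<^sub>f X) (\<sigma> t) \<and>
        (AE x in vol (\<Omega>\<^sub>f X).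
           \<sigma> t x = - mat (p t x) + (2 * \<mu>\<^sub>f X) *\<^sub>R symgrad (\<Omega>\<^sub>f X) (u t) x \<and>
           \<rho>\<^sub>f X *\<^sub>R tderiv (vol (\<Omega>\<^sub>f X)) a b u t x - wtdiv (\<Omega>\<^sub>f X) (\<sigma> t) x = 0 \<and>
           wdiv (\<Omega>\<^sub>f X) (u t) x = 0) \<and>
        (AE x in restrict_space (surf X) (frontier (\<Omega>\<^sub>f X) - \<Gamma> X).
           if x \<in> Dir_f X then u t x = 0 else \<sigma> t x *v n\<^sub>f X x = 0))"

definition structure_eqs ::
    "'d::finite fsi_data \<Rightarrow> real \<Rightarrow> real \<Rightarrow> 'd vfield \<Rightarrow> 'd vfield \<Rightarrow> 'd tfield \<Rightarrow> bool" where
  "structure_eqs X a b \<eta> \<xi> \<sigma> \<longleftrightarrow>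
     H1t (vol (\<Omega>\<^sub>s X)) a b \<eta> \<and> L2H1 (surf X) (\<Omega>\<^sub>s X) a b \<eta> \<and>
     H1t (vol (\<Omega>\<^sub>s X)) a b \<xi> \<and> L2H1 (surf X) (\<Omega>\<^sub>s X) a b \<xi> \<and>
     L2L2 (vol (\<Omega>\<^sub>s X)) a b \<sigma> \<and>
     (AE t in restrict_space lborel {a..b}.
        Hdiv (surf X) (\<Omega>\<^sub>s X) (n\<^sub>s X) (\<sigma> t) \<and>
        (AE x in vol (\<Omega>\<^sub>s X).
           \<sigma> t x = (2 * \<mu>\<^sub>s X) *\<^sub>R symgrad (\<Omega>\<^sub>s X) (\<eta> t) x + mat (lam\<^sub>s X * wdiv (\<Omega>\<^sub>s X) (\<eta> t) x) \<and>
           \<rho>\<^sub>s X *\<^sub>R tderiv (vol (\<Omega>\<^sub>s X)) a b \<xi> t x - wtdiv (\<Omega>\<^sub>s X) (\<sigma> t) x = 0 \<and>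
           tderiv (vol (\<Omega>\<^sub>s X)) a b \<eta> t x = \<xi> t x) \<and>
        (AE x in restrict_space (surf X) (frontier (\<Omega>\<^sub>s X) - \<Gamma> X).
           if x \<in> Dir_s X then \<eta> t x = 0 \<and> \<xi> t x = 0 else \<sigma> t x *v n\<^sub>s X x = 0))"

text \<open>The exact solution, including the assumed regularity in time of its traces on \<open>\<Gamma>\<close>.\<close>

definition FSI_solution ::
    "'d::finite fsi_data \<Rightarrow> real \<Rightarrow> 'd vfield \<Rightarrow> 'd sfield \<Rightarrow> 'd tfield \<Rightarrow> 'd vfield \<Rightarrow> 'd vfield \<Rightarrow> 'd tfield \<Rightarrow> bool" where
  "FSI_solution X T U P \<sigma>F \<Psi> \<Xi> \<sigma>S \<longleftrightarrow>
     fluid_eqs X 0 T U P \<sigma>F \<and> structure_eqs X 0 T \<Psi> \<Xi> \<sigma>S \<and>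
     (AE t in restrict_space lborel {0..T}. AE x in on_\<Gamma> X.
        U t x = \<Xi> t x \<and> \<sigma>F t x *v n\<^sub>f X x = \<sigma>S t x *v n\<^sub>f X x) \<and>
     H1t (on_\<Gamma> X) 0 T U \<and> H1t (on_\<Gamma> X) 0 T (\<lambda>t x. \<sigma>F t x *v n\<^sub>f X x) \<and>
     H1t (on_\<Gamma> X) 0 T \<Xi> \<and> H1t (on_\<Gamma> X) 0 T (\<lambda>t x. \<sigma>S t x *v n\<^sub>f X x)"

text \<open>\<open>v n\<close> is the quantity with superscript \<open>n\<close>, as a function of time on \<open>[(n-1)\<Delta>t, n\<Delta>t]\<close> for
  \<open>n \<ge> 1\<close>; the initial datum is \<open>v 0 0\<close>.\<close>

definition shift :: "real \<Rightarrow> (nat \<Rightarrow> real \<Rightarrow> 'a) \<Rightarrow> nat \<Rightarrow> real \<Rightarrow> 'a" where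
  "shift \<Delta>t v n t = (if n = 0 then v 0 0 else v n (t - \<Delta>t))"

definition robin_data ::
    "real \<Rightarrow> real \<Rightarrow> (nat \<Rightarrow> 'd::finite vfield) \<Rightarrow> (nat \<Rightarrow> 'd tfield) \<Rightarrow> (nat \<Rightarrow> 'd vfield) \<Rightarrow> (nat \<Rightarrow> 'd tfield) \<Rightarrow>
     nat \<Rightarrow> (real ^ 'd \<Rightarrow> real ^ 'd) \<Rightarrow> 'd vfield" where
  "robin_data L \<Delta>t u \<sigma>f \<xi> \<sigma>s n \<nu> t x =
     (L / 2) *\<^sub>R shift \<Delta>t u n t x + (L / 2) *\<^sub>R shift \<Delta>t \<xi> n t x
     + (1 / 2) *\<^sub>R (shift \<Delta>t \<sigma>f n t x *v \<nu> x) + (1 / 2) *\<^sub>R (shift \<Delta>t \<sigma>s n t x *v \<nu> x)"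

definition fluid_step ::
    "'d::finite fsi_data \<Rightarrow> real \<Rightarrow> real \<Rightarrow> (nat \<Rightarrow> 'd vfield) \<Rightarrow> (nat \<Rightarrow> 'd sfield) \<Rightarrow> (nat \<Rightarrow> 'd tfield) \<Rightarrow>
     (nat \<Rightarrow> 'd vfield) \<Rightarrow> (nat \<Rightarrow> 'd tfield) \<Rightarrow> nat \<Rightarrow> bool" where
  "fluid_step X L \<Delta>t u p \<sigma>f \<xi> \<sigma>s n \<longleftrightarrow>
     (let a = real n * \<Delta>t; b = real (Suc n) * \<Delta>t in
        fluid_eqs X a b (u (Suc n)) (p (Suc n)) (\<sigma>f (Suc n)) \<and>
        (AE x in vol (\<Omega>\<^sub>f X). u (Suc n) a x = u n a x) \<and>
        L2L2 (on_\<Gamma> X) a b (u (Suc n)) \<and> L2L2 (on_\<Gamma> X) a b (\<lambda>t x. \<sigma>f (Suc n) t x *v n\<^sub>f X x) \<and>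
        (AE t in restrict_space lborel {a..b}. AE x in on_\<Gamma> X.
           L *\<^sub>R u (Suc n) t x + \<sigma>f (Suc n) t x *v n\<^sub>f X x
             = robin_data L \<Delta>t u \<sigma>f \<xi> \<sigma>s n (n\<^sub>f X) t x))"

definition structure_step ::
    "'d::finite fsi_data \<Rightarrow> real \<Rightarrow> real \<Rightarrow> (nat \<Rightarrow> 'd vfield) \<Rightarrow> (nat \<Rightarrow> 'd tfield) \<Rightarrow>
     (nat \<Rightarrow> 'd vfield) \<Rightarrow> (nat \<Rightarrow> 'd vfield) \<Rightarrow> (nat \<Rightarrow> 'd tfield) \<Rightarrow> nat \<Rightarrow> bool" where
  "structure_step X L \<Delta>t u \<sigma>f \<eta> \<xi> \<sigma>s n \<longleftrightarrow>
     (let a = real n * \<Delta>t; b = real (Suc n) * \<Delta>t in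
        structure_eqs X a b (\<eta> (Suc n)) (\<xi> (Suc n)) (\<sigma>s (Suc n)) \<and>
        (AE x in vol (\<Omega>\<^sub>s X). \<xi> (Suc n) a x = \<xi> n a x \<and> \<eta> (Suc n) a x = \<eta> n a x) \<and>
        L2L2 (on_\<Gamma> X) a b (\<xi> (Suc n)) \<and> L2L2 (on_\<Gamma> X) a b (\<lambda>t x. \<sigma>s (Suc n) t x *v n\<^sub>s X x) \<and>
        (AE t in restrict_space lborel {a..b}. AE x in on_\<Gamma> X.
           L *\<^sub>R \<xi> (Suc n) t x + \<sigma>s (Suc n) t x *v n\<^sub>s X x
             = robin_data L \<Delta>t u \<sigma>f \<xi> \<sigma>s n (n\<^sub>s X) t x))"

definition splitting_solution ::
    "'d::finite fsi_data \<Rightarrow> real \<Rightarrow> real \<Rightarrow> nat \<Rightarrow> (nat \<Rightarrow> 'd vfield) \<Rightarrow> (nat \<Rightarrow> 'd sfield) \<Rightarrow> (nat \<Rightarrow> 'd tfield) \<Rightarrow>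
     (nat \<Rightarrow> 'd vfield) \<Rightarrow> (nat \<Rightarrow> 'd vfield) \<Rightarrow> (nat \<Rightarrow> 'd tfield) \<Rightarrow> bool" where
  "splitting_solution X L \<Delta>t N u p \<sigma>f \<eta> \<xi> \<sigma>s \<longleftrightarrow>
     (\<forall>n<N. fluid_step X L \<Delta>t u p \<sigma>f \<xi> \<sigma>s n \<and> structure_step X L \<Delta>t u \<sigma>f \<eta> \<xi> \<sigma>s n)"


section \<open>Error quantities\<close>

definition energy_norm :: "'d::finite fsi_data \<Rightarrow> (real ^ 'd \<Rightarrow> real ^ 'd) \<Rightarrow> real" where
  "energy_norm X \<eta> = sqrt (2 * \<mu>\<^sub>s X * (L2norm (vol (\<Omega>\<^sub>s X)) (symgrad (\<Omega>\<^sub>s X) \<eta>))\<^sup>2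
                          + lam\<^sub>s X * (L2norm (vol (\<Omega>\<^sub>s X)) (wdiv (\<Omega>\<^sub>s X) \<eta>))\<^sup>2)"

definition err_E ::
    "'d::finite fsi_data \<Rightarrow> real \<Rightarrow> 'd vfield \<Rightarrow> 'd vfield \<Rightarrow> 'd vfield \<Rightarrow>
     (nat \<Rightarrow> 'd vfield) \<Rightarrow> (nat \<Rightarrow> 'd vfield) \<Rightarrow> (nat \<Rightarrow> 'd vfield) \<Rightarrow> nat \<Rightarrow> real" where
  "err_E X \<Delta>t U \<Psi> \<Xi> u \<eta> \<xi> n =
     (if n = 0 then 0 else let t = real n * \<Delta>t in
        \<rho>\<^sub>f X / 2 * (L2norm (vol (\<Omega>\<^sub>f X)) (\<lambda>x. U t x - u n t x))\<^sup>2
      + \<rho>\<^sub>s X / 2 * (L2norm (vol (\<Omega>\<^sub>s X)) (\<lambda>x. \<Xi> t x - \<xi> n t x))\<^sup>2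
      + 1 / 2 * (energy_norm X (\<lambda>x. \<Psi> t x - \<eta> n t x))\<^sup>2)"

text \<open>The integrand is determined only for almost every \<open>s\<close>; hence the complete measure
  \<open>lebesgue\<close>.\<close>

definition err_T ::
    "'d::finite fsi_data \<Rightarrow> real \<Rightarrow> 'd vfield \<Rightarrow> (nat \<Rightarrow> 'd vfield) \<Rightarrow> nat \<Rightarrow> real" where
  "err_T X \<Delta>t U u n =
     2 * \<mu>\<^sub>f X * (LINT s:{real (n - 1) * \<Delta>t..real n * \<Delta>t}|lebesgue.
       (L2norm (vol (\<Omega>\<^sub>f X)) (symgrad (\<Omega>\<^sub>f X) (\<lambda>x. U s x - u n s x)))\<^sup>2)"

definition err_S ::
    "'d::finite fsi_data \<Rightarrow> real \<Rightarrow> real \<Rightarrow> 'd vfield \<Rightarrow> 'd tfield \<Rightarrow> 'd vfield \<Rightarrow> 'd tfield \<Rightarrow>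
     (nat \<Rightarrow> 'd vfield) \<Rightarrow> (nat \<Rightarrow> 'd tfield) \<Rightarrow> (nat \<Rightarrow> 'd vfield) \<Rightarrow> (nat \<Rightarrow> 'd tfield) \<Rightarrow> nat \<Rightarrow> real" where
  "err_S X L \<Delta>t U \<sigma>F \<Xi> \<sigma>S u \<sigma>f \<xi> \<sigma>s n =
     (if n = 0 then 0 else let I = {real (n - 1) * \<Delta>t..real n * \<Delta>t} in
        L / 2 * (LINT s:I|lborel. ((L2norm (on_\<Gamma> X) (\<lambda>x. U s x - u n s x))\<^sup>2
                                + (L2norm (on_\<Gamma> X) (\<lambda>x. \<Xi> s x - \<xi> n s x))\<^sup>2))
      + 1 / (2 * L) * (LINT s:I|lborel.
           ((L2norm (on_\<Gamma> X) (\<lambda>x. (\<sigma>F s x - \<sigma>f n s x) *v n\<^sub>f X x))\<^sup>2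
          + (L2norm (on_\<Gamma> X) (\<lambda>x. (\<sigma>S s x - \<sigma>s n s x) *v n\<^sub>f X x))\<^sup>2)))"

end

theory Submission
  imports Defs
begin

text \<open>The errors satisfy the homogeneous fluid and structure equations, so on each time step Green's
  formula turns the energy balance into the boundary work \<open>\<integral> (b \<bullet> a - d \<bullet> c)\<close> on the interface, where
  \<open>a, c\<close> are the velocity errors and \<open>b, d\<close> the normal stress errors. The Robin conditions bound this
  work plus the current interface quantity \<open>S\<close> by the previous \<open>S\<close>, up to the consistency error of
  replacing the exact traces by their values one step earlier; that error is at most \<open>\<Delta>t\<close> times the
  integral of the squared time derivatives over two steps. Young's inequality with weight \<open>1/N\<close> and the
  discrete Gronwall lemma give the factor \<open>exp 1\<close>, and hence \<open>C = 2 exp 1\<close>.\<close>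

section \<open>Square integrable functions\<close>

text \<open>The exact solution meets both Robin conditions with data taken at the current time,
  because the coupling makes the two velocities and the two normal stresses agree on the interface;
  hence only its increments enter. No interface dissipation is exploited: S is handed on from step
  to step, inflated by 1 + 1/N. The complementary factor 1 + N <= 2N, times the squared step of the
  consistency error, becomes 2T times the step; this 2 cancels the halved weights in S, and the 2 in
  the constant counts the overlap of the two-step windows. The obstacle is regularity in time.
  Equations, gradients and traces are available for almost every time, whereas energies are
  evaluated at grid points. For velocities the absolutely continuous representative settles this;
  for the elastic energy the gradient of the displacement error is rebuilt at every time as a
  primitive of the gradient of the velocity error. Moreover \<open>wpd\<close> and
  \<open>wtdiv\<close> are separate choices at each time, so measurability in time has to come from
  jointly measurable representatives.\<close>

lemma L2_inner_integrable:
  assumes "L2 M f" "L2 M g"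
  shows "integrable M (\<lambda>x. f x \<bullet> g x)"
proof (rule Bochner_Integration.integrable_bound)
  show "integrable M (\<lambda>x. (norm (f x))\<^sup>2 + (norm (g x))\<^sup>2)"
    using assms by (auto simp: L2_def)
  show "(\<lambda>x. f x \<bullet> g x) \<in> borel_measurable M"
    using assms by (auto simp: L2_def)
  have "norm (f x \<bullet> g x) \<le> norm ((norm (f x))\<^sup>2 + (norm (g x))\<^sup>2)" for x
  proof -
    have "\<bar>f x \<bullet> g x\<bar> \<le> norm (f x) * norm (g x)" by (rule Cauchy_Schwarz_ineq2)
    also have "\<dots> \<le> (norm (f x))\<^sup>2 + (norm (g x))\<^sup>2"
      using sum_squares_bound[of "norm (f x)" "norm (g x)"]
        mult_nonneg_nonneg[OF norm_ge_zero[of "f x"] norm_ge_zero[of "g x"]] by linarith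
    finally show ?thesis by simp
  qed
  then show "AE x in M. norm (f x \<bullet> g x) \<le> norm ((norm (f x))\<^sup>2 + (norm (g x))\<^sup>2)"
    by simp
qed

lemma L2_bound:
  assumes "f \<in> borel_measurable M" "integrable M h" "AE x in M. (norm (f x))\<^sup>2 \<le> h x"
  shows "L2 M f"
  unfolding L2_def
proof
  show "integrable M (\<lambda>x. (norm (f x))\<^sup>2)"
    by (rule Bochner_Integration.integrable_bound[OF assms(2)]) (use assms in auto)
qed fact

lemma L2_bounded_linear:
  assumes "bounded_linear h" "L2 M f"
  shows "L2 M (\<lambda>x. h (f x))"
proof -
  interpret bounded_linear h by fact
  obtain K where K: "\<And>x. norm (h x) \<le> norm x * K" using bounded by auto
  have "(norm (h (f x)))\<^sup>2 \<le> K\<^sup>2 * (norm (f x))\<^sup>2" for x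
    using power_mono[OF K[of "f x"] norm_ge_zero, of 2] by (simp add: power_mult_distrib mult.commute)
  moreover have "(\<lambda>x. h (f x)) \<in> borel_measurable M"
  proof (rule measurable_compose[of f M borel h borel])
    show "f \<in> borel_measurable M" using assms(2) by (simp add: L2_def)
    show "h \<in> borel_measurable borel"
      by (intro borel_measurable_continuous_onI linear_continuous_on assms(1))
  qed
  ultimately show ?thesis
    using assms(2) by (intro L2_bound[where h="\<lambda>x. K\<^sup>2 * (norm (f x))\<^sup>2"]) (auto simp: L2_def)
qed

lemma norm_add_scaleR_sq:
  fixes x y :: "'a::real_inner"
  shows "(norm (x + t *\<^sub>R y))\<^sup>2 = (norm x)\<^sup>2 + 2 * t * (x \<bullet> y) + t\<^sup>2 * (norm y)\<^sup>2"
proof -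
  have "(x + t *\<^sub>R y) \<bullet> (x + t *\<^sub>R y) = x \<bullet> x + 2 * t * (x \<bullet> y) + t * t * (y \<bullet> y)"
    by (simp add: inner_add_left inner_add_right inner_commute[of y x] algebra_simps)
  then show ?thesis unfolding power2_norm_eq_inner by (simp add: power2_eq_square)
qed

text \<open>Young's inequality with a free weight, from expanding
  \<open>e * |x - y/e|^2 >= 0\<close>. The freedom matters: with \<open>e = 1\<close> the old error
  would double in every time step.\<close>

lemma norm_add_sq_le:
  fixes x y :: "'a::real_inner"
  assumes "e > 0"
  shows "(norm (x + y))\<^sup>2 \<le> (1 + e) * (norm x)\<^sup>2 + (1 + 1 / e) * (norm y)\<^sup>2"
proof -
  have "0 \<le> e * (norm (x + (- 1 / e) *\<^sub>R y))\<^sup>2" using assms by simp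
  also have "\<dots> = e * (norm x)\<^sup>2 - 2 * (x \<bullet> y) + (1 / e) * (norm y)\<^sup>2"
    unfolding norm_add_scaleR_sq using assms by (simp add: field_simps power2_eq_square)
  finally show ?thesis
    using norm_add_scaleR_sq[of x 1 y] by (simp add: algebra_simps)
qed

lemma L2_add:
  assumes "L2 M f" "L2 M g"
  shows "L2 M (\<lambda>x. f x + g x)"
proof (rule L2_bound)
  show "integrable M (\<lambda>x. 2 * (norm (f x))\<^sup>2 + 2 * (norm (g x))\<^sup>2)"
    using assms by (auto simp: L2_def)
  show "AE x in M. (norm (f x + g x))\<^sup>2 \<le> 2 * (norm (f x))\<^sup>2 + 2 * (norm (g x))\<^sup>2"
    using norm_add_sq_le[of 1 "f _" "g _"] by simp
qed (use assms in \<open>auto simp: L2_def\<close>)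

lemma L2_scaleR: "L2 M f \<Longrightarrow> L2 M (\<lambda>x. c *\<^sub>R f x)"
  by (rule L2_bounded_linear[OF bounded_linear_scaleR_right])

lemma L2_uminus: "L2 M f \<Longrightarrow> L2 M (\<lambda>x. - f x)"
  by (rule L2_bounded_linear[OF bounded_linear_minus[OF bounded_linear_ident]])

lemma L2_diff: "L2 M f \<Longrightarrow> L2 M g \<Longrightarrow> L2 M (\<lambda>x. f x - g x)"
  using L2_add[of M f "\<lambda>x. - g x"] L2_uminus[of M g] by simp

lemma L2_zero: "L2 M (\<lambda>x. 0)"
  by (simp add: L2_def)

lemma L2_sum: "finite I \<Longrightarrow> (\<And>i. i \<in> I \<Longrightarrow> L2 M (f i)) \<Longrightarrow> L2 M (\<lambda>x. \<Sum>i\<in>I. f i x)"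
proof (induction I rule: finite_induct)
  case (insert i I)
  then show ?case using L2_add[of M "f i" "\<lambda>x. \<Sum>i\<in>I. f i x"] by simp
qed (simp add: L2_zero)

lemma L2_Basis:
  fixes f :: "'a \<Rightarrow> 'b::euclidean_space"
  assumes "\<And>b. b \<in> Basis \<Longrightarrow> L2 M (\<lambda>x. f x \<bullet> b)"
  shows "L2 M f"
proof -
  have "L2 M (\<lambda>x. \<Sum>b\<in>Basis. (f x \<bullet> b) *\<^sub>R b)"
  proof (rule L2_sum)
    fix b :: 'b assume "b \<in> Basis"
    from L2_bounded_linear[OF bounded_linear_scaleR_left assms[OF this], of b]
    show "L2 M (\<lambda>x. (f x \<bullet> b) *\<^sub>R b)" .
  qed simp
  then show ?thesis by (simp add: euclidean_representation)
qed

lemma L2_vec: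
  fixes f :: "'a \<Rightarrow> 'b::euclidean_space ^ 'n::finite"
  assumes "\<And>i. L2 M (\<lambda>x. f x $ i)"
  shows "L2 M f"
proof (rule L2_Basis)
  fix b :: "'b ^ 'n" assume "b \<in> Basis"
  then obtain i u where b: "b = axis i u" "u \<in> Basis" by (auto simp: Basis_vec_def)
  have "L2 M (\<lambda>x. f x $ i \<bullet> u)"
    using L2_bounded_linear[OF bounded_linear_inner_left assms[of i], of u] .
  then show "L2 M (\<lambda>x. f x \<bullet> b)" by (simp add: b inner_axis)
qed

lemma L2_bounded:
  assumes "finite_measure M" "f \<in> borel_measurable M" "AE x in M. norm (f x) \<le> B"
  shows "L2 M f"
proof (rule L2_bound[OF assms(2)])
  show "integrable M (\<lambda>x. B\<^sup>2)" using assms(1) by (simp add: finite_measure.integrable_const)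
  show "AE x in M. (norm (f x))\<^sup>2 \<le> B\<^sup>2"
    using assms(3) by eventually_elim (simp add: power_mono)
qed

lemma L2_integrable:
  assumes "finite_measure M" "L2 M f"
  shows "integrable M f"
proof (rule Bochner_Integration.integrable_bound)
  show "integrable M (\<lambda>x. 1 + (norm (f x))\<^sup>2)"
    using assms by (auto simp: L2_def finite_measure.integrable_const)
  have "norm (f x) \<le> 1 + (norm (f x))\<^sup>2" for x
    using sum_squares_bound[of "norm (f x)" 1] norm_ge_zero[of "f x"] unfolding power_one by linarith
  then show "AE x in M. norm (f x) \<le> norm (1 + (norm (f x))\<^sup>2)" by simp
qed (use assms in \<open>auto simp: L2_def\<close>)

text \<open>Measurability of \<open>g\<close> is a separate assumption because \<open>M\<close> need
  not be complete.\<close>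

lemma L2_AE_cong:
  assumes "L2 M f" "g \<in> borel_measurable M" "AE x in M. f x = g x"
  shows "L2 M g"
proof (rule L2_bound[OF assms(2)])
  show "integrable M (\<lambda>x. (norm (f x))\<^sup>2)" using assms(1) by (simp add: L2_def)
  show "AE x in M. (norm (g x))\<^sup>2 \<le> (norm (f x))\<^sup>2" using assms(3) by eventually_elim simp
qed

lemma L2norm_sq: "(L2norm M f)\<^sup>2 = (LINT x|M. (norm (f x))\<^sup>2)"
  by (simp add: L2norm_def)

lemma L2norm_nonneg: "0 \<le> L2norm M f"
  by (simp add: L2norm_def)

lemma L2norm_AE_cong:
  assumes "f \<in> borel_measurable M" "g \<in> borel_measurable M" "AE x in M. f x = g x"
  shows "L2norm M f = L2norm M g"
proof -
  have "AE x in M. (norm (f x))\<^sup>2 = (norm (g x))\<^sup>2" using assms(3) by eventually_elim simp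
  then have "(LINT x|M. (norm (f x))\<^sup>2) = (LINT x|M. (norm (g x))\<^sup>2)"
    using assms(1,2) by (intro integral_cong_AE) simp_all
  then show ?thesis by (simp add: L2norm_def)
qed

text \<open>Cauchy-Schwarz through the discriminant: the squared norm of \<open>f + t g\<close> is a
  quadratic polynomial in \<open>t\<close> without negative values.\<close>

lemma L2_inner_bound:
  assumes "L2 M f" "L2 M g"
  shows "\<bar>LINT x|M. f x \<bullet> g x\<bar> \<le> L2norm M f * L2norm M g"
proof -
  define a b c where "a = (LINT x|M. (norm (f x))\<^sup>2)" and "b = (LINT x|M. (norm (g x))\<^sup>2)"
    and "c = (LINT x|M. f x \<bullet> g x)"
  have *: "0 \<le> a + 2 * t * c + t\<^sup>2 * b" for t
  proof -
    have "0 \<le> (LINT x|M. (norm (f x + t *\<^sub>R g x))\<^sup>2)" by simp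
    also have "\<dots> = (LINT x|M. (norm (f x))\<^sup>2 + 2 * t * (f x \<bullet> g x) + t\<^sup>2 * (norm (g x))\<^sup>2)"
      by (simp only: norm_add_scaleR_sq)
    also have "\<dots> = a + 2 * t * c + t\<^sup>2 * b"
      unfolding a_def b_def c_def using assms L2_inner_integrable[OF assms] by (simp add: L2_def)
    finally show ?thesis .
  qed
  have nn: "a \<ge> 0" "b \<ge> 0" by (auto simp: a_def b_def)
  have "c\<^sup>2 \<le> a * b"
  proof (cases "b = 0")
    case True
    have "c = 0"
    proof (rule ccontr)
      assume "c \<noteq> 0"
      \<comment> \<open>With \<open>b = 0\<close> the polynomial is affine and takes the value -1 at
        this point.\<close>
      then show False using *[of "- (a + 1) / (2 * c)"] True by (simp add: field_simps)
    qed
    then show ?thesis using True by simp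
  next
    case False
    then have "b > 0" using nn by simp
    \<comment> \<open>The polynomial is minimal at \<open>t = - c / b\<close>.\<close>
    have "0 \<le> a + 2 * (- c / b) * c + (- c / b)\<^sup>2 * b" by (rule *)
    also have "\<dots> = a - c\<^sup>2 / b" using \<open>b > 0\<close> by (simp add: power2_eq_square divide_simps)
    finally show ?thesis using \<open>b > 0\<close> by (simp add: field_simps)
  qed
  then have "\<bar>c\<bar> \<le> sqrt (a * b)" using real_sqrt_le_mono[of "c\<^sup>2" "a * b"] by simp
  then show ?thesis by (simp add: L2norm_def a_def b_def c_def real_sqrt_mult)
qed

text \<open>The splitting \<open>fg - FG = (f-F)(g-G) + (f-F)G + F(g-G)\<close> and Cauchy-Schwarz
  reduce the claim to null sequences. It carries Green's formula from C1 fields to their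
  limits.\<close>

lemma L2_inner_tendsto:
  assumes L2: "\<And>k. L2 M (f k)" "L2 M F" "\<And>k. L2 M (g k)" "L2 M G"
    and lim: "(\<lambda>k. L2norm M (\<lambda>x. f k x - F x)) \<longlonglongrightarrow> 0" "(\<lambda>k. L2norm M (\<lambda>x. g k x - G x)) \<longlonglongrightarrow> 0"
  shows "(\<lambda>k. LINT x|M. f k x \<bullet> g k x) \<longlonglongrightarrow> (LINT x|M. F x \<bullet> G x)"
proof (rule LIM_zero_cancel, rule Lim_null_comparison)
  let ?a = "\<lambda>k. L2norm M (\<lambda>x. f k x - F x)" and ?b = "\<lambda>k. L2norm M (\<lambda>x. g k x - G x)"
  show "(\<lambda>k. ?a k * ?b k + ?a k * L2norm M G + L2norm M F * ?b k) \<longlonglongrightarrow> 0"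
    using tendsto_add[OF tendsto_add[OF tendsto_mult_zero[OF lim] tendsto_mult_left_zero[OF lim(1)]]
        tendsto_mult_right_zero[OF lim(2)]] unfolding add_0 .
  have "norm ((LINT x|M. f k x \<bullet> g k x) - (LINT x|M. F x \<bullet> G x))
      \<le> ?a k * ?b k + ?a k * L2norm M G + L2norm M F * ?b k" for k
  proof -
    note d = L2_diff[OF L2(1,2), of k] L2_diff[OF L2(3,4), of k]
    note i = L2_inner_integrable[OF d] L2_inner_integrable[OF d(1) L2(4)] L2_inner_integrable[OF L2(2) d(2)]
    have "(LINT x|M. f k x \<bullet> g k x) - (LINT x|M. F x \<bullet> G x)
      = (LINT x|M. f k x \<bullet> g k x - F x \<bullet> G x)"
      by (rule Bochner_Integration.integral_diff[symmetric]; rule L2_inner_integrable; rule L2)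
    also have "\<dots> = (LINT x|M. (f k x - F x) \<bullet> (g k x - G x) + (f k x - F x) \<bullet> G x + F x \<bullet> (g k x - G x))"
      by (intro Bochner_Integration.integral_cong refl) (simp add: inner_diff_left inner_diff_right)
    also have "\<dots> = (LINT x|M. (f k x - F x) \<bullet> (g k x - G x)) + (LINT x|M. (f k x - F x) \<bullet> G x)
        + (LINT x|M. F x \<bullet> (g k x - G x))"
      by (simp only: i Bochner_Integration.integral_add Bochner_Integration.integrable_add)
    finally show ?thesis
      unfolding real_norm_def
      using L2_inner_bound[OF d] L2_inner_bound[OF d(1) L2(4)] L2_inner_bound[OF L2(2) d(2)] by linarith
  qed
  then show "\<forall>\<^sub>F k in sequentially. norm ((LINT x|M. f k x \<bullet> g k x) - (LINT x|M. F x \<bullet> G x))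
      \<le> ?a k * ?b k + ?a k * L2norm M G + L2norm M F * ?b k" by (intro always_eventually allI)
qed

lemma L2norm_bounded_linear_tendsto:
  assumes "bounded_linear h" "\<And>k. L2 M (f k)" "(\<lambda>k. L2norm M (f k)) \<longlonglongrightarrow> 0"
  shows "(\<lambda>k. L2norm M (\<lambda>x. h (f k x))) \<longlonglongrightarrow> 0"
proof -
  interpret bounded_linear h by fact
  obtain K where K: "K > 0" "\<And>x. norm (h x) \<le> norm x * K" using pos_bounded by auto
  have "L2norm M (\<lambda>x. h (f k x)) \<le> K * L2norm M (f k)" for k
  proof -
    have "(LINT x|M. (norm (h (f k x)))\<^sup>2) \<le> (LINT x|M. K\<^sup>2 * (norm (f k x))\<^sup>2)"
    proof (rule integral_mono)
      show "integrable M (\<lambda>x. (norm (h (f k x)))\<^sup>2)"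
        using L2_bounded_linear[OF assms(1,2)] by (simp add: L2_def)
      show "integrable M (\<lambda>x. K\<^sup>2 * (norm (f k x))\<^sup>2)" using assms(2) by (simp add: L2_def)
      show "(norm (h (f k x)))\<^sup>2 \<le> K\<^sup>2 * (norm (f k x))\<^sup>2" for x
        using power_mono[OF K(2)[of "f k x"] norm_ge_zero, of 2] by (simp add: power_mult_distrib mult.commute)
    qed
    then have "sqrt (LINT x|M. (norm (h (f k x)))\<^sup>2) \<le> sqrt (K\<^sup>2 * (LINT x|M. (norm (f k x))\<^sup>2))"
      by simp
    then show ?thesis using K(1) by (simp add: L2norm_def real_sqrt_mult)
  qed
  then have "norm (L2norm M (\<lambda>x. h (f k x))) \<le> K * L2norm M (f k)" for k
    by (simp add: L2norm_nonneg)
  then have "\<forall>\<^sub>F k in sequentially. norm (L2norm M (\<lambda>x. h (f k x))) \<le> K * L2norm M (f k)"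
    by (intro always_eventually allI)
  then show ?thesis
    by (rule Lim_null_comparison) (rule tendsto_mult_right_zero[OF assms(3)])
qed

section \<open>Functions of time and space\<close>

abbreviation itv :: "real \<Rightarrow> real \<Rightarrow> real measure" where
  "itv a b \<equiv> restrict_space lborel {a..b}"

lemma space_itv: "space (itv a b) = {a..b}"
  by (simp add: space_restrict_space)

lemma finite_itv: "finite_measure (itv a b)"
  by (rule finite_measureI) (simp add: emeasure_restrict_space space_itv emeasure_lborel_Icc_eq)

lemma measurable_ident_itv: "(\<lambda>t. t) \<in> borel_measurable (itv a b)"
  by (rule measurable_restrict_space1) simp

lemma measurable_fst_itv: "fst \<in> borel_measurable (itv a b \<Otimes>\<^sub>M N)"
  by (rule measurable_compose[OF measurable_fst measurable_ident_itv])

lemma measurable_snd_itv: "snd \<in> borel_measurable (N \<Otimes>\<^sub>M itv a b)"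
  by (rule measurable_compose[OF measurable_snd measurable_ident_itv])

lemma AE_itv: "(AE t in itv a b. P t) \<longleftrightarrow> (AE t in lborel. a \<le> t \<and> t \<le> b \<longrightarrow> P t)"
  by (simp add: AE_restrict_space_iff)

lemma AE_itv_sub: "(AE t in itv a b. P t) \<Longrightarrow> a \<le> c \<Longrightarrow> d \<le> b \<Longrightarrow> (AE t in itv c d. P t)"
  unfolding AE_itv by (erule eventually_mono) auto

lemma AE_itv_in: "AE t in itv a b. a \<le> t \<and> t \<le> b"
  by (simp add: AE_itv)

text \<open>An interval of positive length is not a null set. This extracts one good time from an
  almost-everywhere statement.\<close>

lemma AE_itv_exists:
  assumes "AE t in itv a b. P t" "a < b"
  shows "\<exists>t. a \<le> t \<and> t \<le> b \<and> P t"
proof (rule ccontr)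
  assume "\<not> ?thesis"
  then have "AE t in itv a b. False"
    using eventually_mono[OF eventually_conj[OF assms(1) AE_itv_in]] by blast
  moreover have "emeasure (itv a b) (space (itv a b)) = ennreal (b - a)"
    using assms(2) by (simp add: emeasure_restrict_space space_itv)
  ultimately show False using assms(2) by (simp add: eventually_False ae_filter_eq_bot_iff)
qed

lemma set_integral_itv:
  fixes f :: "real \<Rightarrow> 'b::euclidean_space"
  shows "(LINT t:{a..b}|lborel. f t) = (LINT t|itv a b. f t)"
  by (simp add: integral_restrict_space set_lebesgue_integral_def)

lemma itv_integrable_sub:
  fixes f :: "real \<Rightarrow> 'b::euclidean_space"
  assumes "integrable (itv a b) f" "a \<le> c" "d \<le> b"
  shows "integrable (itv c d) f"
proof -
  have "set_integrable lborel {c..d} f"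
    by (rule set_integrable_subset[of lborel "{a..b}"])
      (use assms in \<open>auto simp: integrable_restrict_space set_integrable_def\<close>)
  then show ?thesis by (simp add: integrable_restrict_space set_integrable_def)
qed

lemma itv_integral_split:
  fixes f :: "real \<Rightarrow> 'b::euclidean_space"
  assumes "integrable (itv a b) f" "a \<le> c" "c \<le> b"
  shows "(LINT t|itv a b. f t) = (LINT t|itv a c. f t) + (LINT t|itv c b. f t)"
proof -
  have i: "integrable lborel (\<lambda>t. indicator {p..q} t *\<^sub>R f t)" if "a \<le> p" "q \<le> b" for p q
    using itv_integrable_sub[OF assms(1) that] by (simp add: integrable_restrict_space)
  have "(LINT t|itv a b. f t) = (LINT t|lborel. indicator {a..b} t *\<^sub>R f t)"
    by (simp add: integral_restrict_space)
  also have "\<dots> = (LINT t|lborel. indicator {a..c} t *\<^sub>R f t + indicator {c..b} t *\<^sub>R f t)"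
  proof (rule integral_cong_AE)
    have "AE t in lborel. t \<noteq> c" by (rule AE_lborel_singleton)
    then show "AE t in lborel. indicator {a..b} t *\<^sub>R f t = indicator {a..c} t *\<^sub>R f t + indicator {c..b} t *\<^sub>R f t"
      by eventually_elim (use assms in \<open>auto simp: indicator_def\<close>)
  qed (use i assms in \<open>auto intro!: borel_measurable_add borel_measurable_integrable simp del: borel_measurable_scaleR\<close>)
  also have "\<dots> = (LINT t|itv a c. f t) + (LINT t|itv c b. f t)"
    using i[of a c] i[of c b] assms by (simp add: integral_restrict_space)
  finally show ?thesis .
qed

lemma itv_integral_mono_set:
  fixes f :: "real \<Rightarrow> real"
  assumes "integrable (itv a b) f" "a \<le> c" "d \<le> b" "\<And>t. 0 \<le> f t"
  shows "(LINT t|itv c d. f t) \<le> (LINT t|itv a b. f t)"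
proof -
  have "(LINT t|lborel. indicator {c..d} t *\<^sub>R f t) \<le> (LINT t|lborel. indicator {a..b} t *\<^sub>R f t)"
  proof (rule integral_mono)
  show "integrable lborel (\<lambda>t. indicator {c..d} t *\<^sub>R f t)" "integrable lborel (\<lambda>t. indicator {a..b} t *\<^sub>R f t)"
    using assms(1) itv_integrable_sub[OF assms(1-3)] by (auto simp: integrable_restrict_space)
  show "indicator {c..d} t *\<^sub>R f t \<le> indicator {a..b} t *\<^sub>R f t" for t
    using assms(2-4) by (auto simp: indicator_def)
  qed
  then show ?thesis by (simp add: integral_restrict_space)
qed

lemma integrable_pair_fst:
  fixes g :: "'a \<Rightarrow> 'c::euclidean_space"
  assumes "finite_measure M1" "finite_measure M2" "integrable M1 g"
  shows "integrable (M1 \<Otimes>\<^sub>M M2) (\<lambda>(x, y). g x)"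
proof -
  interpret M1: finite_measure M1 by fact
  interpret M2: finite_measure M2 by fact
  interpret pair_sigma_finite M1 M2 ..
  have [measurable]: "g \<in> borel_measurable M1" using assms(3) by simp
  show ?thesis
    by (rule Fubini_integrable) (use assms(3) in \<open>auto simp: M2.integrable_const\<close>)
qed

lemma integrable_pair_snd:
  fixes g :: "'a \<Rightarrow> 'c::euclidean_space"
  assumes "finite_measure M1" "finite_measure M2" "integrable M2 g"
  shows "integrable (M1 \<Otimes>\<^sub>M M2) (\<lambda>(x, y). g y)"
proof -
  interpret M1: finite_measure M1 by fact
  interpret M2: finite_measure M2 by fact
  interpret pair_sigma_finite M2 M1 ..
  interpret Q: pair_sigma_finite M1 M2 ..
  show ?thesis
    using integrable_pair_fst[OF assms(2,1,3)] Q.integrable_product_swap_iff[of "\<lambda>(x, y). g y"]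
    by (simp add: case_prod_beta')
qed

lemma L2_const: "finite_measure M \<Longrightarrow> L2 M (\<lambda>x. c)"
  by (rule L2_bounded[where B="norm c"]) auto

text \<open>By symmetry, the double integral of \<open>f s \<bullet> f t\<close> over the square is twice the one over the
  triangle \<open>s \<le> t\<close>.\<close>

lemma integral_inner_primitive:
  fixes f :: "real \<Rightarrow> 'b::euclidean_space"
  assumes f: "L2 (itv a b) f"
  shows "2 * (LINT t|itv a b. (LINT s|itv a t. f s) \<bullet> f t) = (norm (LINT t|itv a b. f t))\<^sup>2"
proof -
  let ?I = "itv a b"
  interpret I: finite_measure ?I by (rule finite_itv)
  interpret pair_sigma_finite ?I ?I ..
  have [measurable]: "f \<in> borel_measurable ?I" using f by (simp add: L2_def)
  have int: "integrable ?I f" by (rule L2_integrable[OF finite_itv f])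
  have n2: "integrable ?I (\<lambda>t. (norm (f t))\<^sup>2)" using f by (simp add: L2_def)
  have i: "integrable (?I \<Otimes>\<^sub>M ?I) (\<lambda>(s, t). f s \<bullet> f t)"
    unfolding case_prod_beta'
    by (rule L2_inner_integrable)
      (use integrable_pair_fst[OF finite_itv finite_itv n2] integrable_pair_snd[OF finite_itv finite_itv n2]
        in \<open>auto simp: L2_def case_prod_beta'\<close>)
  \<comment> \<open>\<open>h\<close> lives on the closed triangle \<open>s <= t\<close> and
    \<open>k\<close> on the open one \<open>t < s\<close>, so that they add up to the full integrand
    without overlap on the diagonal.\<close>
  define h k where "h = (\<lambda>s t. indicator {s..} t * (f s \<bullet> f t) :: real)"
    and "k = (\<lambda>s t. indicator {t<..} s * (f s \<bullet> f t) :: real)"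
  have meas[measurable]: "(\<lambda>x. indicator {fst x..} (snd x) :: real) \<in> borel_measurable (?I \<Otimes>\<^sub>M ?I)"
    "(\<lambda>x. indicator {snd x<..} (fst x) :: real) \<in> borel_measurable (?I \<Otimes>\<^sub>M ?I)"
    "(\<lambda>x. indicator {..snd x} (fst x) :: real) \<in> borel_measurable (?I \<Otimes>\<^sub>M ?I)"
  proof -
    note [measurable] = measurable_fst_itv measurable_snd_itv
    show "(\<lambda>x. indicator {fst x..} (snd x) :: real) \<in> borel_measurable (?I \<Otimes>\<^sub>M ?I)"
      "(\<lambda>x. indicator {snd x<..} (fst x) :: real) \<in> borel_measurable (?I \<Otimes>\<^sub>M ?I)"
      "(\<lambda>x. indicator {..snd x} (fst x) :: real) \<in> borel_measurable (?I \<Otimes>\<^sub>M ?I)"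
      unfolding indicator_def by (auto intro!: measurable_If)
  qed
  have hi: "integrable (?I \<Otimes>\<^sub>M ?I) (\<lambda>(s, t). h s t)"
  proof (rule Bochner_Integration.integrable_bound[OF i])
    show "(\<lambda>(s, t). h s t) \<in> borel_measurable (?I \<Otimes>\<^sub>M ?I)"
      unfolding h_def case_prod_beta' by measurable
  qed (auto simp: h_def indicator_def)
  have ki: "integrable (?I \<Otimes>\<^sub>M ?I) (\<lambda>(s, t). k s t)"
  proof (rule Bochner_Integration.integrable_bound[OF i])
    show "(\<lambda>(s, t). k s t) \<in> borel_measurable (?I \<Otimes>\<^sub>M ?I)"
      unfolding k_def case_prod_beta' by measurable
  qed (auto simp: k_def indicator_def)
  have in1: "(LINT s|?I. indicator {..t} s *\<^sub>R f s) = (LINT s|itv a t. f s)" if "t \<le> b" for t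
  proof -
    have "(LINT s|?I. indicator {..t} s *\<^sub>R f s) = (LINT s|lborel. indicator {a..b} s *\<^sub>R (indicator {..t} s *\<^sub>R f s))"
      by (simp add: integral_restrict_space)
    also have "\<dots> = (LINT s|lborel. indicator {a..t} s *\<^sub>R f s)"
      by (rule Bochner_Integration.integral_cong) (use that in \<open>auto simp: indicator_def\<close>)
    finally show ?thesis by (simp add: integral_restrict_space)
  qed
  have fi: "integrable ?I (\<lambda>s. indicator {..t} s *\<^sub>R f s)" for t
  proof (rule Bochner_Integration.integrable_bound[OF int])
    have [measurable]: "(\<lambda>s. indicator {..t} s :: real) \<in> borel_measurable ?I"
      by (rule measurable_restrict_space1) simp
    show "(\<lambda>s. indicator {..t} s *\<^sub>R f s) \<in> borel_measurable ?I" by measurable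
  qed (auto simp: indicator_def)
  have H: "(LINT t|?I. (LINT s|?I. h s t)) = (LINT t|?I. (LINT s|itv a t. f s) \<bullet> f t)"
  proof (rule Bochner_Integration.integral_cong[OF refl])
    fix t assume "t \<in> space ?I"
    then have "t \<le> b" by (simp add: space_itv)
    have "(LINT s|?I. h s t) = (LINT s|?I. (indicator {..t} s *\<^sub>R f s) \<bullet> f t)"
      by (rule Bochner_Integration.integral_cong) (auto simp: h_def indicator_def)
    also have "\<dots> = (LINT s|itv a t. f s) \<bullet> f t"
      using fi[of t] by (simp only: integral_inner_left in1[OF \<open>t \<le> b\<close>])
    finally show "(LINT s|?I. h s t) = (LINT s|itv a t. f s) \<bullet> f t" .
  qed
  \<comment> \<open>Renaming the variables turns the second triangle into \<open>s < t\<close>,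
    which differs from \<open>s <= t\<close> in a single point for each \<open>t\<close>.\<close>
  have K: "(LINT s|?I. (LINT t|?I. k s t)) = (LINT t|?I. (LINT s|itv a t. f s) \<bullet> f t)"
  proof (rule Bochner_Integration.integral_cong[OF refl])
    fix t assume "t \<in> space ?I"
    then have "t \<le> b" by (simp add: space_itv)
    have "AE s in lborel. s \<noteq> t" by (rule AE_lborel_singleton)
    then have "AE s in ?I. s \<noteq> t" unfolding AE_itv by eventually_elim auto
    then have ae: "AE s in ?I. k t s = (indicator {..t} s *\<^sub>R f s) \<bullet> f t"
      by eventually_elim (auto simp: k_def indicator_def inner_commute)
    have "(LINT s|?I. k t s) = (LINT s|?I. (indicator {..t} s *\<^sub>R f s) \<bullet> f t)"
    proof (rule integral_cong_AE[OF _ _ ae])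
      show "(\<lambda>s. (indicator {..t} s *\<^sub>R f s) \<bullet> f t) \<in> borel_measurable ?I"
        using fi[of t] by (intro borel_measurable_inner) auto
      have [measurable]: "(\<lambda>s. indicator {s<..} t :: real) \<in> borel_measurable ?I"
        by (rule measurable_restrict_space1) (auto simp: indicator_def)
      show "k t \<in> borel_measurable ?I" unfolding k_def by measurable
    qed
    also have "\<dots> = (LINT s|itv a t. f s) \<bullet> f t"
      using fi[of t] by (simp only: integral_inner_left in1[OF \<open>t \<le> b\<close>])
    finally show "(LINT s|?I. k t s) = (LINT s|itv a t. f s) \<bullet> f t" .
  qed
  have "(norm (LINT t|?I. f t))\<^sup>2 = (LINT s|?I. (LINT t|?I. f s \<bullet> f t))"
    using int by (simp add: power2_norm_eq_inner)
  also have "\<dots> = integral\<^sup>L (?I \<Otimes>\<^sub>M ?I) (\<lambda>(s, t). f s \<bullet> f t)"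
    by (rule integral_fst[OF i])
  also have "\<dots> = integral\<^sup>L (?I \<Otimes>\<^sub>M ?I) (\<lambda>x. (case x of (s, t) \<Rightarrow> h s t) + (case x of (s, t) \<Rightarrow> k s t))"
    by (rule Bochner_Integration.integral_cong) (auto simp: h_def k_def indicator_def)
  also have "\<dots> = integral\<^sup>L (?I \<Otimes>\<^sub>M ?I) (\<lambda>(s, t). h s t) + integral\<^sup>L (?I \<Otimes>\<^sub>M ?I) (\<lambda>(s, t). k s t)"
    by (rule Bochner_Integration.integral_add[OF hi ki])
  also have "\<dots> = 2 * (LINT t|?I. (LINT s|itv a t. f s) \<bullet> f t)"
    unfolding integral_snd[OF hi, symmetric] integral_fst[OF ki, symmetric] H K by simp
  finally show ?thesis by simp
qed

text \<open>The chain rule for \<open>|v + F t|^2\<close>, with \<open>F\<close> the primitive of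
  \<open>f\<close>, in integrated form. No pointwise derivative of \<open>F\<close> is taken:
  expanding the square leaves a linear term and the double integral of
  \<open>integral_inner_primitive\<close>.\<close>

lemma norm_sq_primitive:
  fixes f :: "real \<Rightarrow> 'b::euclidean_space"
  assumes f: "L2 (itv a b) f"
  shows "(norm (v + (LINT t|itv a b. f t)))\<^sup>2 - (norm v)\<^sup>2
     = 2 * (LINT t|itv a b. (v + (LINT s|itv a t. f s)) \<bullet> f t)"
proof -
  let ?I = "itv a b"
  interpret I: finite_measure ?I by (rule finite_itv)
  have int: "integrable ?I f" by (rule L2_integrable[OF finite_itv f])
  have fm: "f \<in> borel_measurable ?I" using f by (simp add: L2_def)
  \<comment> \<open>Rewriting the variable upper limit as an indicator on a fixed interval makes the
    primitive a parameter integral, whose measurability in \<open>t\<close> is part of Fubini's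
    theorem.\<close>
  have "(\<lambda>t. LINT s|?I. (indicator {s..} t) *\<^sub>R f s) \<in> borel_measurable ?I"
  proof (rule I.borel_measurable_lebesgue_integral)
    note m = measurable_fst_itv[of a b ?I] measurable_snd_itv[of ?I a b]
    have "(\<lambda>x. (if snd x \<le> fst x then 1 else 0 :: real) *\<^sub>R f (snd x)) \<in> borel_measurable (?I \<Otimes>\<^sub>M ?I)"
      using m measurable_compose[OF measurable_snd fm] by measurable
    then show "(\<lambda>(t, s). indicator {s..} t *\<^sub>R f s) \<in> borel_measurable (?I \<Otimes>\<^sub>M ?I)"
      by (simp add: case_prod_beta' indicator_def of_bool_def)
  qed
  moreover have "(LINT s|?I. (indicator {s..} t) *\<^sub>R f s) = (LINT s|itv a t. f s)" if "t \<in> space ?I" for t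
  proof -
    have "(LINT s|lborel. indicator {a..b} s *\<^sub>R (indicator {s..} t *\<^sub>R f s))
        = (LINT s|lborel. indicator {a..t} s *\<^sub>R f s)"
      by (rule Bochner_Integration.integral_cong) (use that in \<open>auto simp: indicator_def space_itv\<close>)
    then show ?thesis by (simp add: integral_restrict_space)
  qed
  ultimately have m: "(\<lambda>t. LINT s|itv a t. f s) \<in> borel_measurable ?I"
    by (rule measurable_cong[THEN iffD1, rotated])
  have bd: "norm (LINT s|itv a t. f s) \<le> (LINT s|?I. norm (f s))" if "t \<le> b" for t
  proof -
    have "norm (LINT s|itv a t. f s) \<le> (LINT s|itv a t. norm (f s))" by (rule integral_norm_bound)
    also have "\<dots> \<le> (LINT s|?I. norm (f s))"
      by (rule itv_integral_mono_set) (use int that in auto)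
    finally show ?thesis .
  qed
  have L: "L2 ?I (\<lambda>t. LINT s|itv a t. f s)"
    by (rule L2_bounded[OF finite_itv m, of "LINT s|?I. norm (f s)"])
      (use bd in \<open>auto simp: AE_itv\<close>)
  have "(LINT t|?I. (v + (LINT s|itv a t. f s)) \<bullet> f t)
      = v \<bullet> (LINT t|?I. f t) + (LINT t|?I. (LINT s|itv a t. f s) \<bullet> f t)"
    using int L2_inner_integrable[OF L f] by (simp add: inner_add_left)
  then show ?thesis
    using integral_inner_primitive[OF f] norm_add_scaleR_sq[of v 1 "LINT t|?I. f t"] by simp
qed

text \<open>Cauchy-Schwarz against the constant function whose value is the integral itself,
  followed by division by its norm. The factor \<open>b - a\<close> becomes one of the two powers of
  the step size in the consistency error of a step.\<close>

lemma norm_primitive_sq_le: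
  fixes f :: "real \<Rightarrow> 'b::euclidean_space"
  assumes "L2 (itv a b) f" "a \<le> b"
  shows "(norm (LINT t|itv a b. f t))\<^sup>2 \<le> (b - a) * (LINT t|itv a b. (norm (f t))\<^sup>2)"
proof -
  let ?v = "LINT t|itv a b. f t"
  have "?v \<bullet> ?v = (LINT t|itv a b. f t \<bullet> ?v)"
    using L2_integrable[OF finite_itv assms(1)] by simp
  also have "\<dots> \<le> L2norm (itv a b) f * L2norm (itv a b) (\<lambda>t. ?v)"
    using L2_inner_bound[OF assms(1) L2_const[OF finite_itv, of _ _ ?v]] by linarith
  also have "L2norm (itv a b) (\<lambda>t. ?v) = sqrt (b - a) * norm ?v"
    using assms(2) by (simp add: L2norm_def measure_restrict_space space_itv real_sqrt_mult)
  finally have "norm ?v * norm ?v \<le> (L2norm (itv a b) f * sqrt (b - a)) * norm ?v"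
    by (simp add: power2_norm_eq_inner[symmetric] power2_eq_square mult_ac)
  then have "norm ?v \<le> L2norm (itv a b) f * sqrt (b - a)"
    by (cases "?v = 0") (auto simp: L2norm_nonneg assms(2))
  from power_mono[OF this norm_ge_zero, of 2] show ?thesis
    using assms(2) by (simp add: power_mult_distrib L2norm_sq mult.commute)
qed

section \<open>Square integrable functions of time and space\<close>

lemma pair_sigma_finite_itv: "finite_measure M \<Longrightarrow> pair_sigma_finite (itv a b) M"
  by (intro pair_sigma_finite.intro finite_measure.axioms finite_itv)
    (auto dest: finite_measure.axioms)

lemma L2L2_section:
  assumes "L2L2 M a b v" "a \<le> t" "t \<le> b"
  shows "v t \<in> borel_measurable M"
proof -
  have "(\<lambda>(t, x). v t x) \<in> borel_measurable (itv a b \<Otimes>\<^sub>M M)"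
    using assms(1) by (simp add: L2L2_def L2_def)
  from measurable_Pair2[OF this, of t] show ?thesis using assms(2,3) by (simp add: space_itv)
qed

lemma L2L2_bounded_linear:
  assumes "bounded_linear h" "L2L2 M a b v"
  shows "L2L2 M a b (\<lambda>t x. h (v t x))"
  using L2_bounded_linear[OF assms(1) assms(2)[unfolded L2L2_def]]
  by (simp add: L2L2_def case_prod_beta')

lemma L2L2_add: "L2L2 M a b v \<Longrightarrow> L2L2 M a b w \<Longrightarrow> L2L2 M a b (\<lambda>t x. v t x + w t x)"
  unfolding L2L2_def case_prod_beta' by (rule L2_add)

lemma L2L2_diff: "L2L2 M a b v \<Longrightarrow> L2L2 M a b w \<Longrightarrow> L2L2 M a b (\<lambda>t x. v t x - w t x)"
  unfolding L2L2_def case_prod_beta' by (rule L2_diff)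

lemma L2L2_vec:
  fixes v :: "real \<Rightarrow> 'a \<Rightarrow> 'b::euclidean_space ^ 'n::finite"
  assumes "\<And>i. L2L2 M a b (\<lambda>t x. v t x $ i)"
  shows "L2L2 M a b v"
  using assms unfolding L2L2_def case_prod_beta' by (intro L2_vec)

text \<open>Exchanging two almost-everywhere quantifiers requires a measurable set, which this
  provides.\<close>

lemma L2L2_eq_sets:
  assumes "L2L2 M a b v" "L2L2 M a b w"
  shows "{p \<in> space (itv a b \<Otimes>\<^sub>M M). v (fst p) (snd p) = w (fst p) (snd p)} \<in> sets (itv a b \<Otimes>\<^sub>M M)"
proof -
  have "(\<lambda>p. v (fst p) (snd p) - w (fst p) (snd p)) \<in> borel_measurable (itv a b \<Otimes>\<^sub>M M)"
    using L2L2_diff[OF assms] unfolding L2L2_def L2_def case_prod_beta' by simp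
  from measurable_sets[OF this, of "{0}"] show ?thesis by (simp add: vimage_def Int_def conj_commute)
qed

lemma
  assumes "finite_measure M" "L2L2 M a b v"
  shows L2L2_AE_space: "AE t in itv a b. L2 M (v t)"
    and L2L2_AE_time: "AE x in M. L2 (itv a b) (\<lambda>t. v t x)"
proof -
  interpret pair_sigma_finite "itv a b" M by (rule pair_sigma_finite_itv[OF assms(1)])
  have m: "(\<lambda>(t, x). v t x) \<in> borel_measurable (itv a b \<Otimes>\<^sub>M M)"
    and i: "integrable (itv a b \<Otimes>\<^sub>M M) (\<lambda>(t, x). (norm (v t x))\<^sup>2)"
    using assms(2) by (auto simp: L2L2_def L2_def case_prod_beta')
  show "AE t in itv a b. L2 M (v t)"
    using AE_integrable_fst'[OF i] AE_itv_in
    by eventually_elim (auto simp: L2_def intro: L2L2_section[OF assms(2)])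
  show "AE x in M. L2 (itv a b) (\<lambda>t. v t x)"
    using AE_integrable_snd[OF i] AE_space
    by eventually_elim (use measurable_Pair1[OF m] in \<open>auto simp: L2_def\<close>)
qed

lemma L2L2_integrable_inner:
  assumes "L2L2 M a b v" "L2L2 M a b w"
  shows "integrable (itv a b \<Otimes>\<^sub>M M) (\<lambda>(t, x). v t x \<bullet> w t x)"
  using L2_inner_integrable[OF assms[unfolded L2L2_def]] by (simp add: case_prod_beta')

lemma
  assumes "finite_measure M" "L2L2 M a b v" "L2L2 M a b w"
  shows L2L2_inner_time_integrable: "integrable (itv a b) (\<lambda>t. LINT x|M. v t x \<bullet> w t x)"
    and L2L2_inner_space_integrable: "integrable M (\<lambda>x. LINT t|itv a b. v t x \<bullet> w t x)"
    and L2L2_inner_Fubini: "(LINT x|M. LINT t|itv a b. v t x \<bullet> w t x) = (LINT t|itv a b. LINT x|M. v t x \<bullet> w t x)"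
proof -
  interpret pair_sigma_finite "itv a b" M by (rule pair_sigma_finite_itv[OF assms(1)])
  note i = L2L2_integrable_inner[OF assms(2,3)]
  show "integrable (itv a b) (\<lambda>t. LINT x|M. v t x \<bullet> w t x)"
    using integrable_fst'[OF i] by simp
  show "integrable M (\<lambda>x. LINT t|itv a b. v t x \<bullet> w t x)"
    using integrable_snd[OF i] by simp
  show "(LINT x|M. LINT t|itv a b. v t x \<bullet> w t x) = (LINT t|itv a b. LINT x|M. v t x \<bullet> w t x)"
    by (rule Fubini_integral[OF i])
qed

lemma L2L2_norm_integrable:
  assumes "finite_measure M" "L2L2 M a b v"
  shows "integrable (itv a b) (\<lambda>t. (L2norm M (v t))\<^sup>2)"
  using L2L2_inner_time_integrable[OF assms assms(2)] by (simp add: L2norm_sq power2_norm_eq_inner)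

lemma L2L2norm_sq: "(L2L2norm M a b v)\<^sup>2 = (LINT t|itv a b. (L2norm M (v t))\<^sup>2)"
  by (simp add: L2L2norm_def set_integral_itv)

text \<open>Measurability is pulled back along the inclusion of the intervals; integrability follows
  from Tonelli, since iterated integrals are easily restricted in time.\<close>

lemma L2L2_sub:
  assumes M: "finite_measure M" and v: "L2L2 M a b v" and "a \<le> c" "d \<le> b"
  shows "L2L2 M c d v"
proof -
  interpret P: pair_sigma_finite "itv a b" M by (rule pair_sigma_finite_itv[OF M])
  interpret Q: pair_sigma_finite "itv c d" M by (rule pair_sigma_finite_itv[OF M])
  have m: "(\<lambda>(t, x). v t x) \<in> borel_measurable (itv a b \<Otimes>\<^sub>M M)"
    and i: "integrable (itv a b \<Otimes>\<^sub>M M) (\<lambda>(t, x). (norm (v t x))\<^sup>2)"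
    using v by (auto simp: L2L2_def L2_def case_prod_beta')
  have "(\<lambda>t. t) \<in> itv c d \<rightarrow>\<^sub>M itv a b"
    using assms(3,4) by (intro measurable_restrict_space2 measurable_restrict_space1) (auto simp: space_itv)
  then have "(\<lambda>p. (fst p, snd p)) \<in> itv c d \<Otimes>\<^sub>M M \<rightarrow>\<^sub>M itv a b \<Otimes>\<^sub>M M"
    by (intro measurable_Pair measurable_snd measurable_compose[OF measurable_fst])
  from measurable_compose[OF this m] have m': "(\<lambda>(t, x). v t x) \<in> borel_measurable (itv c d \<Otimes>\<^sub>M M)"
    by (simp add: case_prod_beta')
  have "integrable (itv c d \<Otimes>\<^sub>M M) (\<lambda>(t, x). (norm (v t x))\<^sup>2)"
  proof (rule Q.Fubini_integrable)
    show "(\<lambda>(t, x). (norm (v t x))\<^sup>2) \<in> borel_measurable (itv c d \<Otimes>\<^sub>M M)"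
      using m' by (simp add: case_prod_beta')
    show "integrable (itv c d) (\<lambda>t. LINT x|M. norm (case (t, x) of (t, x) \<Rightarrow> (norm (v t x))\<^sup>2))"
      using itv_integrable_sub[OF P.integrable_fst'[OF i] assms(3,4)] by simp
    show "AE t in itv c d. integrable M (\<lambda>x. case (t, x) of (t, x) \<Rightarrow> (norm (v t x))\<^sup>2)"
      using AE_itv_sub[OF P.AE_integrable_fst'[OF i] assms(3,4)] by simp
  qed
  then show ?thesis using m' by (simp add: L2L2_def L2_def case_prod_beta')
qed

section \<open>Functions with a square integrable time derivative\<close>

lemma has_tderiv_primitive:
  "has_tderiv M a b v dv \<Longrightarrow> AE x in M. \<forall>t\<in>{a..b}. v t x = v a x + (LINT s|itv a t. dv s x)"
  by (simp add: has_tderiv_def set_integral_itv)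

text \<open>One null set serves all pairs \<open>c\<close>, \<open>d\<close>, because both values
  come from the same primitive starting at \<open>a\<close>. This is why the quantifiers stand
  inside the \<open>AE\<close>.\<close>

lemma has_tderiv_increment:
  assumes M: "finite_measure M" and v: "has_tderiv M a b v dv"
  shows "AE x in M. \<forall>c d. a \<le> c \<and> c \<le> d \<and> d \<le> b \<longrightarrow> v d x = v c x + (LINT s|itv c d. dv s x)"
proof -
  have "L2L2 M a b dv" using v by (simp add: has_tderiv_def)
  from L2L2_AE_time[OF M this] has_tderiv_primitive[OF v] show ?thesis
  proof eventually_elim
    case (elim x)
    have int: "integrable (itv a b) (\<lambda>t. dv t x)" by (rule L2_integrable[OF finite_itv elim(1)])
    show ?case
    proof safe
      fix c d assume *: "a \<le> c" "c \<le> d" "d \<le> b"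
      have "(LINT s|itv a d. dv s x) = (LINT s|itv a c. dv s x) + (LINT s|itv c d. dv s x)"
        by (rule itv_integral_split) (use * itv_integrable_sub[OF int] in auto)
      moreover have "v d x = v a x + (LINT s|itv a d. dv s x)" "v c x = v a x + (LINT s|itv a c. dv s x)"
        using * bspec[OF elim(2), of d] bspec[OF elim(2), of c] by auto
      ultimately show "v d x = v c x + (LINT s|itv c d. dv s x)" by simp
    qed
  qed
qed

lemma has_tderiv_increment_le:
  assumes M: "finite_measure M" and v: "has_tderiv M a b v dv"
  shows "AE x in M. \<forall>c d. a \<le> c \<and> c \<le> d \<and> d \<le> b \<longrightarrow>
      (norm (v d x - v c x))\<^sup>2 \<le> (d - c) * (LINT s|itv c d. (norm (dv s x))\<^sup>2)"
proof -
  have "L2L2 M a b dv" using v by (simp add: has_tderiv_def)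
  from L2L2_AE_time[OF M this] has_tderiv_increment[OF M v] show ?thesis
  proof eventually_elim
    case (elim x)
    show ?case
    proof (intro allI impI)
      fix c d assume *: "a \<le> c \<and> c \<le> d \<and> d \<le> b"
      have "integrable (itv c d) (\<lambda>s. (norm (dv s x))\<^sup>2)" "integrable (itv c d) (\<lambda>s. dv s x)"
        using elim(1) itv_integrable_sub[of a b "\<lambda>s. (norm (dv s x))\<^sup>2" c d]
          itv_integrable_sub[OF L2_integrable[OF finite_itv elim(1)], of c d] * by (auto simp: L2_def)
      then have "L2 (itv c d) (\<lambda>s. dv s x)" unfolding L2_def by (auto dest: borel_measurable_integrable)
      moreover have "v d x - v c x = (LINT s|itv c d. dv s x)"
        using elim(2)[rule_format, OF *] by simp
      ultimately show "(norm (v d x - v c x))\<^sup>2 \<le> (d - c) * (LINT s|itv c d. (norm (dv s x))\<^sup>2)"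
        using norm_primitive_sq_le[of c d "\<lambda>s. dv s x"] * by simp
    qed
  qed
qed

text \<open>The value at \<open>a\<close> is square integrable by definition and the increment by
  Cauchy-Schwarz in time, so the conclusion is available at each \<open>t\<close>, grid points
  included, rather than at almost every one.\<close>

lemma has_tderiv_L2:
  assumes M: "finite_measure M" and v: "has_tderiv M a b v dv" and t: "a \<le> t" "t \<le> b"
  shows "L2 M (v t)"
proof (rule L2_bound)
  have dv: "L2L2 M a b dv" and va: "L2 M (v a)" and vv: "L2L2 M a b v"
    using v by (auto simp: has_tderiv_def)
  show "v t \<in> borel_measurable M" by (rule L2L2_section[OF vv t])
  have dvt: "L2L2 M a t dv" by (rule L2L2_sub[OF M dv]) (use t in auto)
  show "integrable M (\<lambda>x. 2 * (norm (v a x))\<^sup>2 + 2 * ((t - a) * (LINT s|itv a t. (norm (dv s x))\<^sup>2)))"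
    using va L2L2_inner_space_integrable[OF M dvt dvt] by (simp add: L2_def power2_norm_eq_inner)
  show "AE x in M. (norm (v t x))\<^sup>2 \<le> 2 * (norm (v a x))\<^sup>2 + 2 * ((t - a) * (LINT s|itv a t. (norm (dv s x))\<^sup>2))"
    using has_tderiv_increment_le[OF M v]
  proof eventually_elim
    case (elim x)
    from elim t have "(norm (v t x - v a x))\<^sup>2 \<le> (t - a) * (LINT s|itv a t. (norm (dv s x))\<^sup>2)" by blast
    then show ?case using norm_add_sq_le[of 1 "v a x" "v t x - v a x"] by simp
  qed
qed

lemma has_tderiv_sub:
  assumes M: "finite_measure M" and v: "has_tderiv M a b v dv" and *: "a \<le> c" "c \<le> d" "d \<le> b"
  shows "has_tderiv M c d v dv"
  unfolding has_tderiv_def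
proof (intro conjI)
  show "L2L2 M c d v" "L2L2 M c d dv"
    using L2L2_sub[OF M _ *(1,3)] v by (auto simp: has_tderiv_def)
  show "L2 M (v c)" using has_tderiv_L2[OF M v] * by simp
  show "AE x in M. \<forall>t\<in>{c..d}. v t x = v c x + (LINT s:{c..t}|lborel. dv s x)"
    using has_tderiv_increment[OF M v]
  proof eventually_elim
    case (elim x)
    show ?case
    proof
      fix t assume "t \<in> {c..d}"
      then have "v t x = v c x + (LINT s|itv c t. dv s x)"
        using * by (intro elim[rule_format]) auto
      then show "v t x = v c x + (LINT s:{c..t}|lborel. dv s x)" by (simp only: set_integral_itv)
    qed
  qed
qed

lemma has_tderiv_diff:
  assumes M: "finite_measure M" and v: "has_tderiv M a b v dv" "has_tderiv M a b w dw"
  shows "has_tderiv M a b (\<lambda>t x. v t x - w t x) (\<lambda>t x. dv t x - dw t x)"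
  unfolding has_tderiv_def
proof (intro conjI)
  have dv: "L2L2 M a b dv" "L2L2 M a b dw" using v by (auto simp: has_tderiv_def)
  show "L2L2 M a b (\<lambda>t x. v t x - w t x)" "L2L2 M a b (\<lambda>t x. dv t x - dw t x)"
    using v by (auto simp: has_tderiv_def intro!: L2L2_diff)
  show "L2 M (\<lambda>x. v a x - w a x)" using v by (auto simp: has_tderiv_def intro!: L2_diff)
  show "AE x in M. \<forall>t\<in>{a..b}. v t x - w t x = v a x - w a x + (LINT s:{a..t}|lborel. dv s x - dw s x)"
    using L2L2_AE_time[OF M dv(1)] L2L2_AE_time[OF M dv(2)] has_tderiv_primitive[OF v(1)] has_tderiv_primitive[OF v(2)]
  proof eventually_elim
    case (elim x)
    show ?case
    proof
      fix t assume t: "t \<in> {a..b}"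
      have "integrable (itv a t) (\<lambda>s. dv s x)" "integrable (itv a t) (\<lambda>s. dw s x)"
        by (rule itv_integrable_sub[OF L2_integrable[OF finite_itv elim(1)]]; use t in simp)
          (rule itv_integrable_sub[OF L2_integrable[OF finite_itv elim(2)]]; use t in simp)
      then have "(LINT s|itv a t. dv s x - dw s x) = (LINT s|itv a t. dv s x) - (LINT s|itv a t. dw s x)"
        by (rule Bochner_Integration.integral_diff)
      with bspec[OF elim(3) t] bspec[OF elim(4) t]
      show "v t x - w t x = v a x - w a x + (LINT s:{a..t}|lborel. dv s x - dw s x)"
        by (simp only: set_integral_itv) (simp add: algebra_simps)
    qed
  qed
qed

text \<open>\<open>norm_sq_primitive\<close> for almost every \<open>x\<close>, then Fubini. Both
  the kinetic and the elastic energies arise from this identity.\<close>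

lemma has_tderiv_energy:
  assumes M: "finite_measure M" and v: "has_tderiv M a b v dv" and ab: "a \<le> b"
  shows "(L2norm M (v b))\<^sup>2 - (L2norm M (v a))\<^sup>2 = 2 * (LINT t|itv a b. LINT x|M. v t x \<bullet> dv t x)"
proof -
  have dv: "L2L2 M a b dv" and vv: "L2L2 M a b v" using v by (auto simp: has_tderiv_def)
  have L: "L2 M (v a)" "L2 M (v b)" using has_tderiv_L2[OF M v] ab by auto
  have "(L2norm M (v b))\<^sup>2 - (L2norm M (v a))\<^sup>2 = (LINT x|M. (norm (v b x))\<^sup>2 - (norm (v a x))\<^sup>2)"
    using L by (simp add: L2norm_sq L2_def)
  also have "\<dots> = (LINT x|M. 2 * (LINT t|itv a b. v t x \<bullet> dv t x))"
  proof (rule integral_cong_AE)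
    show "(\<lambda>x. (norm (v b x))\<^sup>2 - (norm (v a x))\<^sup>2) \<in> borel_measurable M"
      using L by (auto simp: L2_def)
    show "(\<lambda>x. 2 * (LINT t|itv a b. v t x \<bullet> dv t x)) \<in> borel_measurable M"
      using borel_measurable_integrable[OF L2L2_inner_space_integrable[OF M vv dv]] by simp
    show "AE x in M. (norm (v b x))\<^sup>2 - (norm (v a x))\<^sup>2 = 2 * (LINT t|itv a b. v t x \<bullet> dv t x)"
      using L2L2_AE_time[OF M dv] has_tderiv_primitive[OF v]
    proof eventually_elim
      case (elim x)
      have "(LINT t|itv a b. v t x \<bullet> dv t x) = (LINT t|itv a b. (v a x + (LINT s|itv a t. dv s x)) \<bullet> dv t x)"
        by (intro Bochner_Integration.integral_cong refl arg_cong2[where f=inner] bspec[OF elim(2)])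
          (simp add: space_itv)
      moreover have "v b x = v a x + (LINT s|itv a b. dv s x)" using bspec[OF elim(2), of b] ab by simp
      ultimately show ?case using norm_sq_primitive[OF elim(1), of "v a x"] by (simp only:)
    qed
  qed
  also have "\<dots> = 2 * (LINT t|itv a b. LINT x|M. v t x \<bullet> dv t x)"
    by (simp add: L2L2_inner_Fubini[OF M vv dv])
  finally show ?thesis .
qed

text \<open>Building a function from a prescribed derivative is what later defines gradients at
  every time.\<close>

lemma has_tderiv_primitiveI:
  fixes dv :: "real \<Rightarrow> 'a \<Rightarrow> 'b::euclidean_space"
  assumes M: "finite_measure M" and dv: "L2L2 M a b dv" and v0: "L2 M v0" and ab: "a \<le> b"
  shows "has_tderiv M a b (\<lambda>t x. v0 x + (LINT s|itv a t. dv s x)) dv"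
proof -
  let ?I = "itv a b"
  interpret I: finite_measure ?I by (rule finite_itv)
  interpret M: finite_measure M by fact
  interpret pair_sigma_finite ?I M ..
  define V where "V = (\<lambda>t x. LINT s|itv a t. dv s x)"
  have dvm: "(\<lambda>p. dv (fst p) (snd p)) \<in> borel_measurable (?I \<Otimes>\<^sub>M M)"
    using dv by (simp add: L2L2_def L2_def case_prod_beta')
  \<comment> \<open>As an integral over a fixed interval with parameter \<open>p = (t, x)\<close>,
    the primitive is jointly measurable.\<close>
  have "(\<lambda>p. LINT s|?I. of_bool (s \<le> fst p) *\<^sub>R dv s (snd p)) \<in> borel_measurable (?I \<Otimes>\<^sub>M M)"
  proof (rule I.borel_measurable_lebesgue_integral)
    have m1: "(\<lambda>q. (snd q, snd (fst q))) \<in> (?I \<Otimes>\<^sub>M M) \<Otimes>\<^sub>M ?I \<rightarrow>\<^sub>M ?I \<Otimes>\<^sub>M M" by measurable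
    have m2: "(\<lambda>q. fst (fst q)) \<in> borel_measurable ((?I \<Otimes>\<^sub>M M) \<Otimes>\<^sub>M ?I)"
      by (rule measurable_compose[OF measurable_fst measurable_fst_itv])
    have m3: "snd \<in> borel_measurable ((?I \<Otimes>\<^sub>M M) \<Otimes>\<^sub>M ?I)" by (rule measurable_snd_itv)
    have m4: "(\<lambda>q. if snd q \<le> fst (fst q) then 1 else 0 :: real) \<in> borel_measurable ((?I \<Otimes>\<^sub>M M) \<Otimes>\<^sub>M ?I)"
      using m2 m3 by measurable
    have "(\<lambda>q. (if snd q \<le> fst (fst q) then 1 else 0 :: real) *\<^sub>R dv (snd q) (snd (fst q)))
        \<in> borel_measurable ((?I \<Otimes>\<^sub>M M) \<Otimes>\<^sub>M ?I)"
      using borel_measurable_scaleR[OF m4 measurable_compose[OF m1 dvm]] by simp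
    then show "(\<lambda>(p, s). of_bool (s \<le> fst p) *\<^sub>R dv s (snd p)) \<in> borel_measurable ((?I \<Otimes>\<^sub>M M) \<Otimes>\<^sub>M ?I)"
      by (simp add: case_prod_beta' of_bool_def)
  qed
  moreover have "(LINT s|?I. of_bool (s \<le> fst p) *\<^sub>R dv s (snd p)) = V (fst p) (snd p)"
    if "p \<in> space (?I \<Otimes>\<^sub>M M)" for p
  proof -
    have "fst p \<le> b" using that by (auto simp: space_pair_measure space_itv)
    then have "(LINT s|lborel. indicator {a..b} s *\<^sub>R (of_bool (s \<le> fst p) *\<^sub>R dv s (snd p)))
        = (LINT s|lborel. indicator {a..fst p} s *\<^sub>R dv s (snd p))"
      by (intro Bochner_Integration.integral_cong) (auto simp: indicator_def)
    then show ?thesis by (simp add: integral_restrict_space V_def)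
  qed
  ultimately have Vm: "(\<lambda>p. V (fst p) (snd p)) \<in> borel_measurable (?I \<Otimes>\<^sub>M M)"
    by (rule measurable_cong[THEN iffD1, rotated])
  have Vs: "V t \<in> borel_measurable M" if "a \<le> t" "t \<le> b" for t
    using measurable_Pair2[OF Vm, of t] that by (simp add: space_itv)
  define C where "C = (b - a) * (LINT x|M. LINT s|?I. (norm (dv s x))\<^sup>2)"
  have int: "integrable M (\<lambda>x. LINT s|?I. (norm (dv s x))\<^sup>2)"
    using L2L2_inner_space_integrable[OF M dv dv] by (simp add: power2_norm_eq_inner)
  \<comment> \<open>Cauchy-Schwarz in time gives a bound that does not depend on \<open>t\<close>,
    so the squared spatial norms all stay below \<open>C\<close>.\<close>
  have bd: "AE x in M. (norm (V t x))\<^sup>2 \<le> (b - a) * (LINT s|?I. (norm (dv s x))\<^sup>2)"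
    if t: "a \<le> t" "t \<le> b" for t
    using L2L2_AE_time[OF M dv]
  proof eventually_elim
    case (elim x)
    have i: "integrable ?I (\<lambda>s. (norm (dv s x))\<^sup>2)" using elim by (simp add: L2_def)
    have "L2 (itv a t) (\<lambda>s. dv s x)"
      using itv_integrable_sub[OF i order_refl t(2)]
        borel_measurable_integrable[OF itv_integrable_sub[OF L2_integrable[OF finite_itv elim] order_refl t(2)]]
      by (simp add: L2_def)
    from norm_primitive_sq_le[OF this t(1)]
    have "(norm (V t x))\<^sup>2 \<le> (t - a) * (LINT s|itv a t. (norm (dv s x))\<^sup>2)" by (simp add: V_def)
    also have "\<dots> \<le> (b - a) * (LINT s|?I. (norm (dv s x))\<^sup>2)"
      using t by (intro mult_mono itv_integral_mono_set[OF i]) auto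
    finally show ?case .
  qed
  have VL: "L2 M (V t)" if t: "a \<le> t" "t \<le> b" for t
    by (rule L2_bound[OF Vs[OF t] _ bd[OF t]]) (use int in simp)
  have VC: "(LINT x|M. (norm (V t x))\<^sup>2) \<le> C" if t: "a \<le> t" "t \<le> b" for t
  proof -
    have "(LINT x|M. (norm (V t x))\<^sup>2) \<le> (LINT x|M. (b - a) * (LINT s|?I. (norm (dv s x))\<^sup>2))"
      using VL[OF t] int by (intro integral_mono_AE bd[OF t]) (auto simp: L2_def)
    then show ?thesis by (simp add: C_def)
  qed
  have LV: "L2L2 M a b V"
    unfolding L2L2_def L2_def case_prod_beta'
  proof (intro conjI Vm Fubini_integrable)
    show "(\<lambda>p. (norm (V (fst p) (snd p)))\<^sup>2) \<in> borel_measurable (?I \<Otimes>\<^sub>M M)" using Vm by simp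
    show "integrable ?I (\<lambda>t. LINT x|M. norm ((norm (V (fst (t, x)) (snd (t, x))))\<^sup>2))"
    proof (rule Bochner_Integration.integrable_bound[of _ "\<lambda>t. C"])
      have "(\<lambda>(t, x). norm ((norm (V (fst (t, x)) (snd (t, x))))\<^sup>2)) \<in> borel_measurable (?I \<Otimes>\<^sub>M M)"
        using Vm by (simp add: case_prod_beta')
      then show "(\<lambda>t. LINT x|M. norm ((norm (V (fst (t, x)) (snd (t, x))))\<^sup>2)) \<in> borel_measurable ?I"
        by (rule M.borel_measurable_lebesgue_integral)
      show "AE t in ?I. norm (LINT x|M. norm ((norm (V (fst (t, x)) (snd (t, x))))\<^sup>2)) \<le> norm C"
        using VC by (auto simp: AE_itv intro!: AE_I2 order_trans[OF _ abs_ge_self])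
    qed (simp add: I.integrable_const)
    show "AE t in ?I. integrable M (\<lambda>x. (norm (V (fst (t, x)) (snd (t, x))))\<^sup>2)"
      using VL by (auto simp: AE_itv L2_def)
  qed
  \<comment> \<open>The interval \<open>{a..a}\<close> is a null set with a single point, so any
    section is measurable there and the identity holds for every \<open>x\<close>.\<close>
  have Va: "V a x = 0" for x
  proof -
    have "(LINT s|itv a a. dv s x) = (LINT s|itv a a. 0)"
    proof (rule integral_cong_AE)
      have "AE s in lborel. s \<noteq> a" by (rule AE_lborel_singleton)
      then show "AE s in itv a a. dv s x = 0" unfolding AE_itv by eventually_elim auto
      show "(\<lambda>s. dv s x) \<in> borel_measurable (itv a a)"
        by (subst measurable_cong[where g="\<lambda>s. dv a x"]) (auto simp: space_itv)
    qed simp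
    then show ?thesis by (simp add: V_def)
  qed
  have "L2L2 M a b (\<lambda>t x. v0 x)"
    unfolding L2L2_def L2_def case_prod_beta'
    using integrable_pair_snd[OF finite_itv M, of "\<lambda>x. (norm (v0 x))\<^sup>2" a b] v0 measurable_compose[OF measurable_snd, of v0 M borel ?I]
    by (auto simp: L2_def case_prod_beta')
  from L2L2_add[OF this LV] have "L2L2 M a b (\<lambda>t x. v0 x + V t x)" .
  have set: "(LINT s:{a..t}|lborel. dv s x) = V t x" for t x by (simp only: set_integral_itv V_def)
  have "has_tderiv M a b (\<lambda>t x. v0 x + V t x) dv"
    unfolding has_tderiv_def set
  proof (intro conjI dv AE_I2 ballI)
    show "L2L2 M a b (\<lambda>t x. v0 x + V t x)" by fact
    show "L2 M (\<lambda>x. v0 x + V a x)" using v0 by (simp only: Va add_0_right)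
  qed (simp only: Va add_0_right)
  then show ?thesis by (simp only: V_def)
qed

section \<open>Continuously differentiable functions\<close>

lemma C1I:
  assumes "\<And>x. (f has_derivative f' x) (at x)" "\<And>h. continuous_on UNIV (\<lambda>x. f' x h)"
  shows "C1 f"
  using assms by (auto simp: C1_def)

lemma has_derivative_pd:
  "(f has_derivative f') (at x) \<Longrightarrow> pd i f x = f' (axis i 1)"
  by (simp add: pd_def frechet_derivative_at[symmetric])

lemma C1_derivative:
  assumes "C1 f"
  obtains f' where "\<And>x. (f has_derivative f' x) (at x)" "\<And>h. continuous_on UNIV (\<lambda>x. f' x h)"
  using assms by (auto simp: C1_def)

lemma C1_continuous:
  assumes "C1 f"
  shows "continuous_on UNIV f"
proof -
  obtain f' where f': "\<And>x. (f has_derivative f' x) (at x)" "\<And>h. continuous_on UNIV (\<lambda>x. f' x h)"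
    using C1_derivative[OF assms] by blast
  show ?thesis
    by (rule continuous_at_imp_continuous_on) (use has_derivative_continuous[OF f'(1)] in blast)
qed

lemma C1_pd_continuous:
  assumes "C1 f"
  shows "continuous_on UNIV (pd i f)"
proof -
  obtain f' where f': "\<And>x. (f has_derivative f' x) (at x)" "\<And>h. continuous_on UNIV (\<lambda>x. f' x h)"
    using C1_derivative[OF assms] by blast
  have "pd i f = (\<lambda>x. f' x (axis i 1))" using has_derivative_pd[OF f'(1)] by auto
  then show ?thesis using f'(2) by simp
qed

lemma C1_sum:
  fixes f :: "'i \<Rightarrow> real ^ 'd::finite \<Rightarrow> 'b::real_normed_vector"
  assumes "\<And>i. i \<in> I \<Longrightarrow> C1 (f i)"
  shows "C1 (\<lambda>x. \<Sum>i\<in>I. f i x)"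
proof -
  have "\<forall>i\<in>I. \<exists>f'. (\<forall>x. (f i has_derivative f' x) (at x)) \<and> (\<forall>h. continuous_on UNIV (\<lambda>x. f' x h))"
    using assms by (auto simp: C1_def)
  then obtain F where F: "\<And>i x. i \<in> I \<Longrightarrow> (f i has_derivative F i x) (at x)"
    "\<And>i h. i \<in> I \<Longrightarrow> continuous_on UNIV (\<lambda>x. F i x h)" by metis
  show ?thesis
    by (rule C1I[of _ "\<lambda>x h. \<Sum>i\<in>I. F i x h"])
      (auto intro!: has_derivative_sum continuous_on_sum F)
qed

lemma C1_scale:
  fixes f :: "real ^ 'd::finite \<Rightarrow> real"
  assumes "C1 f"
  shows "C1 (\<lambda>x. c * f x)"
proof -
  obtain f' where f': "\<And>x. (f has_derivative f' x) (at x)" "\<And>h. continuous_on UNIV (\<lambda>x. f' x h)"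
    using C1_derivative[OF assms] by blast
  show ?thesis
    by (rule C1I[of _ "\<lambda>x h. c * f' x h"])
      (auto intro!: has_derivative_mult_right continuous_on_mult f' continuous_on_const)
qed

text \<open>The map \<open>s / (1 + s)\<close> fixes 0, stays below 1 and sends large values close
  to 1; it serves as a differentiable truncation.\<close>

lemma C1_saturate:
  fixes f :: "real ^ 'd::finite \<Rightarrow> real"
  assumes "C1 f" and nn: "\<And>x. 0 \<le> f x"
  shows "C1 (\<lambda>x. f x / (1 + f x))"
proof -
  obtain f' where f': "\<And>x. (f has_derivative f' x) (at x)" "\<And>h. continuous_on UNIV (\<lambda>x. f' x h)"
    using C1_derivative[OF assms(1)] by blast
  have pos: "1 + f x \<noteq> 0" for x using nn[of x] by linarith
  show ?thesis
  proof (rule C1I[of _ "\<lambda>x h. f' x h / (1 + f x)\<^sup>2"])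
    fix x
    show "((\<lambda>x. f x / (1 + f x)) has_derivative (\<lambda>h. f' x h / (1 + f x)\<^sup>2)) (at x)"
      using pos[of x] by (auto intro!: derivative_eq_intros f' simp: fun_eq_iff field_simps power2_eq_square)
    show "continuous_on UNIV (\<lambda>x. f' x h / (1 + f x)\<^sup>2)" for h
      using pos by (auto intro!: continuous_intros f' C1_continuous[OF assms(1)])
  qed
qed

section \<open>Bump functions and the fundamental lemma of the calculus of variations\<close>

lemma has_real_derivative_pos_part_sq:
  "((\<lambda>t. (max 0 t)\<^sup>2) has_real_derivative 2 * max 0 t) (at t)"
proof -
  consider "t < 0" | "t > 0" | "t = 0" by linarith
  then show ?thesis
  proof cases
    case 1
    have "((\<lambda>t. 0) has_real_derivative 2 * max 0 t) (at t)" using 1 by auto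
    then show ?thesis
      by (rule has_field_derivative_transform_within_open[of _ _ _ "{..<0}"]) (use 1 in auto)
  next
    case 2
    have "((\<lambda>t. t\<^sup>2) has_real_derivative 2 * max 0 t) (at t)"
      using 2 by (auto intro!: derivative_eq_intros)
    then show ?thesis
      by (rule has_field_derivative_transform_within_open[of _ _ _ "{0<..}"]) (use 2 in auto)
  next
    case 3
    \<comment> \<open>Only the origin is delicate: there the difference quotient is at most
      \<open>|h|\<close> in absolute value.\<close>
    have "((\<lambda>h. (max 0 h)\<^sup>2 / h) \<longlongrightarrow> 0) (at (0::real))"
    proof (rule Lim_null_comparison[of _ "\<lambda>h. \<bar>h\<bar>"])
      show "\<forall>\<^sub>F h in at (0::real). norm ((max 0 h)\<^sup>2 / h) \<le> \<bar>h\<bar>"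
        by (intro always_eventually allI) (auto simp: max_def power2_eq_square)
      show "((\<lambda>h. \<bar>h\<bar>) \<longlongrightarrow> 0) (at (0::real))" by (auto intro!: tendsto_eq_intros)
    qed
    then show ?thesis using 3 by (simp add: DERIV_def)
  qed
qed

text \<open>Test functions are only required to be C1, so a squared positive part does, and no
  exponential bump is involved.\<close>

definition bump :: "real ^ 'd::finite \<Rightarrow> real \<Rightarrow> real ^ 'd \<Rightarrow> real" where
  "bump c r x = (max 0 (r\<^sup>2 - (x - c) \<bullet> (x - c)))\<^sup>2"

lemma C1_bump: "C1 (bump c r)"
proof (rule C1I[of _ "\<lambda>x h. (- 2 * ((x - c) \<bullet> h)) * (2 * max 0 (r\<^sup>2 - (x - c) \<bullet> (x - c)))"])
  fix x :: "real ^ 'a"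
  have "((\<lambda>x. r\<^sup>2 - (x - c) \<bullet> (x - c)) has_derivative (\<lambda>h. - 2 * ((x - c) \<bullet> h))) (at x)"
    by (auto intro!: derivative_eq_intros simp: inner_commute fun_eq_iff)
  from has_derivative_compose[OF this has_real_derivative_pos_part_sq[unfolded has_field_derivative_def]]
  show "(bump c r has_derivative (\<lambda>h. (- 2 * ((x - c) \<bullet> h)) * (2 * max 0 (r\<^sup>2 - (x - c) \<bullet> (x - c))))) (at x)"
    by (simp add: bump_def[abs_def] mult.commute)
qed (intro continuous_intros)

lemma bump_pos_iff:
  assumes "r > 0"
  shows "bump c r x \<noteq> 0 \<longleftrightarrow> x \<in> ball c r"
proof -
  have "(x - c) \<bullet> (x - c) = (dist c x)\<^sup>2"
    by (simp add: dist_norm power2_norm_eq_inner inner_diff_left inner_diff_right)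
  then have "bump c r x \<noteq> 0 \<longleftrightarrow> (dist c x)\<^sup>2 < r\<^sup>2" by (auto simp: bump_def)
  then show ?thesis using assms by (simp add: power2_less_imp_less power_strict_mono abs_le_square_iff[symmetric] not_le[symmetric])
qed

lemma bump_nonneg: "0 \<le> bump c r x"
  by (simp add: bump_def)

text \<open>The functions are \<open>S / (1 + S)\<close> with \<open>S = n (\<psi>\<^sub>1 + \<dots> + \<psi>\<^sub>n)\<close> for bumps \<open>\<psi>\<^sub>j\<close> on balls that
  exhaust \<open>U\<close>.\<close>

lemma test_fun_approx_indicator:
  fixes U :: "(real ^ 'd::finite) set"
  assumes "open U"
  obtains \<phi> where "\<And>n::nat. test_fun U (\<phi> n)" "\<And>n x. \<bar>\<phi> n x\<bar> \<le> 1"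
    "\<And>x. (\<lambda>n. \<phi> n x) \<longlonglongrightarrow> indicator U x"
proof (cases "U = {}")
  case True
  have "test_fun U (\<lambda>x. 0)"
    by (auto simp: test_fun_def intro!: C1I[of _ "\<lambda>x h. 0"])
  then show ?thesis using that[of "\<lambda>n x. 0"] True by simp
next
  case False
  \<comment> \<open>The balls have closures inside \<open>U\<close>, so that supports of finite sums
    of bumps are compact subsets of \<open>U\<close>; Lindelof then makes the family
    countable.\<close>
  define F where "F = {ball c r |c r. r > 0 \<and> cball c r \<subseteq> U}"
  obtain F' where F': "F' \<subseteq> F" "countable F'" "\<Union>F' = \<Union>F"
    by (rule Lindelof[of F]) (auto simp: F_def)
  have "\<Union>F = U"
  proof
    show "U \<subseteq> \<Union>F"
    proof
      fix x assume "x \<in> U"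
      then obtain r where "r > 0" "cball x r \<subseteq> U" using assms open_contains_cball by blast
      then show "x \<in> \<Union>F" by (auto simp: F_def intro!: exI[of _ "ball x r"] exI[of _ x] exI[of _ r])
    qed
    show "\<Union>F \<subseteq> U" unfolding F_def using ball_subset_cball by blast
  qed
  then have "F' \<noteq> {}" using False F'(3) by auto
  define B where "B = from_nat_into F'"
  have rB: "range B = F'" unfolding B_def by (rule range_from_nat_into[OF \<open>F' \<noteq> {}\<close> F'(2)])
  have "\<forall>j. \<exists>c r. B j = ball c r \<and> r > 0 \<and> cball c r \<subseteq> U"
  proof
    fix j
    have "B j \<in> F" using rB F'(1) by blast
    then show "\<exists>c r. B j = ball c r \<and> r > 0 \<and> cball c r \<subseteq> U" unfolding F_def by blast
  qed
  then obtain c r where cr: "\<And>j. B j = ball (c j) (r j)" "\<And>j. r j > 0" "\<And>j. cball (c j) (r j) \<subseteq> U"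
    by metis
  \<comment> \<open>The factor \<open>n\<close> drives the sum to infinity at each point of
    \<open>U\<close> once one bump is positive there, so the saturated functions tend to 1 on
    \<open>U\<close>; off \<open>U\<close> all of them vanish.\<close>
  define S where "S = (\<lambda>n x. real n * (\<Sum>j<n. bump (c j) (r j) x))"
  have S0: "0 \<le> S n x" for n x by (auto simp: S_def intro!: mult_nonneg_nonneg sum_nonneg bump_nonneg)
  have C1S: "C1 (S n)" for n unfolding S_def by (intro C1_scale C1_sum C1_bump)
  have Sz: "S n x = 0" if "x \<notin> (\<Union>j<n. cball (c j) (r j))" for n x
  proof -
    have "bump (c j) (r j) x = 0" if "j < n" for j
      using bump_pos_iff[OF cr(2)[of j], of "c j" x] ball_subset_cball[of "c j" "r j"] \<open>x \<notin> _\<close> that by blast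
    then show ?thesis by (simp add: S_def)
  qed
  define \<phi> where "\<phi> = (\<lambda>n x. S n x / (1 + S n x))"
  have supp: "closure {x. \<phi> n x \<noteq> 0} \<subseteq> (\<Union>j<n. cball (c j) (r j))" for n
  proof (rule closure_minimal)
    show "{x. \<phi> n x \<noteq> 0} \<subseteq> (\<Union>j<n. cball (c j) (r j))"
    proof (rule subsetI, rule ccontr)
      fix x assume "x \<in> {x. \<phi> n x \<noteq> 0}" "x \<notin> (\<Union>j<n. cball (c j) (r j))"
      then show False using Sz[of x n] by (simp add: \<phi>_def)
    qed
  qed (auto intro!: closed_UN)
  have "test_fun U (\<phi> n)" for n
    unfolding test_fun_def
  proof (intro conjI)
    show "C1 (\<phi> n)" unfolding \<phi>_def by (rule C1_saturate[OF C1S S0])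
    have "compact (\<Union>j<n. cball (c j) (r j))" by (intro compact_UN) auto
    from compact_Int_closed[OF this closed_closure, of "{x. \<phi> n x \<noteq> 0}"]
    show "compact (closure {x. \<phi> n x \<noteq> 0})" unfolding Int_absorb1[OF supp] .
    show "closure {x. \<phi> n x \<noteq> 0} \<subseteq> U" using supp[of n] cr(3) by blast
  qed
  moreover have le1: "\<bar>\<phi> n x\<bar> \<le> 1" for n x
    using S0[of n x] by (simp add: \<phi>_def)
  moreover have "(\<lambda>n. \<phi> n x) \<longlonglongrightarrow> indicator U x" for x
  proof (cases "x \<in> U")
    case False
    have "S n x = 0" for n by (rule Sz) (use False cr(3) in blast)
    then show ?thesis using False by (simp add: \<phi>_def)
  next
    case True
    then obtain k where k: "x \<in> B k" using \<open>\<Union>F = U\<close> F'(3) rB by blast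
    define d where "d = bump (c k) (r k) x"
    have d: "d > 0" using bump_pos_iff[OF cr(2)[of k], of "c k" x] k cr(1) bump_nonneg[of "c k" "r k" x]
      by (auto simp: d_def)
    have ge: "S n x \<ge> real n * d" if "n > k" for n
      unfolding S_def d_def
      by (intro mult_left_mono member_le_sum) (use that bump_nonneg in auto)
    have "(\<lambda>n. 1 / (1 + real n * d)) \<longlonglongrightarrow> 0"
    proof (rule tendsto_divide_0[OF tendsto_const])
      have "filterlim (\<lambda>n. 1 + real n * d) at_top sequentially"
        by (intro filterlim_tendsto_add_at_top[OF tendsto_const]
            filterlim_at_top_mult_tendsto_pos[OF tendsto_const d] filterlim_real_sequentially)
      then show "filterlim (\<lambda>n. 1 + real n * d) at_infinity sequentially"
        by (rule filterlim_at_top_imp_at_infinity)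
    qed
    then have lim: "(\<lambda>n. 1 - 1 / (1 + real n * d)) \<longlonglongrightarrow> 1"
      using tendsto_diff[OF tendsto_const, of _ 0 sequentially 1] by fastforce
    have "(\<lambda>n. \<phi> n x) \<longlonglongrightarrow> 1"
    proof (rule tendsto_sandwich[OF _ _ lim tendsto_const])
      show "\<forall>\<^sub>F n in sequentially. \<phi> n x \<le> 1"
        by (intro always_eventually allI) (use le1 in \<open>simp add: abs_le_iff\<close>)
      show "\<forall>\<^sub>F n in sequentially. 1 - 1 / (1 + real n * d) \<le> \<phi> n x"
        using eventually_gt_at_top[of k]
      proof eventually_elim
        case (elim n)
        have "1 / (1 + S n x) \<le> 1 / (1 + real n * d)"
          using ge[OF elim] d by (intro divide_left_mono) (auto intro!: mult_pos_pos add_pos_nonneg S0)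
        moreover have "\<phi> n x = 1 - 1 / (1 + S n x)" using S0[of n x] by (simp add: \<phi>_def field_simps)
        ultimately show ?case by simp
      qed
    qed
    then show ?thesis using True by simp
  qed
  ultimately show ?thesis by (rule that)
qed

lemma test_fun_mono: "test_fun U \<phi> \<Longrightarrow> U \<subseteq> V \<Longrightarrow> test_fun V \<phi>"
  by (auto simp: test_fun_def)

text \<open>Test functions converging to indicators show that the integral vanishes over all open
  sets. These form an intersection-stable generator of the Borel sets, and a function whose
  integrals over all Borel sets vanish is zero almost everywhere.\<close>

lemma test_fun_integral_zero:
  fixes g :: "real ^ 'd::finite \<Rightarrow> 'b::euclidean_space"
  assumes \<Omega>: "open \<Omega>" and g: "integrable (vol \<Omega>) g"
    and z: "\<And>\<phi>. test_fun \<Omega> \<phi> \<Longrightarrow> (LINT x|vol \<Omega>. \<phi> x *\<^sub>R g x) = 0"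
  shows "AE x in vol \<Omega>. g x = 0"
proof -
  define f where "f = (\<lambda>x. indicator \<Omega> x *\<^sub>R g x)"
  have f: "integrable lborel f" using g \<Omega> by (simp add: integrable_restrict_space f_def)
  \<comment> \<open>The approximating functions are supported in the intersection of
    \<open>U\<close> with the domain, where they are admissible, and \<open>norm f\<close> dominates
    the integrands.\<close>
  have op: "(LINT x:U|lborel. f x) = 0" if U: "open U" for U
  proof -
    obtain \<phi> where \<phi>: "\<And>n::nat. test_fun (U \<inter> \<Omega>) (\<phi> n)" "\<And>n x. \<bar>\<phi> n x\<bar> \<le> 1"
      "\<And>x. (\<lambda>n. \<phi> n x) \<longlonglongrightarrow> indicator (U \<inter> \<Omega>) x"
      using test_fun_approx_indicator[of "U \<inter> \<Omega>"] U \<Omega> by blast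
    have "(\<lambda>n. LINT x|lborel. \<phi> n x *\<^sub>R f x) \<longlonglongrightarrow> (LINT x|lborel. indicator (U \<inter> \<Omega>) x *\<^sub>R f x)"
    proof (rule integral_dominated_convergence[where w="\<lambda>x. norm (f x)"])
      show "(\<lambda>x. \<phi> n x *\<^sub>R f x) \<in> borel_measurable lborel" for n
      proof (rule borel_measurable_scaleR)
        show "\<phi> n \<in> borel_measurable lborel"
          using \<phi>(1)[of n] C1_continuous[of "\<phi> n"]
          by (simp add: test_fun_def borel_measurable_continuous_onI)
      qed (use f in simp)
      show "AE x in lborel. (\<lambda>n. \<phi> n x *\<^sub>R f x) \<longlonglongrightarrow> indicator (U \<inter> \<Omega>) x *\<^sub>R f x"
        by (auto intro!: tendsto_scaleR \<phi>(3))
      show "AE x in lborel. norm (\<phi> n x *\<^sub>R f x) \<le> norm (f x)" for n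
        using \<phi>(2) by (auto intro!: mult_left_le_one_le)
    qed (use f U \<Omega> in \<open>auto intro!: borel_measurable_scaleR borel_measurable_indicator\<close>)
    moreover have "(LINT x|lborel. \<phi> n x *\<^sub>R f x) = 0" for n
      using z[OF test_fun_mono[OF \<phi>(1)[of n]]] \<Omega> by (simp add: integral_restrict_space f_def mult.commute)
    ultimately have "(LINT x|lborel. indicator (U \<inter> \<Omega>) x *\<^sub>R f x) = 0" by (simp add: LIMSEQ_const_iff)
    moreover have "indicator (U \<inter> \<Omega>) x *\<^sub>R f x = indicator U x *\<^sub>R f x" for x
      by (auto simp: indicator_def f_def)
    ultimately show ?thesis by (simp add: set_lebesgue_integral_def)
  qed
  have "(LINT x:A|lborel. f x) = 0" if "A \<in> sigma_sets UNIV {S. open S}" for A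
  proof -
    have "Int_stable {S :: (real ^ 'd) set. open S}" "{S :: (real ^ 'd) set. open S} \<subseteq> Pow UNIV"
      by (auto simp: Int_stable_def)
    from this that show ?thesis
    proof (induct rule: sigma_sets_induct_disjoint)
      case (basic A)
      then show ?case using op by simp
    next
      case (compl A)
      have A: "A \<in> sets borel" using compl(1) by (simp add: sets_borel)
      have "(LINT x:UNIV - A|lborel. f x) = (LINT x:UNIV|lborel. f x) - (LINT x:A|lborel. f x)"
        using f A by (simp add: set_lebesgue_integral_def indicator_diff scaleR_diff_left
            integrable_mult_indicator Bochner_Integration.integral_diff[symmetric] del: Bochner_Integration.integral_diff)
      then show ?case using compl op[of UNIV] by simp
    next
      case (union A)
      have A: "A i \<in> sets borel" for i using union(2) by (auto simp: sets_borel)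
      have "(LINT x:(\<Union>i. A i)|lborel. f x) = (\<Sum>i. LINT x:A i|lborel. f x)"
      proof (rule lebesgue_integral_countable_add)
        show "set_integrable lborel (\<Union>i. A i) f"
          unfolding set_integrable_def by (rule integrable_mult_indicator) (use A f in auto)
      qed (use A union(1) in \<open>auto simp: disjoint_family_on_def\<close>)
      then show ?case using union by simp
    qed (auto simp: set_lebesgue_integral_def)
  qed
  then have "AE x in lborel. f x = 0"
    by (intro sigma_finite_measure.density_zero[OF sigma_finite_lborel f]) (simp add: sets_borel)
  then show ?thesis
    using \<Omega> by (subst AE_restrict_space_iff) (auto simp: f_def elim!: eventually_mono)
qed

section \<open>Weak derivatives\<close>

lemma finite_vol:
  assumes "open \<Omega>" "bounded \<Omega>"
  shows "finite_measure (vol \<Omega>)"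
proof (rule finite_measureI)
  show "emeasure (vol \<Omega>) (space (vol \<Omega>)) \<noteq> \<infinity>"
    using emeasure_bounded_finite[OF assms(2)] assms(1)
    by (simp add: emeasure_restrict_space space_restrict_space)
qed

lemma continuous_bounded_on:
  fixes f :: "'a::heine_borel \<Rightarrow> 'b::real_normed_vector"
  assumes "continuous_on UNIV f" "bounded \<Omega>"
  obtains B where "\<And>x. x \<in> \<Omega> \<Longrightarrow> norm (f x) \<le> B"
proof -
  have "compact (f ` closure \<Omega>)"
    using assms by (intro compact_continuous_image continuous_on_subset[OF assms(1)]) auto
  then obtain B where "\<And>y. y \<in> f ` closure \<Omega> \<Longrightarrow> norm y \<le> B"
    using compact_imp_bounded bounded_iff by metis
  then show ?thesis using that[of B] closure_subset by blast
qed

lemma L2_continuous_scaleR: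
  assumes c: "continuous_on UNIV \<psi>" and b: "bounded \<Omega>" "\<Omega> \<in> sets lborel"
    and v: "L2 (vol \<Omega>) v"
  shows "L2 (vol \<Omega>) (\<lambda>x. \<psi> x *\<^sub>R v x)"
proof -
  obtain B where B: "\<And>x. x \<in> \<Omega> \<Longrightarrow> norm (\<psi> x) \<le> B" by (rule continuous_bounded_on[OF c b(1)]) blast
  have "\<psi> \<in> borel_measurable (vol \<Omega>)"
    by (rule measurable_restrict_space1) (use c in \<open>simp add: borel_measurable_continuous_onI\<close>)
  then have m: "(\<lambda>x. \<psi> x *\<^sub>R v x) \<in> borel_measurable (vol \<Omega>)" using v by (auto simp: L2_def)
  show ?thesis
  proof (rule L2_bound[OF m])
    show "integrable (vol \<Omega>) (\<lambda>x. B\<^sup>2 * (norm (v x))\<^sup>2)" using v by (simp add: L2_def)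
    show "AE x in vol \<Omega>. (norm (\<psi> x *\<^sub>R v x))\<^sup>2 \<le> B\<^sup>2 * (norm (v x))\<^sup>2"
    proof (rule AE_I2)
      fix x assume "x \<in> space (vol \<Omega>)"
      then have "norm (\<psi> x) \<le> B" using B by (simp add: space_restrict_space)
      from power_mono[OF this norm_ge_zero, of 2]
      show "(norm (\<psi> x *\<^sub>R v x))\<^sup>2 \<le> B\<^sup>2 * (norm (v x))\<^sup>2"
        by (simp add: power_mult_distrib mult_right_mono)
    qed
  qed
qed

lemma integrable_continuous_scaleR:
  assumes "continuous_on UNIV \<psi>" "open \<Omega>" "bounded \<Omega>" "L2 (vol \<Omega>) v"
  shows "integrable (vol \<Omega>) (\<lambda>x. \<psi> x *\<^sub>R v x)"
  by (rule L2_integrable[OF finite_vol[OF assms(2,3)] L2_continuous_scaleR]) (use assms in auto)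

lemma test_fun_continuous:
  assumes "test_fun \<Omega> \<phi>"
  shows "continuous_on UNIV \<phi>" "continuous_on UNIV (pd i \<phi>)"
  using assms C1_continuous[of \<phi>] C1_pd_continuous[of \<phi> i] by (auto simp: test_fun_def)

lemma has_weak_pd_diff:
  assumes \<Omega>: "open \<Omega>" "bounded \<Omega>" and v: "has_weak_pd \<Omega> i v g" and w: "has_weak_pd \<Omega> i w h"
  shows "has_weak_pd \<Omega> i (\<lambda>x. v x - w x) (\<lambda>x. g x - h x)"
  unfolding has_weak_pd_def
proof (intro conjI allI impI)
  have L: "L2 (vol \<Omega>) v" "L2 (vol \<Omega>) g" "L2 (vol \<Omega>) w" "L2 (vol \<Omega>) h"
    using v w by (auto simp: has_weak_pd_def)
  show "L2 (vol \<Omega>) (\<lambda>x. v x - w x)" "L2 (vol \<Omega>) (\<lambda>x. g x - h x)" by (intro L2_diff L)+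
  fix \<phi> assume \<phi>: "test_fun \<Omega> \<phi>"
  note i1 = integrable_continuous_scaleR[OF test_fun_continuous(1)[OF \<phi>] \<Omega>]
    and i2 = integrable_continuous_scaleR[OF test_fun_continuous(2)[OF \<phi>, of i] \<Omega>]
  have "(LINT x|vol \<Omega>. pd i \<phi> x *\<^sub>R (v x - w x))
      = (LINT x|vol \<Omega>. pd i \<phi> x *\<^sub>R v x) - (LINT x|vol \<Omega>. pd i \<phi> x *\<^sub>R w x)"
    unfolding scaleR_diff_right by (rule Bochner_Integration.integral_diff[OF i2[OF L(1)] i2[OF L(3)]])
  moreover have "(LINT x|vol \<Omega>. \<phi> x *\<^sub>R (g x - h x))
      = (LINT x|vol \<Omega>. \<phi> x *\<^sub>R g x) - (LINT x|vol \<Omega>. \<phi> x *\<^sub>R h x)"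
    unfolding scaleR_diff_right by (rule Bochner_Integration.integral_diff[OF i1[OF L(2)] i1[OF L(4)]])
  ultimately show "(LINT x|vol \<Omega>. pd i \<phi> x *\<^sub>R (v x - w x)) = - (LINT x|vol \<Omega>. \<phi> x *\<^sub>R (g x - h x))"
    using v w \<phi> by (simp add: has_weak_pd_def)
qed

lemma has_weak_pd_cong:
  assumes "has_weak_pd \<Omega> i v g" "w \<in> borel_measurable (vol \<Omega>)" "AE x in vol \<Omega>. v x = w x"
  shows "has_weak_pd \<Omega> i w g"
proof -
  have L: "L2 (vol \<Omega>) v" using assms(1) by (simp add: has_weak_pd_def)
  have w: "L2 (vol \<Omega>) w" by (rule L2_AE_cong[OF L assms(2,3)])
  have "(LINT x|vol \<Omega>. pd i \<phi> x *\<^sub>R w x) = (LINT x|vol \<Omega>. pd i \<phi> x *\<^sub>R v x)" if "test_fun \<Omega> \<phi>" for \<phi>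
  proof (rule integral_cong_AE)
    have "pd i \<phi> \<in> borel_measurable (vol \<Omega>)"
      by (rule measurable_restrict_space1)
        (use test_fun_continuous(2)[OF that] in \<open>simp add: borel_measurable_continuous_onI\<close>)
    then show "(\<lambda>x. pd i \<phi> x *\<^sub>R w x) \<in> borel_measurable (vol \<Omega>)" "(\<lambda>x. pd i \<phi> x *\<^sub>R v x) \<in> borel_measurable (vol \<Omega>)"
      using L w by (auto simp: L2_def)
    show "AE x in vol \<Omega>. pd i \<phi> x *\<^sub>R w x = pd i \<phi> x *\<^sub>R v x"
      using assms(3) by eventually_elim simp
  qed
  then show ?thesis using assms(1) w by (simp add: has_weak_pd_def)
qed

text \<open>This makes the arbitrary choice in \<open>wpd\<close> harmless: every weak derivative
  agrees with the chosen one almost everywhere.\<close>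

lemma has_weak_pd_unique:
  assumes \<Omega>: "open \<Omega>" "bounded \<Omega>" and "has_weak_pd \<Omega> i v g" "has_weak_pd \<Omega> i v h"
  shows "AE x in vol \<Omega>. g x = h x"
proof -
  note d = has_weak_pd_diff[OF \<Omega> assms(3,4)]
  have "AE x in vol \<Omega>. g x - h x = 0"
  proof (rule test_fun_integral_zero[OF \<Omega>(1)])
    show "integrable (vol \<Omega>) (\<lambda>x. g x - h x)"
      using d by (intro L2_integrable finite_vol \<Omega>) (simp add: has_weak_pd_def)
    show "(LINT x|vol \<Omega>. \<phi> x *\<^sub>R (g x - h x)) = 0" if "test_fun \<Omega> \<phi>" for \<phi>
      using d that by (simp add: has_weak_pd_def)
  qed
  then show ?thesis by simp
qed

lemma wpd_has_weak_pd: "has_weak_pd \<Omega> i v g \<Longrightarrow> has_weak_pd \<Omega> i v (wpd \<Omega> i v)"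
  unfolding wpd_def by (rule someI[where P="has_weak_pd \<Omega> i v"])

lemma wpd_eq:
  assumes "open \<Omega>" "bounded \<Omega>" "has_weak_pd \<Omega> i v g"
  shows "AE x in vol \<Omega>. wpd \<Omega> i v x = g x"
  by (rule has_weak_pd_unique[OF assms(1,2) wpd_has_weak_pd[OF assms(3)] assms(3)])

lemma Fubini_continuous_scaleR:
  assumes c: "continuous_on UNIV \<psi>" and \<Omega>: "open \<Omega>" "bounded \<Omega>" and v: "L2L2 (vol \<Omega>) a b v"
  shows "(LINT x|vol \<Omega>. \<psi> x *\<^sub>R (LINT s|itv a b. v s x)) = (LINT s|itv a b. LINT x|vol \<Omega>. \<psi> x *\<^sub>R v s x)"
    and "integrable (itv a b) (\<lambda>s. LINT x|vol \<Omega>. \<psi> x *\<^sub>R v s x)"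
proof -
  note fin = finite_vol[OF \<Omega>]
  interpret pair_sigma_finite "itv a b" "vol \<Omega>" by (rule pair_sigma_finite_itv[OF fin])
  let ?P = "itv a b \<Otimes>\<^sub>M vol \<Omega>"
  obtain B where B: "\<And>x. x \<in> \<Omega> \<Longrightarrow> norm (\<psi> x) \<le> B" by (rule continuous_bounded_on[OF c \<Omega>(2)]) blast
  have vm: "(\<lambda>p. v (fst p) (snd p)) \<in> borel_measurable ?P"
    and vi: "integrable ?P (\<lambda>p. (norm (v (fst p) (snd p)))\<^sup>2)"
    using v by (auto simp: L2L2_def L2_def case_prod_beta')
  have \<psi>: "\<psi> \<in> borel_measurable (vol \<Omega>)"
    by (rule measurable_restrict_space1) (use c in \<open>simp add: borel_measurable_continuous_onI\<close>)
  have "L2 ?P (\<lambda>p. \<psi> (snd p) *\<^sub>R v (fst p) (snd p))"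
  proof (rule L2_bound)
    show "(\<lambda>p. \<psi> (snd p) *\<^sub>R v (fst p) (snd p)) \<in> borel_measurable ?P"
      by (rule borel_measurable_scaleR[OF measurable_compose[OF measurable_snd \<psi>] vm])
    show "integrable ?P (\<lambda>p. B\<^sup>2 * (norm (v (fst p) (snd p)))\<^sup>2)" using vi by simp
    show "AE p in ?P. (norm (\<psi> (snd p) *\<^sub>R v (fst p) (snd p)))\<^sup>2 \<le> B\<^sup>2 * (norm (v (fst p) (snd p)))\<^sup>2"
    proof (rule AE_I2)
      fix p assume "p \<in> space ?P"
      then have "norm (\<psi> (snd p)) \<le> B" using B by (auto simp: space_pair_measure space_restrict_space)
      from power_mono[OF this norm_ge_zero, of 2]
      show "(norm (\<psi> (snd p) *\<^sub>R v (fst p) (snd p)))\<^sup>2 \<le> B\<^sup>2 * (norm (v (fst p) (snd p)))\<^sup>2"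
        by (simp add: power_mult_distrib mult_right_mono)
    qed
  qed
  moreover have "finite_measure ?P" by (rule finite_measure_pair_measure[OF fin finite_itv])
  ultimately have i: "integrable ?P (\<lambda>(s, x). \<psi> x *\<^sub>R v s x)"
    unfolding case_prod_beta' by (intro L2_integrable)
  have "(LINT x|vol \<Omega>. \<psi> x *\<^sub>R (LINT s|itv a b. v s x)) = (LINT x|vol \<Omega>. LINT s|itv a b. \<psi> x *\<^sub>R v s x)"
    by simp
  also have "\<dots> = (LINT s|itv a b. LINT x|vol \<Omega>. \<psi> x *\<^sub>R v s x)" by (rule Fubini_integral[OF i])
  finally show "(LINT x|vol \<Omega>. \<psi> x *\<^sub>R (LINT s|itv a b. v s x)) = (LINT s|itv a b. LINT x|vol \<Omega>. \<psi> x *\<^sub>R v s x)" .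
  show "integrable (itv a b) (\<lambda>s. LINT x|vol \<Omega>. \<psi> x *\<^sub>R v s x)" using integrable_fst'[OF i] by simp
qed

text \<open>At each time \<open>wpd\<close> is an independent choice, so it need not be measurable
  in time. The gradient \<open>G\<close> is therefore a parameter, jointly measurable by
  requirement.\<close>

definition weak_pd_ae ::
    "(real ^ 'd::finite) set \<Rightarrow> 'd \<Rightarrow> real \<Rightarrow> real \<Rightarrow> (real \<Rightarrow> real ^ 'd \<Rightarrow> 'b::euclidean_space) \<Rightarrow> (real \<Rightarrow> real ^ 'd \<Rightarrow> 'b) \<Rightarrow> bool" where
  "weak_pd_ae \<Omega> i a b v G \<longleftrightarrow> L2L2 (vol \<Omega>) a b G \<and> (AE t in itv a b. has_weak_pd \<Omega> i (v t) (G t))"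

lemma weak_pd_ae_diff:
  assumes \<Omega>: "open \<Omega>" "bounded \<Omega>" and v: "weak_pd_ae \<Omega> i a b v G" and w: "weak_pd_ae \<Omega> i a b w H"
  shows "weak_pd_ae \<Omega> i a b (\<lambda>t x. v t x - w t x) (\<lambda>t x. G t x - H t x)"
  unfolding weak_pd_ae_def
proof
  show "L2L2 (vol \<Omega>) a b (\<lambda>t x. G t x - H t x)"
    using v w by (auto simp: weak_pd_ae_def intro: L2L2_diff)
  have "AE t in itv a b. has_weak_pd \<Omega> i (v t) (G t)" "AE t in itv a b. has_weak_pd \<Omega> i (w t) (H t)"
    using v w by (auto simp: weak_pd_ae_def)
  then show "AE t in itv a b. has_weak_pd \<Omega> i (\<lambda>x. v t x - w t x) (\<lambda>x. G t x - H t x)"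
    by eventually_elim (rule has_weak_pd_diff[OF \<Omega>])
qed

lemma weak_pd_ae_sub:
  assumes "open \<Omega>" "bounded \<Omega>" "weak_pd_ae \<Omega> i a b v G" "a \<le> c" "d \<le> b"
  shows "weak_pd_ae \<Omega> i c d v G"
  using L2L2_sub[OF finite_vol[OF assms(1,2)] _ assms(4,5)] AE_itv_sub[OF _ assms(4,5)] assms(3)
  unfolding weak_pd_ae_def by blast

lemma L2H1_weak_pd_ae:
  assumes "L2H1 S \<Omega> a b v"
  obtains G where "\<And>i. weak_pd_ae \<Omega> i a b v (G i)"
  using assms unfolding L2H1_def weak_pd_ae_def by metis

text \<open>Test functions do not depend on time, so the defining identity can be integrated over
  time, with Fubini on both sides.\<close>

lemma has_weak_pd_time_integral:
  assumes \<Omega>: "open \<Omega>" "bounded \<Omega>" and v: "L2L2 (vol \<Omega>) a b v" and G: "weak_pd_ae \<Omega> i a b v G" and ab: "a \<le> b"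
  shows "has_weak_pd \<Omega> i (\<lambda>x. LINT s|itv a b. v s x) (\<lambda>x. LINT s|itv a b. G s x)"
  unfolding has_weak_pd_def
proof (intro conjI allI impI)
  note fin = finite_vol[OF \<Omega>]
  have GL: "L2L2 (vol \<Omega>) a b G" and Gw: "AE t in itv a b. has_weak_pd \<Omega> i (v t) (G t)"
    using G by (auto simp: weak_pd_ae_def)
  show "L2 (vol \<Omega>) (\<lambda>x. LINT s|itv a b. v s x)" "L2 (vol \<Omega>) (\<lambda>x. LINT s|itv a b. G s x)"
    using has_tderiv_L2[OF fin has_tderiv_primitiveI[OF fin v L2_zero ab], of b]
      has_tderiv_L2[OF fin has_tderiv_primitiveI[OF fin GL L2_zero ab], of b] ab by auto
  fix \<phi> assume \<phi>: "test_fun \<Omega> \<phi>"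
  note c = test_fun_continuous[OF \<phi>]
  have "(LINT x|vol \<Omega>. pd i \<phi> x *\<^sub>R (LINT s|itv a b. v s x)) = (LINT s|itv a b. LINT x|vol \<Omega>. pd i \<phi> x *\<^sub>R v s x)"
    by (rule Fubini_continuous_scaleR[OF c(2) \<Omega> v])
  also have "\<dots> = (LINT s|itv a b. - (LINT x|vol \<Omega>. \<phi> x *\<^sub>R G s x))"
  proof (rule integral_cong_AE)
    show "AE s in itv a b. (LINT x|vol \<Omega>. pd i \<phi> x *\<^sub>R v s x) = - (LINT x|vol \<Omega>. \<phi> x *\<^sub>R G s x)"
      using Gw by eventually_elim (use \<phi> in \<open>simp add: has_weak_pd_def\<close>)
  qed (use Fubini_continuous_scaleR(2)[OF c(2) \<Omega> v] Fubini_continuous_scaleR(2)[OF c(1) \<Omega> GL] in auto)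
  also have "\<dots> = - (LINT x|vol \<Omega>. \<phi> x *\<^sub>R (LINT s|itv a b. G s x))"
    by (simp add: Fubini_continuous_scaleR[OF c(1) \<Omega> GL])
  finally show "(LINT x|vol \<Omega>. pd i \<phi> x *\<^sub>R (LINT s|itv a b. v s x)) = - (LINT x|vol \<Omega>. \<phi> x *\<^sub>R (LINT s|itv a b. G s x))" .
qed

text \<open>A weak derivative of \<open>\<eta> t\<close> is known to exist for almost every \<open>t\<close> only; integrating that of
  \<open>\<partial>\<^sub>t \<eta> = \<xi>\<close> yields one for every \<open>t\<close>, absolutely continuous in time.\<close>

lemma has_weak_pd_everywhere:
  assumes \<Omega>: "open \<Omega>" "bounded \<Omega>" and \<eta>: "has_tderiv (vol \<Omega>) a b \<eta> \<xi>" and ab: "a < b"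
    and G\<eta>: "weak_pd_ae \<Omega> i a b \<eta> G\<^sub>0" and G: "weak_pd_ae \<Omega> i a b \<xi> G"
  obtains H where "has_tderiv (vol \<Omega>) a b H G"
    "\<And>t. a \<le> t \<Longrightarrow> t \<le> b \<Longrightarrow> has_weak_pd \<Omega> i (\<eta> t) (H t)"
proof -
  note fin = finite_vol[OF \<Omega>]
  have \<xi>L: "L2L2 (vol \<Omega>) a b \<xi>" and \<eta>L: "L2L2 (vol \<Omega>) a b \<eta>" using \<eta> by (auto simp: has_tderiv_def)
  have GL: "L2L2 (vol \<Omega>) a b G" using G by (simp add: weak_pd_ae_def)
  have int: "has_weak_pd \<Omega> i (\<lambda>x. LINT s|itv a t. \<xi> s x) (\<lambda>x. LINT s|itv a t. G s x)"
    if "a \<le> t" "t \<le> b" for t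
    by (rule has_weak_pd_time_integral[OF \<Omega> L2L2_sub[OF fin \<xi>L] weak_pd_ae_sub[OF \<Omega> G]]) (use that in auto)
  \<comment> \<open>A weak derivative of \<open>\<eta> a\<close> itself is not given. One exists at
    some time \<open>r\<close>, and the increment from \<open>a\<close> to \<open>r\<close> has a
    known weak derivative, which is subtracted.\<close>
  obtain r where r: "a \<le> r" "r \<le> b" "has_weak_pd \<Omega> i (\<eta> r) (G\<^sub>0 r)"
    using AE_itv_exists[OF _ ab] G\<eta> by (auto simp: weak_pd_ae_def)
  define H\<^sub>0 where "H\<^sub>0 = (\<lambda>x. G\<^sub>0 r x - (LINT s|itv a r. G s x))"
  have H0: "has_weak_pd \<Omega> i (\<eta> a) H\<^sub>0"
  proof (rule has_weak_pd_cong)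
    show "has_weak_pd \<Omega> i (\<lambda>x. \<eta> r x - (LINT s|itv a r. \<xi> s x)) H\<^sub>0"
      unfolding H\<^sub>0_def by (rule has_weak_pd_diff[OF \<Omega> r(3) int[OF r(1,2)]])
    show "\<eta> a \<in> borel_measurable (vol \<Omega>)" by (rule L2L2_section[OF \<eta>L]) (use ab in auto)
    show "AE x in vol \<Omega>. \<eta> r x - (LINT s|itv a r. \<xi> s x) = \<eta> a x"
      using has_tderiv_primitive[OF \<eta>]
    proof eventually_elim
      case (elim x)
      from bspec[OF elim, of r] r(1,2) have "\<eta> r x = \<eta> a x + (LINT s|itv a r. \<xi> s x)" by simp
      then show ?case unfolding diff_eq_eq .
    qed
  qed
  define H where "H = (\<lambda>t x. H\<^sub>0 x + (LINT s|itv a t. G s x))"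
  show ?thesis
  proof
    show HT: "has_tderiv (vol \<Omega>) a b H G"
      unfolding H_def by (rule has_tderiv_primitiveI[OF fin GL]) (use H0 ab in \<open>auto simp: has_weak_pd_def\<close>)
    fix t assume t: "a \<le> t" "t \<le> b"
    \<comment> \<open>A sum is obtained from two differences, with the zero function in
      between.\<close>
    have "has_weak_pd \<Omega> i (\<lambda>x. 0) (\<lambda>x. 0 :: 'b)" by (auto simp: has_weak_pd_def L2_zero)
    from has_weak_pd_diff[OF \<Omega> H0 has_weak_pd_diff[OF \<Omega> this int[OF t]]]
    have *: "has_weak_pd \<Omega> i (\<lambda>x. \<eta> a x + (LINT s|itv a t. \<xi> s x)) (H t)"
      by (simp add: H_def)
    show "has_weak_pd \<Omega> i (\<eta> t) (H t)"
    proof (rule has_weak_pd_cong[OF *])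
      show "\<eta> t \<in> borel_measurable (vol \<Omega>)" by (rule L2L2_section[OF \<eta>L t])
      show "AE x in vol \<Omega>. \<eta> a x + (LINT s|itv a t. \<xi> s x) = \<eta> t x"
        using has_tderiv_primitive[OF \<eta>]
      proof eventually_elim
        case (elim x)
        from bspec[OF elim, of t] t have "\<eta> t x = \<eta> a x + (LINT s|itv a t. \<xi> s x)" by simp
        then show ?case by (rule sym)
      qed
    qed
  qed
qed

section \<open>Green's formula\<close>

lemma L2_continuous_vol:
  fixes f :: "real ^ 'd::finite \<Rightarrow> 'b::euclidean_space"
  assumes "continuous_on UNIV f" "open \<Omega>" "bounded \<Omega>"
  shows "L2 (vol \<Omega>) f"
proof -
  obtain B where B: "\<And>x. x \<in> \<Omega> \<Longrightarrow> norm (f x) \<le> B" by (rule continuous_bounded_on[OF assms(1,3)]) blast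
  show ?thesis
  proof (rule L2_bounded[OF finite_vol[OF assms(2,3)]])
    show "f \<in> borel_measurable (vol \<Omega>)"
      by (rule measurable_restrict_space1) (simp add: borel_measurable_continuous_onI assms(1))
    show "AE x in vol \<Omega>. norm (f x) \<le> B"
      by (rule AE_I2) (use B in \<open>simp add: space_restrict_space\<close>)
  qed
qed

lemma surface_finite:
  assumes "surface_normal S \<Omega> n"
  shows "finite_measure (restrict_space S (frontier \<Omega>))"
proof (rule finite_measureI)
  have s: "sets S = sets borel" "emeasure S (frontier \<Omega>) < \<infinity>" using assms by (auto simp: surface_normal_def)
  have "space S = UNIV" using sets_eq_imp_space_eq[OF s(1)] by simp
  then show "emeasure (restrict_space S (frontier \<Omega>)) (space (restrict_space S (frontier \<Omega>))) \<noteq> \<infinity>"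
    using s by (simp add: emeasure_restrict_space space_restrict_space)
qed

lemma measurable_surface:
  assumes "surface_normal S \<Omega> n" "f \<in> borel_measurable borel"
  shows "f \<in> borel_measurable (restrict_space S A)"
proof (rule measurable_restrict_space1)
  have "sets S = sets borel" using assms by (auto simp: surface_normal_def)
  then show "f \<in> borel_measurable S" using assms(2) measurable_cong_sets[of S borel borel borel] by blast
qed

lemma continuous_matrix_vector:
  "continuous_on UNIV (\<lambda>p. (fst p :: real ^ 'n ^ 'm) *v (snd p :: real ^ 'n))"
  unfolding matrix_vector_mult_def by (intro continuous_intros continuous_on_vec_lambda)

lemma measurable_matrix_vector:
  fixes A :: "'a \<Rightarrow> real ^ 'n ^ 'm"
  assumes "A \<in> borel_measurable M" "v \<in> borel_measurable M"
  shows "(\<lambda>x. A x *v v x) \<in> borel_measurable M"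
  using borel_measurable_continuous_on[OF continuous_matrix_vector borel_measurable_Pair[OF assms]] by simp

lemma L2_continuous_surface:
  fixes f :: "real ^ 'd::finite \<Rightarrow> 'b::euclidean_space"
  assumes sn: "surface_normal S \<Omega> n" and \<Omega>: "bounded \<Omega>" and c: "continuous_on UNIV f"
  shows "L2 (restrict_space S (frontier \<Omega>)) f"
proof -
  have "bounded (frontier \<Omega>)"
    using bounded_closure[OF \<Omega>] by (rule bounded_subset) (simp add: frontier_def)
  then obtain B where B: "\<And>x. x \<in> frontier \<Omega> \<Longrightarrow> norm (f x) \<le> B" by (rule continuous_bounded_on[OF c]) blast
  show ?thesis
  proof (rule L2_bounded[OF surface_finite[OF sn]])
    show "f \<in> borel_measurable (restrict_space S (frontier \<Omega>))"
      by (rule measurable_surface[OF sn]) (simp add: borel_measurable_continuous_onI c)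
    show "AE x in restrict_space S (frontier \<Omega>). norm (f x) \<le> B"
      by (rule AE_I2) (use B in \<open>simp add: space_restrict_space\<close>)
  qed
qed

lemma norm_matrix_vector_le:
  obtains K where "\<And>(A :: real ^ 'n ^ 'm) x. norm (A *v x) \<le> norm A * norm x * K"
proof -
  have "bounded_bilinear (\<lambda>(A :: real ^ 'n ^ 'm) x. A *v x)"
    unfolding bilinear_conv_bounded_bilinear[symmetric] bilinear_def
    by (auto intro!: linearI simp: matrix_vector_mult_add_rdistrib matrix_vector_right_distrib
        scaleR_matrix_vector_assoc matrix_vector_mult_scaleR vector_scaleR_matrix_ac)
  from bounded_bilinear.bounded[OF this] show ?thesis using that by blast
qed

text \<open>The normal is merely measurable, but of length one almost everywhere, so the bound on
  the continuous \<open>w\<close> survives the multiplication.\<close>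

lemma L2_continuous_normal:
  fixes w :: "real ^ 'd::finite \<Rightarrow> real ^ 'd ^ 'd"
  assumes sn: "surface_normal S \<Omega> n" and \<Omega>: "bounded \<Omega>" and c: "continuous_on UNIV w"
  shows "L2 (restrict_space S (frontier \<Omega>)) (\<lambda>x. w x *v n x)"
proof -
  let ?F = "restrict_space S (frontier \<Omega>)"
  obtain K where K: "\<And>(A :: real ^ 'd ^ 'd) x. norm (A *v x) \<le> norm A * norm x * K"
    using norm_matrix_vector_le by blast
  have L: "L2 ?F w" by (rule L2_continuous_surface[OF sn \<Omega> c])
  have n: "n \<in> borel_measurable ?F" "AE x in ?F. norm (n x) = 1"
    using sn by (auto simp: surface_normal_def intro!: measurable_surface[OF sn])
  show ?thesis
  proof (rule L2_bound)
    show "(\<lambda>x. w x *v n x) \<in> borel_measurable ?F"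
      using L n(1) by (intro measurable_matrix_vector) (auto simp: L2_def)
    show "integrable ?F (\<lambda>x. K\<^sup>2 * (norm (w x))\<^sup>2)" using L by (simp add: L2_def)
    show "AE x in ?F. (norm (w x *v n x))\<^sup>2 \<le> K\<^sup>2 * (norm (w x))\<^sup>2"
      using n(2)
    proof eventually_elim
      case (elim x)
      have "norm (w x *v n x) \<le> norm (w x) * K" using K[of "w x" "n x"] elim by simp
      from power_mono[OF this norm_ge_zero, of 2] show ?case by (simp add: power_mult_distrib mult.commute)
    qed
  qed
qed

lemma linear_column: "linear (column j :: real ^ 'n::finite ^ 'm::finite \<Rightarrow> real ^ 'm)"
  by (rule linearI) (auto simp: column_def vec_eq_iff)

lemma bounded_linear_column: "bounded_linear (column j :: real ^ 'n::finite ^ 'm::finite \<Rightarrow> real ^ 'm)"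
  using linear_column linear_conv_bounded_linear by blast

lemma column_diff: "column j (A - B :: real ^ 'n::finite ^ 'm::finite) = column j A - column j B"
  by (simp add: linear_diff[OF linear_column])

abbreviation cdiv :: "(real ^ 'd::finite \<Rightarrow> real ^ 'd ^ 'd) \<Rightarrow> real ^ 'd \<Rightarrow> real ^ 'd" where
  "cdiv w x \<equiv> (\<chi> i. \<Sum>j\<in>UNIV. pd j w x $ i $ j)"

lemma cdiv_inner: "cdiv w x \<bullet> v = (\<Sum>j\<in>UNIV. column j (pd j w x) \<bullet> v)"
proof -
  have "cdiv w x \<bullet> v = (\<Sum>i\<in>UNIV. \<Sum>j\<in>UNIV. pd j w x $ i $ j * v $ i)"
    by (simp add: inner_vec_def sum_distrib_right)
  also have "\<dots> = (\<Sum>j\<in>UNIV. \<Sum>i\<in>UNIV. pd j w x $ i $ j * v $ i)" by (rule sum.swap)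
  finally show ?thesis by (simp add: inner_vec_def column_def)
qed

text \<open>The Gauss formula contained in \<open>surface_normal\<close>, applied to the transpose
  of \<open>w\<close> times \<open>v\<close>: its divergence splits by the product rule into the two
  volume terms.\<close>

lemma Green_C1:
  fixes w :: "real ^ 'd::finite \<Rightarrow> real ^ 'd ^ 'd" and v :: "real ^ 'd \<Rightarrow> real ^ 'd"
  assumes \<Omega>: "open \<Omega>" "bounded \<Omega>" and sn: "surface_normal S \<Omega> n" and w: "C1 w" and v: "C1 v"
  shows "(LINT x|vol \<Omega>. cdiv w x \<bullet> v x) + (\<Sum>j\<in>UNIV. LINT x|vol \<Omega>. column j (w x) \<bullet> pd j v x)
    = (LINT x|restrict_space S (frontier \<Omega>). (w x *v n x) \<bullet> v x)"
proof -
  define B where "B = (\<lambda>(A :: real ^ 'd ^ 'd) y. (\<chi> j. column j A \<bullet> y))"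
  have "bounded_bilinear B"
    unfolding bilinear_conv_bounded_bilinear[symmetric] bilinear_def B_def
    by (auto intro!: linearI simp: vec_eq_iff inner_add_left inner_add_right
        linear_add[OF linear_column] linear_scale[OF linear_column])
  then interpret B: bounded_bilinear B .
  obtain w' where w': "\<And>x. (w has_derivative w' x) (at x)" "\<And>h. continuous_on UNIV (\<lambda>x. w' x h)"
    using C1_derivative[OF w] by blast
  obtain v' where v': "\<And>x. (v has_derivative v' x) (at x)" "\<And>h. continuous_on UNIV (\<lambda>x. v' x h)"
    using C1_derivative[OF v] by blast
  note cw = C1_continuous[OF w] and cv = C1_continuous[OF v]
  define \<phi> where "\<phi> = (\<lambda>x. B (w x) (v x))"
  have d: "(\<phi> has_derivative (\<lambda>h. B (w x) (v' x h) + B (w' x h) (v x))) (at x)" for x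
    unfolding \<phi>_def by (rule B.FDERIV[OF w'(1) v'(1)])
  have c1: "C1 \<phi>"
    by (rule C1I[OF d]) (intro continuous_on_add B.continuous_on cw cv w' v')
  have p: "pd j \<phi> x $ j = column j (w x) \<bullet> pd j v x + column j (pd j w x) \<bullet> v x" for j x
    unfolding has_derivative_pd[OF d] has_derivative_pd[OF w'(1)] has_derivative_pd[OF v'(1)]
    by (simp add: B_def)
  have q: "\<phi> x \<bullet> n x = (w x *v n x) \<bullet> v x" for x
  proof -
    have "\<phi> x \<bullet> n x = (\<Sum>j\<in>UNIV. \<Sum>i\<in>UNIV. w x $ i $ j * v x $ i * n x $ j)"
      by (simp add: \<phi>_def B_def inner_vec_def column_def sum_distrib_right)
    also have "\<dots> = (\<Sum>i\<in>UNIV. \<Sum>j\<in>UNIV. w x $ i $ j * v x $ i * n x $ j)" by (rule sum.swap)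
    finally show ?thesis
      by (simp add: inner_vec_def matrix_vector_mult_def sum_distrib_right sum_distrib_left mult_ac)
  qed
  have gauss: "\<forall>\<phi>. C1 \<phi> \<longrightarrow> (LINT x|vol \<Omega>. (\<Sum>i\<in>UNIV. pd i \<phi> x $ i)) =
      (LINT x|restrict_space S (frontier \<Omega>). \<phi> x \<bullet> n x)"
    using sn unfolding surface_normal_def by blast
  have "(LINT x|vol \<Omega>. (\<Sum>j\<in>UNIV. column j (w x) \<bullet> pd j v x + column j (pd j w x) \<bullet> v x))
      = (LINT x|restrict_space S (frontier \<Omega>). (w x *v n x) \<bullet> v x)"
    using gauss[rule_format, OF c1] by (simp only: p q)
  moreover have i1: "integrable (vol \<Omega>) (\<lambda>x. column j (w x) \<bullet> pd j v x)"
    and i2: "integrable (vol \<Omega>) (\<lambda>x. column j (pd j w x) \<bullet> v x)" for j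
    by (intro L2_inner_integrable L2_bounded_linear[OF bounded_linear_column] L2_continuous_vol \<Omega>
        cw cv C1_pd_continuous w v)+
  ultimately show ?thesis
    unfolding cdiv_inner by (simp add: sum.distrib)
qed

lemma wtdiv_has_weak_tdiv:
  assumes "Hdiv S \<Omega> n \<sigma>"
  shows "has_weak_tdiv \<Omega> \<sigma> (wtdiv \<Omega> \<sigma>)"
  using assms someI_ex[of "has_weak_tdiv \<Omega> \<sigma>"] by (simp add: Hdiv_def wtdiv_def)

lemma continuous_cdiv:
  assumes "C1 w"
  shows "continuous_on UNIV (cdiv w)"
  by (intro continuous_on_vec_lambda continuous_on_sum continuous_on_component C1_pd_continuous assms)

lemma H1_L2:
  assumes "H1 S \<Omega> v"
  shows "L2 (vol \<Omega>) v" "L2 (vol \<Omega>) (wpd \<Omega> j v)" "L2 (restrict_space S (frontier \<Omega>)) v"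
    "has_weak_pd \<Omega> j v (wpd \<Omega> j v)"
proof -
  obtain g where "has_weak_pd \<Omega> j v g" using assms unfolding H1_def by blast
  from wpd_has_weak_pd[OF this] show "L2 (vol \<Omega>) v" "L2 (vol \<Omega>) (wpd \<Omega> j v)" "has_weak_pd \<Omega> j v (wpd \<Omega> j v)"
    by (auto simp: has_weak_pd_def)
  show "L2 (restrict_space S (frontier \<Omega>)) v" using assms by (simp add: H1_def)
qed

lemma Hdiv_L2:
  assumes "Hdiv S \<Omega> n \<sigma>"
  shows "L2 (vol \<Omega>) \<sigma>" "L2 (vol \<Omega>) (wtdiv \<Omega> \<sigma>)" "L2 (restrict_space S (frontier \<Omega>)) (\<lambda>x. \<sigma> x *v n x)"
  using wtdiv_has_weak_tdiv[OF assms] assms by (auto simp: has_weak_tdiv_def Hdiv_def)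

text \<open>A density argument: \<open>Hdiv\<close> and \<open>H1\<close> provide C1 approximations
  that converge in the domain together with the relevant derivatives and on the boundary, so each of
  the three terms of \<open>Green_C1\<close> passes to the limit.\<close>

lemma Green:
  fixes \<sigma> :: "real ^ 'd::finite \<Rightarrow> real ^ 'd ^ 'd" and v :: "real ^ 'd \<Rightarrow> real ^ 'd"
  assumes \<Omega>: "open \<Omega>" "bounded \<Omega>" and sn: "surface_normal S \<Omega> n"
    and \<sigma>: "Hdiv S \<Omega> n \<sigma>" and v: "H1 S \<Omega> v"
  shows "(LINT x|vol \<Omega>. wtdiv \<Omega> \<sigma> x \<bullet> v x) + (\<Sum>j\<in>UNIV. LINT x|vol \<Omega>. column j (\<sigma> x) \<bullet> wpd \<Omega> j v x)
    = (LINT x|restrict_space S (frontier \<Omega>). (\<sigma> x *v n x) \<bullet> v x)"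
proof -
  let ?F = "restrict_space S (frontier \<Omega>)"
  obtain w :: "nat \<Rightarrow> real ^ 'd \<Rightarrow> real ^ 'd ^ 'd" where w: "\<And>k. C1 (w k)"
    "(\<lambda>k. L2norm (vol \<Omega>) (\<lambda>x. w k x - \<sigma> x)) \<longlonglongrightarrow> 0"
    "(\<lambda>k. L2norm (vol \<Omega>) (\<lambda>x. cdiv (w k) x - wtdiv \<Omega> \<sigma> x)) \<longlonglongrightarrow> 0"
    "(\<lambda>k. L2norm ?F (\<lambda>x. w k x *v n x - \<sigma> x *v n x)) \<longlonglongrightarrow> 0"
    using \<sigma> unfolding Hdiv_def by blast
  obtain y :: "nat \<Rightarrow> real ^ 'd \<Rightarrow> real ^ 'd" where y: "\<And>k. C1 (y k)"
    "(\<lambda>k. L2norm (vol \<Omega>) (\<lambda>x. y k x - v x)) \<longlonglongrightarrow> 0"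
    "\<And>i. (\<lambda>k. L2norm (vol \<Omega>) (\<lambda>x. pd i (y k) x - wpd \<Omega> i v x)) \<longlonglongrightarrow> 0"
    "(\<lambda>k. L2norm ?F (\<lambda>x. y k x - v x)) \<longlonglongrightarrow> 0"
    using v unfolding H1_def by blast
  note cont = L2_continuous_vol[OF _ \<Omega>]
  note Lw = cont[OF C1_continuous[OF w(1)]] cont[OF continuous_cdiv[OF w(1)]]
    L2_continuous_normal[OF sn \<Omega>(2) C1_continuous[OF w(1)]]
  note Ly = cont[OF C1_continuous[OF y(1)]] cont[OF C1_pd_continuous[OF y(1)]]
    L2_continuous_surface[OF sn \<Omega>(2) C1_continuous[OF y(1)]]
  note L\<sigma> = Hdiv_L2[OF \<sigma>] and Lv = H1_L2[OF v]
  have l1: "(\<lambda>k. LINT x|vol \<Omega>. cdiv (w k) x \<bullet> y k x) \<longlonglongrightarrow> (LINT x|vol \<Omega>. wtdiv \<Omega> \<sigma> x \<bullet> v x)"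
    by (rule L2_inner_tendsto[OF Lw(2) L\<sigma>(2) Ly(1) Lv(1) w(3) y(2)])
  have l2: "(\<lambda>k. LINT x|vol \<Omega>. column j (w k x) \<bullet> pd j (y k) x) \<longlonglongrightarrow> (LINT x|vol \<Omega>. column j (\<sigma> x) \<bullet> wpd \<Omega> j v x)" for j
  proof (rule L2_inner_tendsto[OF _ _ Ly(2) Lv(2) _ y(3)])
    show "L2 (vol \<Omega>) (\<lambda>x. column j (w k x))" for k by (rule L2_bounded_linear[OF bounded_linear_column Lw(1)])
    show "L2 (vol \<Omega>) (\<lambda>x. column j (\<sigma> x))" by (rule L2_bounded_linear[OF bounded_linear_column L\<sigma>(1)])
    show "(\<lambda>k. L2norm (vol \<Omega>) (\<lambda>x. column j (w k x) - column j (\<sigma> x))) \<longlonglongrightarrow> 0"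
      unfolding column_diff[symmetric]
      by (rule L2norm_bounded_linear_tendsto[OF bounded_linear_column L2_diff[OF Lw(1) L\<sigma>(1)] w(2)])
  qed
  have l3: "(\<lambda>k. LINT x|?F. (w k x *v n x) \<bullet> y k x) \<longlonglongrightarrow> (LINT x|?F. (\<sigma> x *v n x) \<bullet> v x)"
    by (rule L2_inner_tendsto[OF Lw(3) L\<sigma>(3) Ly(3) Lv(3) w(4) y(4)])
  have "(\<lambda>k. \<Sum>j\<in>UNIV. LINT x|vol \<Omega>. column j (w k x) \<bullet> pd j (y k) x)
      \<longlonglongrightarrow> (\<Sum>j\<in>UNIV. LINT x|vol \<Omega>. column j (\<sigma> x) \<bullet> wpd \<Omega> j v x)"
    by (rule tendsto_sum) (rule l2)
  from tendsto_add[OF l1 this]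
  have "(\<lambda>k. LINT x|?F. (w k x *v n x) \<bullet> y k x) \<longlonglongrightarrow>
      (LINT x|vol \<Omega>. wtdiv \<Omega> \<sigma> x \<bullet> v x) + (\<Sum>j\<in>UNIV. LINT x|vol \<Omega>. column j (\<sigma> x) \<bullet> wpd \<Omega> j v x)"
    unfolding Green_C1[OF \<Omega> sn w(1) y(1)] .
  from LIMSEQ_unique[OF this l3] show ?thesis .
qed

lemma L2_inner_diff_diff:
  assumes "L2 M f\<^sub>1" "L2 M f\<^sub>2" "L2 M g\<^sub>1" "L2 M g\<^sub>2"
  shows "(LINT x|M. (f\<^sub>1 x - f\<^sub>2 x) \<bullet> (g\<^sub>1 x - g\<^sub>2 x))
    = ((LINT x|M. f\<^sub>1 x \<bullet> g\<^sub>1 x) - (LINT x|M. f\<^sub>1 x \<bullet> g\<^sub>2 x)) - ((LINT x|M. f\<^sub>2 x \<bullet> g\<^sub>1 x) - (LINT x|M. f\<^sub>2 x \<bullet> g\<^sub>2 x))"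
proof -
  note i = L2_inner_integrable[OF assms(1) assms(3)] L2_inner_integrable[OF assms(1) assms(4)]
    L2_inner_integrable[OF assms(2) assms(3)] L2_inner_integrable[OF assms(2) assms(4)]
  show ?thesis
    unfolding inner_diff_left inner_diff_right
    using i by (simp add: Bochner_Integration.integral_diff)
qed

text \<open>Bilinearity over the four pairs. Keeping differences of the chosen derivatives avoids
  relating them to \<open>wtdiv\<close> and \<open>wpd\<close> of the differences, which are
  separate choices.\<close>

lemma Green_diff:
  fixes \<sigma>\<^sub>1 \<sigma>\<^sub>2 :: "real ^ 'd::finite \<Rightarrow> real ^ 'd ^ 'd" and v\<^sub>1 v\<^sub>2 :: "real ^ 'd \<Rightarrow> real ^ 'd"
  assumes \<Omega>: "open \<Omega>" "bounded \<Omega>" and sn: "surface_normal S \<Omega> n"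
    and \<sigma>: "Hdiv S \<Omega> n \<sigma>\<^sub>1" "Hdiv S \<Omega> n \<sigma>\<^sub>2" and v: "H1 S \<Omega> v\<^sub>1" "H1 S \<Omega> v\<^sub>2"
  shows "(LINT x|vol \<Omega>. (wtdiv \<Omega> \<sigma>\<^sub>1 x - wtdiv \<Omega> \<sigma>\<^sub>2 x) \<bullet> (v\<^sub>1 x - v\<^sub>2 x))
     + (LINT x|vol \<Omega>. (\<Sum>j\<in>UNIV. column j (\<sigma>\<^sub>1 x - \<sigma>\<^sub>2 x) \<bullet> (wpd \<Omega> j v\<^sub>1 x - wpd \<Omega> j v\<^sub>2 x)))
    = (LINT x|restrict_space S (frontier \<Omega>). (\<sigma>\<^sub>1 x *v n x - \<sigma>\<^sub>2 x *v n x) \<bullet> (v\<^sub>1 x - v\<^sub>2 x))"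
proof -
  note L = Hdiv_L2[OF \<sigma>(1)] Hdiv_L2[OF \<sigma>(2)] H1_L2(1-3)[OF v(1)] H1_L2(1-3)[OF v(2)]
  note c = L2_bounded_linear[OF bounded_linear_column L(1)] L2_bounded_linear[OF bounded_linear_column L(4)]
  have "(LINT x|vol \<Omega>. (\<Sum>j\<in>UNIV. column j (\<sigma>\<^sub>1 x - \<sigma>\<^sub>2 x) \<bullet> (wpd \<Omega> j v\<^sub>1 x - wpd \<Omega> j v\<^sub>2 x)))
      = (\<Sum>j\<in>UNIV. LINT x|vol \<Omega>. (column j (\<sigma>\<^sub>1 x) - column j (\<sigma>\<^sub>2 x)) \<bullet> (wpd \<Omega> j v\<^sub>1 x - wpd \<Omega> j v\<^sub>2 x))"
    unfolding column_diff
    by (rule Bochner_Integration.integral_sum) (intro L2_inner_integrable L2_diff c L)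
  also have "\<dots> = ((\<Sum>j\<in>UNIV. LINT x|vol \<Omega>. column j (\<sigma>\<^sub>1 x) \<bullet> wpd \<Omega> j v\<^sub>1 x)
      - (\<Sum>j\<in>UNIV. LINT x|vol \<Omega>. column j (\<sigma>\<^sub>1 x) \<bullet> wpd \<Omega> j v\<^sub>2 x))
      - ((\<Sum>j\<in>UNIV. LINT x|vol \<Omega>. column j (\<sigma>\<^sub>2 x) \<bullet> wpd \<Omega> j v\<^sub>1 x)
      - (\<Sum>j\<in>UNIV. LINT x|vol \<Omega>. column j (\<sigma>\<^sub>2 x) \<bullet> wpd \<Omega> j v\<^sub>2 x))"
    unfolding sum_subtractf[symmetric]
    by (intro sum.cong refl L2_inner_diff_diff c L)
  finally show ?thesis
    using L2_inner_diff_diff[OF L(2) L(5) L(7) L(10)] L2_inner_diff_diff[OF L(3) L(6) L(9) L(12)]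
      Green[OF \<Omega> sn \<sigma>(1) v(1)] Green[OF \<Omega> sn \<sigma>(1) v(2)] Green[OF \<Omega> sn \<sigma>(2) v(1)] Green[OF \<Omega> sn \<sigma>(2) v(2)]
    by linarith
qed

lemma integral_restrict_space_subset:
  fixes f :: "'a \<Rightarrow> real"
  assumes "F \<in> sets M" "G \<in> sets M" "G \<subseteq> F" and f: "f \<in> borel_measurable (restrict_space M F)"
    and z: "AE x in restrict_space M (F - G). f x = 0"
  shows "(LINT x|restrict_space M F. f x) = (LINT x|restrict_space M G. f x)"
proof -
  have sets: "F \<inter> space M \<in> sets M" "G \<inter> space M \<in> sets M" "(F - G) \<inter> space M \<in> sets M"
    using assms by auto
  have m: "(\<lambda>x. f x * indicator F x) \<in> borel_measurable M"
    using f borel_measurable_restrict_space_iff[OF sets(1), of f] by (simp add: mult.commute)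
  have "(\<lambda>x. f x * indicator F x * indicator G x) \<in> borel_measurable M"
    by (rule borel_measurable_times[OF m]) (use assms(2) in simp)
  moreover have "f x * indicator F x * indicator G x = indicator G x *\<^sub>R f x" for x
    using assms(3) by (auto simp: indicator_def)
  ultimately have m': "(\<lambda>x. indicator G x *\<^sub>R f x) \<in> borel_measurable M" by simp
  have "AE x in M. indicator F x *\<^sub>R f x = indicator G x *\<^sub>R f x"
    using z[unfolded AE_restrict_space_iff[OF sets(3)]]
    by eventually_elim (use assms(3) in \<open>auto simp: indicator_def\<close>)
  then show ?thesis
    unfolding integral_restrict_space[OF sets(1)] integral_restrict_space[OF sets(2)]
    using m m' by (intro integral_cong_AE) (auto simp: mult.commute)
qed

section \<open>Symmetric gradients\<close>

text \<open>The argument is a family of partial derivatives instead of a function, so that any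
  representative of a weak gradient can be inserted, not only the one picked by \<open>wpd\<close>.
  The same applies to \<open>trc\<close>.\<close>

definition symm :: "('d::finite \<Rightarrow> real ^ 'd) \<Rightarrow> real ^ 'd ^ 'd" where
  "symm g = (\<chi> i j. (g j $ i + g i $ j) / 2)"

definition trc :: "('d::finite \<Rightarrow> real ^ 'd) \<Rightarrow> real" where
  "trc g = (\<Sum>i\<in>UNIV. g i $ i)"

lemma symgrad_symm: "symgrad \<Omega> v x = symm (\<lambda>i. wpd \<Omega> i v x)"
  by (simp add: symgrad_def symm_def)

lemma wdiv_trc: "wdiv \<Omega> v x = trc (\<lambda>i. wpd \<Omega> i v x)"
  by (simp add: wdiv_def trc_def)

lemma symm_diff: "symm (\<lambda>i. g i - h i) = symm g - symm h"
  by (auto simp: symm_def vec_eq_iff field_simps)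

lemma trc_diff: "trc (\<lambda>i. g i - h i) = trc g - trc h"
  by (simp add: trc_def sum_subtractf)

text \<open>A symmetric matrix is orthogonal to the antisymmetric ones, so only the symmetric part
  of the gradient contributes.\<close>

lemma symm_inner: "(\<Sum>j\<in>UNIV. column j (symm g) \<bullet> h j) = symm g \<bullet> symm h"
proof -
  have sym: "symm g $ i $ j = symm g $ j $ i" for i j by (simp add: symm_def)
  have eq: "(\<Sum>j\<in>UNIV. column j (symm g) \<bullet> h j) = (\<Sum>j\<in>UNIV. \<Sum>i\<in>UNIV. symm g $ i $ j * h j $ i)"
    by (simp add: inner_vec_def column_def)
  have eq2: "(\<Sum>j\<in>UNIV. \<Sum>i\<in>UNIV. symm g $ i $ j * h j $ i) = (\<Sum>j\<in>UNIV. \<Sum>i\<in>UNIV. symm g $ i $ j * h i $ j)"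
    by (subst sum.swap) (simp add: sym)
  have "symm g \<bullet> symm h = (\<Sum>i\<in>UNIV. \<Sum>j\<in>UNIV. symm g $ i $ j * ((h j $ i + h i $ j) / 2))"
    by (simp add: inner_vec_def symm_def[of h])
  also have "\<dots> = (\<Sum>i\<in>UNIV. \<Sum>j\<in>UNIV. (symm g $ i $ j * h j $ i) / 2 + (symm g $ i $ j * h i $ j) / 2)"
    by (intro sum.cong refl) (simp add: field_simps)
  also have "\<dots> = (\<Sum>i\<in>UNIV. \<Sum>j\<in>UNIV. symm g $ i $ j * h j $ i) / 2 + (\<Sum>i\<in>UNIV. \<Sum>j\<in>UNIV. symm g $ i $ j * h i $ j) / 2"
    by (simp add: sum.distrib sum_divide_distrib)
  also have "(\<Sum>i\<in>UNIV. \<Sum>j\<in>UNIV. symm g $ i $ j * h j $ i) = (\<Sum>j\<in>UNIV. \<Sum>i\<in>UNIV. symm g $ i $ j * h j $ i)"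
    by (rule sum.swap)
  also have "(\<Sum>i\<in>UNIV. \<Sum>j\<in>UNIV. symm g $ i $ j * h i $ j) = (\<Sum>j\<in>UNIV. \<Sum>i\<in>UNIV. symm g $ i $ j * h i $ j)"
    by (rule sum.swap)
  finally show ?thesis using eq eq2 by simp
qed

lemma mat_inner:
  fixes h :: "'d::finite \<Rightarrow> real ^ 'd"
  shows "(\<Sum>j\<in>UNIV. column j (mat p) \<bullet> h j) = p * trc h"
proof -
  have "column j (mat p :: real ^ 'd ^ 'd) \<bullet> y = p * y $ j" for j and y :: "real ^ 'd"
    by (simp add: inner_vec_def column_def mat_def if_distrib[of "\<lambda>c. c * _"] sum.delta cong: if_cong)
  then show ?thesis by (simp add: trc_def sum_distrib_left)
qed

lemma L2_symm:
  assumes "\<And>i. L2 M (g i)"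
  shows "L2 M (\<lambda>x. symm (\<lambda>i. g i x))"
proof (intro L2_vec)
  fix i j
  have c: "L2 M (\<lambda>x. g k x $ l)" for k l by (rule L2_bounded_linear[OF bounded_linear_vec_nth assms])
  have "L2 M (\<lambda>x. (1 / 2) *\<^sub>R (g j x $ i + g i x $ j))" by (intro L2_scaleR L2_add c)
  then show "L2 M (\<lambda>x. symm (\<lambda>i. g i x) $ i $ j)" by (simp add: symm_def)
qed

lemma L2_trc:
  assumes "\<And>i. L2 M (g i)"
  shows "L2 M (\<lambda>x. trc (\<lambda>i. g i x))"
  unfolding trc_def by (intro L2_sum finite L2_bounded_linear[OF bounded_linear_vec_nth assms])

lemma L2L2_symm:
  assumes "\<And>i. L2L2 M a b (g i)"
  shows "L2L2 M a b (\<lambda>t x. symm (\<lambda>i. g i t x))"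
  using assms unfolding L2L2_def case_prod_beta' by (rule L2_symm)

section \<open>Linear operations on functions differentiable in time\<close>

lemma has_tderiv_bounded_linear:
  assumes M: "finite_measure M" and h: "bounded_linear h" and v: "has_tderiv M a b v dv"
  shows "has_tderiv M a b (\<lambda>t x. h (v t x)) (\<lambda>t x. h (dv t x))"
  unfolding has_tderiv_def set_integral_itv
proof (intro conjI)
  interpret h: bounded_linear h by fact
  have dv: "L2L2 M a b dv" using v by (simp add: has_tderiv_def)
  show "L2L2 M a b (\<lambda>t x. h (v t x))" "L2L2 M a b (\<lambda>t x. h (dv t x))" "L2 M (\<lambda>x. h (v a x))"
    using v by (auto simp: has_tderiv_def intro: L2L2_bounded_linear[OF h] L2_bounded_linear[OF h])
  show "AE x in M. \<forall>t\<in>{a..b}. h (v t x) = h (v a x) + (LINT s|itv a t. h (dv s x))"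
    using L2L2_AE_time[OF M dv] has_tderiv_primitive[OF v]
  proof eventually_elim
    case (elim x)
    show ?case
    proof
      fix t assume t: "t \<in> {a..b}"
      have "integrable (itv a t) (\<lambda>s. dv s x)"
        by (rule itv_integrable_sub[OF L2_integrable[OF finite_itv elim(1)]]) (use t in auto)
      from integral_bounded_linear[OF h this] bspec[OF elim(2) t]
      show "h (v t x) = h (v a x) + (LINT s|itv a t. h (dv s x))" by (simp only: h.add)
    qed
  qed
qed

lemma has_tderiv_add:
  assumes M: "finite_measure M" and v: "has_tderiv M a b v dv" "has_tderiv M a b w dw"
  shows "has_tderiv M a b (\<lambda>t x. v t x + w t x) (\<lambda>t x. dv t x + dw t x)"
  using has_tderiv_diff[OF M v(1) has_tderiv_bounded_linear[OF M bounded_linear_minus[OF bounded_linear_ident] v(2)]]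
  by simp

lemma has_tderiv_sum:
  assumes M: "finite_measure M" and I: "finite I" "I \<noteq> {}" "\<And>i. i \<in> I \<Longrightarrow> has_tderiv M a b (v i) (dv i)"
  shows "has_tderiv M a b (\<lambda>t x. \<Sum>i\<in>I. v i t x) (\<lambda>t x. \<Sum>i\<in>I. dv i t x)"
  using I
proof (induction I rule: finite_ne_induct)
  case (insert i I)
  then show ?case
    using has_tderiv_add[OF M, of a b "v i" "dv i" "\<lambda>t x. \<Sum>i\<in>I. v i t x" "\<lambda>t x. \<Sum>i\<in>I. dv i t x"] by simp
qed simp

lemma has_tderiv_vec:
  fixes v :: "real \<Rightarrow> 'a \<Rightarrow> 'b::euclidean_space ^ 'n::finite"
  assumes M: "finite_measure M" and v: "\<And>i. has_tderiv M a b (\<lambda>t x. v t x $ i) (\<lambda>t x. dv t x $ i)"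
  shows "has_tderiv M a b v dv"
  unfolding has_tderiv_def set_integral_itv
proof (intro conjI)
  have dv: "L2L2 M a b dv" using v by (intro L2L2_vec) (simp add: has_tderiv_def)
  show "L2L2 M a b v" "L2L2 M a b dv" "L2 M (v a)"
    using v by (auto simp: has_tderiv_def intro!: L2L2_vec L2_vec)
  have "AE x in M. \<forall>i\<in>UNIV. \<forall>t\<in>{a..b}. v t x $ i = v a x $ i + (LINT s|itv a t. dv s x $ i)"
    by (rule AE_finite_allI[OF finite]) (rule has_tderiv_primitive[OF v])
  with L2L2_AE_time[OF M dv] show "AE x in M. \<forall>t\<in>{a..b}. v t x = v a x + (LINT s|itv a t. dv s x)"
  proof eventually_elim
    case (elim x)
    show ?case
    proof (intro ballI iffD2[OF vec_eq_iff] allI)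
      fix t i assume t: "t \<in> {a..b}"
      have "integrable (itv a t) (\<lambda>s. dv s x)"
        by (rule itv_integrable_sub[OF L2_integrable[OF finite_itv elim(1)]]) (use t in auto)
      from integral_bounded_linear[OF bounded_linear_vec_nth this, of i] bspec[OF bspec[OF elim(2) UNIV_I] t, of i]
      show "v t x $ i = (v a x + (LINT s|itv a t. dv s x)) $ i" by (simp only: vector_add_component)
    qed
  qed
qed

lemma has_tderiv_symm:
  fixes v :: "'d::finite \<Rightarrow> real \<Rightarrow> 'a \<Rightarrow> real ^ 'd"
  assumes M: "finite_measure M" and v: "\<And>i. has_tderiv M a b (v i) (dv i)"
  shows "has_tderiv M a b (\<lambda>t x. symm (\<lambda>i. v i t x)) (\<lambda>t x. symm (\<lambda>i. dv i t x))"
proof (intro has_tderiv_vec[OF M])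
  fix i j
  have c: "has_tderiv M a b (\<lambda>t x. v k t x $ l) (\<lambda>t x. dv k t x $ l)" for k l
    by (rule has_tderiv_bounded_linear[OF M bounded_linear_vec_nth v])
  have "has_tderiv M a b (\<lambda>t x. (1 / 2) *\<^sub>R (v j t x $ i + v i t x $ j)) (\<lambda>t x. (1 / 2) *\<^sub>R (dv j t x $ i + dv i t x $ j))"
    by (rule has_tderiv_bounded_linear[OF M bounded_linear_scaleR_right has_tderiv_add[OF M c c]])
  then show "has_tderiv M a b (\<lambda>t x. symm (\<lambda>i. v i t x) $ i $ j) (\<lambda>t x. symm (\<lambda>i. dv i t x) $ i $ j)"
    by (simp add: symm_def)
qed

lemma has_tderiv_trc:
  fixes v :: "'d::finite \<Rightarrow> real \<Rightarrow> 'a \<Rightarrow> real ^ 'd"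
  assumes M: "finite_measure M" and v: "\<And>i. has_tderiv M a b (v i) (dv i)"
  shows "has_tderiv M a b (\<lambda>t x. trc (\<lambda>i. v i t x)) (\<lambda>t x. trc (\<lambda>i. dv i t x))"
  unfolding trc_def
  by (rule has_tderiv_sum[OF M]) (auto intro!: has_tderiv_bounded_linear[OF M bounded_linear_vec_nth v])

text \<open>The derivatives agree for almost every \<open>t\<close> and then almost every
  \<open>x\<close>, but the primitive is taken at fixed \<open>x\<close>; the quantifiers are
  therefore exchanged. This puts the velocity in place of the chosen derivative of the
  displacement.\<close>

lemma has_tderiv_cong_deriv:
  assumes M: "finite_measure M" and v: "has_tderiv M a b v dv" and w: "L2L2 M a b w"
    and eq: "AE t in itv a b. AE x in M. dv t x = w t x"
  shows "has_tderiv M a b v w"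
  unfolding has_tderiv_def set_integral_itv
proof (intro conjI)
  interpret pair_sigma_finite "itv a b" M by (rule pair_sigma_finite_itv[OF M])
  have dv: "L2L2 M a b dv" using v by (simp add: has_tderiv_def)
  have eq': "AE x in M. AE t in itv a b. dv t x = w t x"
    using AE_commute[OF L2L2_eq_sets[OF dv w]] eq by blast
  show "L2L2 M a b v" "L2L2 M a b w" "L2 M (v a)" using v w by (auto simp: has_tderiv_def)
  show "AE x in M. \<forall>t\<in>{a..b}. v t x = v a x + (LINT s|itv a t. w s x)"
    using L2L2_AE_time[OF M dv] L2L2_AE_time[OF M w] has_tderiv_primitive[OF v] eq'
  proof eventually_elim
    case (elim x)
    show ?case
    proof
      fix t assume t: "t \<in> {a..b}"
      have "(LINT s|itv a t. dv s x) = (LINT s|itv a t. w s x)"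
      proof (rule integral_cong_AE)
        have "t \<le> b" using t by simp
        note sub = itv_integrable_sub[OF L2_integrable[OF finite_itv] order_refl \<open>t \<le> b\<close>]
        show "(\<lambda>s. dv s x) \<in> borel_measurable (itv a t)" "(\<lambda>s. w s x) \<in> borel_measurable (itv a t)"
          using sub[OF elim(1)] sub[OF elim(2)] by (auto dest: borel_measurable_integrable)
        show "AE s in itv a t. dv s x = w s x" by (rule AE_itv_sub[OF elim(4) order_refl \<open>t \<le> b\<close>])
      qed
      with bspec[OF elim(3) t] show "v t x = v a x + (LINT s|itv a t. w s x)" by (simp only:)
    qed
  qed
qed

text \<open>Both norms see the gradient only up to null sets, so a representative with better
  behaviour in time may replace the chosen one.\<close>

lemma
  fixes v :: "real ^ 'd::finite \<Rightarrow> real ^ 'd"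
  assumes \<Omega>: "open \<Omega>" "bounded \<Omega>" and g: "\<And>i. has_weak_pd \<Omega> i v (g i)"
  shows L2norm_symgrad: "L2norm (vol \<Omega>) (symgrad \<Omega> v) = L2norm (vol \<Omega>) (\<lambda>x. symm (\<lambda>i. g i x))"
    and L2norm_wdiv: "L2norm (vol \<Omega>) (wdiv \<Omega> v) = L2norm (vol \<Omega>) (\<lambda>x. trc (\<lambda>i. g i x))"
proof -
  have "AE x in vol \<Omega>. \<forall>i\<in>UNIV. wpd \<Omega> i v x = g i x"
    by (rule AE_finite_allI[OF finite]) (rule wpd_eq[OF \<Omega> g])
  then have s: "AE x in vol \<Omega>. symgrad \<Omega> v x = symm (\<lambda>i. g i x)"
    and d: "AE x in vol \<Omega>. wdiv \<Omega> v x = trc (\<lambda>i. g i x)"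
    unfolding symgrad_symm wdiv_trc by (eventually_elim, simp)+
  have "L2 (vol \<Omega>) (wpd \<Omega> i v)" "L2 (vol \<Omega>) (g i)" for i
    using wpd_has_weak_pd[OF g[of i]] g[of i] by (auto simp: has_weak_pd_def)
  note L = L2_symm[OF this(1)] L2_symm[OF this(2)] L2_trc[OF this(1)] L2_trc[OF this(2)]
  show "L2norm (vol \<Omega>) (symgrad \<Omega> v) = L2norm (vol \<Omega>) (\<lambda>x. symm (\<lambda>i. g i x))"
    by (rule L2norm_AE_cong[OF _ _ s]) (use L in \<open>auto simp: L2_def symgrad_symm[abs_def]\<close>)
  show "L2norm (vol \<Omega>) (wdiv \<Omega> v) = L2norm (vol \<Omega>) (\<lambda>x. trc (\<lambda>i. g i x))"
    by (rule L2norm_AE_cong[OF _ _ d]) (use L in \<open>auto simp: L2_def wdiv_trc[abs_def]\<close>)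
qed

lemma energy_norm_weak_pd:
  assumes "open (\<Omega>\<^sub>s X)" "bounded (\<Omega>\<^sub>s X)" "\<And>i. has_weak_pd (\<Omega>\<^sub>s X) i v (g i)" "\<mu>\<^sub>s X > 0" "lam\<^sub>s X > 0"
  shows "(energy_norm X v)\<^sup>2 = 2 * \<mu>\<^sub>s X * (L2norm (vol (\<Omega>\<^sub>s X)) (\<lambda>x. symm (\<lambda>i. g i x)))\<^sup>2
    + lam\<^sub>s X * (L2norm (vol (\<Omega>\<^sub>s X)) (\<lambda>x. trc (\<lambda>i. g i x)))\<^sup>2"
  unfolding energy_norm_def L2norm_symgrad[OF assms(1-3)] L2norm_wdiv[OF assms(1-3)]
  using assms(4,5) by (simp add: add_nonneg_nonneg)

lemma energy_norm_cong:
  fixes X :: "'d::finite fsi_data"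
  assumes "open (\<Omega>\<^sub>s X)" "bounded (\<Omega>\<^sub>s X)" "\<And>i. has_weak_pd (\<Omega>\<^sub>s X) i v (g i)" "\<mu>\<^sub>s X > 0" "lam\<^sub>s X > 0"
    and w: "w \<in> borel_measurable (vol (\<Omega>\<^sub>s X))" "AE x in vol (\<Omega>\<^sub>s X). v x = w x"
  shows "(energy_norm X v)\<^sup>2 = (energy_norm X w)\<^sup>2"
  using energy_norm_weak_pd[OF assms(1-5)]
    energy_norm_weak_pd[OF assms(1,2) has_weak_pd_cong[OF assms(3) w] assms(4,5)] by (simp only:)

lemma energy_norm_AE_zero:
  fixes X :: "'d::finite fsi_data"
  assumes X: "open (\<Omega>\<^sub>s X)" "bounded (\<Omega>\<^sub>s X)" "\<mu>\<^sub>s X > 0" "lam\<^sub>s X > 0"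
    and w: "w \<in> borel_measurable (vol (\<Omega>\<^sub>s X))" "AE x in vol (\<Omega>\<^sub>s X). w x = 0"
  shows "(energy_norm X w)\<^sup>2 = 0"
proof -
  have z: "has_weak_pd (\<Omega>\<^sub>s X) i (\<lambda>x. 0 :: real ^ 'd) (\<lambda>x. 0)" for i by (auto simp: has_weak_pd_def L2_zero)
  have "AE x in vol (\<Omega>\<^sub>s X). 0 = w x" using w(2) by eventually_elim simp
  from energy_norm_cong[OF X(1,2) z X(3,4) w(1) this]
  have "(energy_norm X w)\<^sup>2 = (energy_norm X (\<lambda>x. 0))\<^sup>2" by simp
  also have "\<dots> = 0"
  proof -
    have "symm (\<lambda>i::'d. 0 :: real ^ 'd) = 0" "trc (\<lambda>i::'d. 0 :: real ^ 'd) = 0"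
      by (simp_all add: symm_def trc_def vec_eq_iff)
    then show ?thesis
      unfolding energy_norm_weak_pd[OF X(1,2) z X(3,4)] by (simp add: L2norm_def)
  qed
  finally show ?thesis .
qed

section \<open>Energy identities for the errors\<close>

lemma H1t_tderiv: "H1t M a b v \<Longrightarrow> has_tderiv M a b v (tderiv M a b v)"
  unfolding H1t_def tderiv_def by (rule someI_ex[of "has_tderiv M a b v"])

text \<open>As in \<open>fluid_eqs\<close> and \<open>structure_eqs\<close>, but with explicit time derivatives, so that the notions
  pass to subintervals.\<close>

definition fluid_strong ::
    "'d::finite fsi_data \<Rightarrow> real \<Rightarrow> real \<Rightarrow> 'd vfield \<Rightarrow> 'd vfield \<Rightarrow> 'd sfield \<Rightarrow> 'd tfield \<Rightarrow> bool" where
  "fluid_strong X a b u du p \<sigma> \<longleftrightarrow>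
     has_tderiv (vol (\<Omega>\<^sub>f X)) a b u du \<and> (\<forall>i. \<exists>G. weak_pd_ae (\<Omega>\<^sub>f X) i a b u G) \<and>
     (AE t in itv a b. H1 (surf X) (\<Omega>\<^sub>f X) (u t) \<and> Hdiv (surf X) (\<Omega>\<^sub>f X) (n\<^sub>f X) (\<sigma> t) \<and>
        (AE x in vol (\<Omega>\<^sub>f X).
           \<sigma> t x = - mat (p t x) + (2 * \<mu>\<^sub>f X) *\<^sub>R symgrad (\<Omega>\<^sub>f X) (u t) x \<and>
           \<rho>\<^sub>f X *\<^sub>R du t x - wtdiv (\<Omega>\<^sub>f X) (\<sigma> t) x = 0 \<and>
           wdiv (\<Omega>\<^sub>f X) (u t) x = 0) \<and>
        (AE x in restrict_space (surf X) (frontier (\<Omega>\<^sub>f X) - \<Gamma> X).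
           if x \<in> Dir_f X then u t x = 0 else \<sigma> t x *v n\<^sub>f X x = 0))"

definition structure_strong ::
    "'d::finite fsi_data \<Rightarrow> real \<Rightarrow> real \<Rightarrow> 'd vfield \<Rightarrow> 'd vfield \<Rightarrow> 'd vfield \<Rightarrow> 'd tfield \<Rightarrow> bool" where
  "structure_strong X a b \<eta> \<xi> d\<xi> \<sigma> \<longleftrightarrow>
     has_tderiv (vol (\<Omega>\<^sub>s X)) a b \<eta> \<xi> \<and> has_tderiv (vol (\<Omega>\<^sub>s X)) a b \<xi> d\<xi> \<and>
     (\<forall>i. \<exists>G. weak_pd_ae (\<Omega>\<^sub>s X) i a b \<eta> G) \<and> (\<forall>i. \<exists>G. weak_pd_ae (\<Omega>\<^sub>s X) i a b \<xi> G) \<and>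
     (AE t in itv a b. H1 (surf X) (\<Omega>\<^sub>s X) (\<eta> t) \<and> H1 (surf X) (\<Omega>\<^sub>s X) (\<xi> t) \<and>
        Hdiv (surf X) (\<Omega>\<^sub>s X) (n\<^sub>s X) (\<sigma> t) \<and>
        (AE x in vol (\<Omega>\<^sub>s X).
           \<sigma> t x = (2 * \<mu>\<^sub>s X) *\<^sub>R symgrad (\<Omega>\<^sub>s X) (\<eta> t) x + mat (lam\<^sub>s X * wdiv (\<Omega>\<^sub>s X) (\<eta> t) x) \<and>
           \<rho>\<^sub>s X *\<^sub>R d\<xi> t x - wtdiv (\<Omega>\<^sub>s X) (\<sigma> t) x = 0) \<and>
        (AE x in restrict_space (surf X) (frontier (\<Omega>\<^sub>s X) - \<Gamma> X).
           if x \<in> Dir_s X then \<xi> t x = 0 else \<sigma> t x *v n\<^sub>s X x = 0))"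

lemma fsi_settingD:
  assumes "fsi_setting X"
  shows "open (\<Omega>\<^sub>f X)" "bounded (\<Omega>\<^sub>f X)" "open (\<Omega>\<^sub>s X)" "bounded (\<Omega>\<^sub>s X)"
    "surface_normal (surf X) (\<Omega>\<^sub>f X) (n\<^sub>f X)" "surface_normal (surf X) (\<Omega>\<^sub>s X) (n\<^sub>s X)"
    "\<Gamma> X \<in> sets borel" "\<Gamma> X \<subseteq> frontier (\<Omega>\<^sub>f X)" "\<Gamma> X \<subseteq> frontier (\<Omega>\<^sub>s X)"
    "AE x in on_\<Gamma> X. n\<^sub>f X x = - n\<^sub>s X x"
    "\<rho>\<^sub>f X > 0" "\<mu>\<^sub>f X > 0" "\<rho>\<^sub>s X > 0" "\<mu>\<^sub>s X > 0" "lam\<^sub>s X > 0"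
  using assms by (auto simp: fsi_setting_def regular_domain_def)

lemma finite_on_\<Gamma>:
  assumes "fsi_setting X"
  shows "finite_measure (on_\<Gamma> X)"
proof (rule finite_measureI)
  note X = fsi_settingD[OF assms]
  have s: "sets (surf X) = sets borel" "emeasure (surf X) (frontier (\<Omega>\<^sub>f X)) < \<infinity>"
    using X(5) by (auto simp: surface_normal_def)
  have sp: "space (surf X) = UNIV" using sets_eq_imp_space_eq[OF s(1)] by simp
  have "emeasure (surf X) (\<Gamma> X) \<le> emeasure (surf X) (frontier (\<Omega>\<^sub>f X))"
    by (rule emeasure_mono[OF X(8)]) (simp add: s)
  then have "emeasure (surf X) (\<Gamma> X) < \<infinity>" using s(2) by (rule le_less_trans)
  then show "emeasure (on_\<Gamma> X) (space (on_\<Gamma> X)) \<noteq> \<infinity>"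
    using X(7) by (simp add: emeasure_restrict_space space_restrict_space sp s)
qed

lemma fluid_eqs_strong:
  assumes f: "fluid_eqs X a b u p \<sigma>"
  shows "fluid_strong X a b u (tderiv (vol (\<Omega>\<^sub>f X)) a b u) p \<sigma>"
  unfolding fluid_strong_def
proof (intro conjI)
  have H: "H1t (vol (\<Omega>\<^sub>f X)) a b u" "L2H1 (surf X) (\<Omega>\<^sub>f X) a b u" using f by (auto simp: fluid_eqs_def)
  show "has_tderiv (vol (\<Omega>\<^sub>f X)) a b u (tderiv (vol (\<Omega>\<^sub>f X)) a b u)" by (rule H1t_tderiv[OF H(1)])
  show "\<forall>i. \<exists>G. weak_pd_ae (\<Omega>\<^sub>f X) i a b u G" using L2H1_weak_pd_ae[OF H(2)] by metis
  have "AE t in itv a b. H1 (surf X) (\<Omega>\<^sub>f X) (u t)" using H(2) by (simp add: L2H1_def)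
  with f[unfolded fluid_eqs_def, THEN conjunct2, THEN conjunct2, THEN conjunct2, THEN conjunct2]
  show "AE t in itv a b. H1 (surf X) (\<Omega>\<^sub>f X) (u t) \<and> Hdiv (surf X) (\<Omega>\<^sub>f X) (n\<^sub>f X) (\<sigma> t) \<and>
        (AE x in vol (\<Omega>\<^sub>f X).
           \<sigma> t x = - mat (p t x) + (2 * \<mu>\<^sub>f X) *\<^sub>R symgrad (\<Omega>\<^sub>f X) (u t) x \<and>
           \<rho>\<^sub>f X *\<^sub>R tderiv (vol (\<Omega>\<^sub>f X)) a b u t x - wtdiv (\<Omega>\<^sub>f X) (\<sigma> t) x = 0 \<and>
           wdiv (\<Omega>\<^sub>f X) (u t) x = 0) \<and>
        (AE x in restrict_space (surf X) (frontier (\<Omega>\<^sub>f X) - \<Gamma> X).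
           if x \<in> Dir_f X then u t x = 0 else \<sigma> t x *v n\<^sub>f X x = 0)"
    by eventually_elim blast
qed

lemma structure_eqs_strong:
  assumes X: "fsi_setting X" and f: "structure_eqs X a b \<eta> \<xi> \<sigma>"
  shows "structure_strong X a b \<eta> \<xi> (tderiv (vol (\<Omega>\<^sub>s X)) a b \<xi>) \<sigma>"
  unfolding structure_strong_def
proof (intro conjI)
  note fin = finite_vol[OF fsi_settingD(3,4)[OF X]]
  have H: "H1t (vol (\<Omega>\<^sub>s X)) a b \<eta>" "L2H1 (surf X) (\<Omega>\<^sub>s X) a b \<eta>"
    "H1t (vol (\<Omega>\<^sub>s X)) a b \<xi>" "L2H1 (surf X) (\<Omega>\<^sub>s X) a b \<xi>" using f by (auto simp: structure_eqs_def)
  note ae = f[unfolded structure_eqs_def, THEN conjunct2, THEN conjunct2, THEN conjunct2, THEN conjunct2, THEN conjunct2]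
  show \<xi>: "has_tderiv (vol (\<Omega>\<^sub>s X)) a b \<xi> (tderiv (vol (\<Omega>\<^sub>s X)) a b \<xi>)" by (rule H1t_tderiv[OF H(3)])
  \<comment> \<open>The kinematic equation holds almost everywhere for the derivative selected by
    \<open>tderiv\<close>; from here on the velocity itself serves as the time derivative.\<close>
  show "has_tderiv (vol (\<Omega>\<^sub>s X)) a b \<eta> \<xi>"
  proof (rule has_tderiv_cong_deriv[OF fin H1t_tderiv[OF H(1)]])
    show "L2L2 (vol (\<Omega>\<^sub>s X)) a b \<xi>" using \<xi> by (simp add: has_tderiv_def)
    show "AE t in itv a b. AE x in vol (\<Omega>\<^sub>s X). tderiv (vol (\<Omega>\<^sub>s X)) a b \<eta> t x = \<xi> t x"
      using ae
    proof eventually_elim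
      case (elim t)
      from elim[THEN conjunct2, THEN conjunct1] show ?case by eventually_elim blast
    qed
  qed
  show "\<forall>i. \<exists>G. weak_pd_ae (\<Omega>\<^sub>s X) i a b \<eta> G" using L2H1_weak_pd_ae[OF H(2)] by metis
  show "\<forall>i. \<exists>G. weak_pd_ae (\<Omega>\<^sub>s X) i a b \<xi> G" using L2H1_weak_pd_ae[OF H(4)] by metis
  have "AE t in itv a b. H1 (surf X) (\<Omega>\<^sub>s X) (\<eta> t)" "AE t in itv a b. H1 (surf X) (\<Omega>\<^sub>s X) (\<xi> t)"
    using H(2,4) by (auto simp: L2H1_def)
  with ae
  show "AE t in itv a b. H1 (surf X) (\<Omega>\<^sub>s X) (\<eta> t) \<and> H1 (surf X) (\<Omega>\<^sub>s X) (\<xi> t) \<and>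
        Hdiv (surf X) (\<Omega>\<^sub>s X) (n\<^sub>s X) (\<sigma> t) \<and>
        (AE x in vol (\<Omega>\<^sub>s X).
           \<sigma> t x = (2 * \<mu>\<^sub>s X) *\<^sub>R symgrad (\<Omega>\<^sub>s X) (\<eta> t) x + mat (lam\<^sub>s X * wdiv (\<Omega>\<^sub>s X) (\<eta> t) x) \<and>
           \<rho>\<^sub>s X *\<^sub>R tderiv (vol (\<Omega>\<^sub>s X)) a b \<xi> t x - wtdiv (\<Omega>\<^sub>s X) (\<sigma> t) x = 0) \<and>
        (AE x in restrict_space (surf X) (frontier (\<Omega>\<^sub>s X) - \<Gamma> X).
           if x \<in> Dir_s X then \<xi> t x = 0 else \<sigma> t x *v n\<^sub>s X x = 0)"
  proof eventually_elim
    case (elim t)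
    have "AE x in vol (\<Omega>\<^sub>s X).
           \<sigma> t x = (2 * \<mu>\<^sub>s X) *\<^sub>R symgrad (\<Omega>\<^sub>s X) (\<eta> t) x + mat (lam\<^sub>s X * wdiv (\<Omega>\<^sub>s X) (\<eta> t) x) \<and>
           \<rho>\<^sub>s X *\<^sub>R tderiv (vol (\<Omega>\<^sub>s X)) a b \<xi> t x - wtdiv (\<Omega>\<^sub>s X) (\<sigma> t) x = 0"
      using elim(1)[THEN conjunct2, THEN conjunct1] by eventually_elim blast
    moreover have "AE x in restrict_space (surf X) (frontier (\<Omega>\<^sub>s X) - \<Gamma> X).
           if x \<in> Dir_s X then \<xi> t x = 0 else \<sigma> t x *v n\<^sub>s X x = 0"
      using elim(1)[THEN conjunct2, THEN conjunct2] by eventually_elim (auto split: if_splits)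
    ultimately show ?case using elim by blast
  qed
qed

lemma fluid_strong_sub:
  assumes X: "fsi_setting X" and f: "fluid_strong X a b u du p \<sigma>" and *: "a \<le> c" "c \<le> d" "d \<le> b"
  shows "fluid_strong X c d u du p \<sigma>"
  unfolding fluid_strong_def
proof (intro conjI)
  note \<Omega> = fsi_settingD(1,2)[OF X]
  show "has_tderiv (vol (\<Omega>\<^sub>f X)) c d u du"
    using f by (intro has_tderiv_sub[OF finite_vol[OF \<Omega>] _ *]) (simp add: fluid_strong_def)
  show "\<forall>i. \<exists>G. weak_pd_ae (\<Omega>\<^sub>f X) i c d u G"
    using f weak_pd_ae_sub[OF \<Omega> _ *(1,3)] unfolding fluid_strong_def by blast
qed (rule AE_itv_sub[OF f[unfolded fluid_strong_def, THEN conjunct2, THEN conjunct2] *(1,3)])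

lemma structure_strong_sub:
  assumes X: "fsi_setting X" and f: "structure_strong X a b \<eta> \<xi> d\<xi> \<sigma>" and *: "a \<le> c" "c \<le> d" "d \<le> b"
  shows "structure_strong X c d \<eta> \<xi> d\<xi> \<sigma>"
  unfolding structure_strong_def
proof (intro conjI)
  note \<Omega> = fsi_settingD(3,4)[OF X]
  show "has_tderiv (vol (\<Omega>\<^sub>s X)) c d \<eta> \<xi>" "has_tderiv (vol (\<Omega>\<^sub>s X)) c d \<xi> d\<xi>"
    using f by (auto intro!: has_tderiv_sub[OF finite_vol[OF \<Omega>] _ *] simp: structure_strong_def)
  show "\<forall>i. \<exists>G. weak_pd_ae (\<Omega>\<^sub>s X) i c d \<eta> G" "\<forall>i. \<exists>G. weak_pd_ae (\<Omega>\<^sub>s X) i c d \<xi> G"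
    using f weak_pd_ae_sub[OF \<Omega> _ *(1,3)] unfolding structure_strong_def by blast+
qed (rule AE_itv_sub[OF f[unfolded structure_strong_def, THEN conjunct2, THEN conjunct2, THEN conjunct2, THEN conjunct2] *(1,3)])

section \<open>Power balance of the errors at almost every time\<close>

lemma momentum_integral:
  fixes f w dw :: "'a \<Rightarrow> 'b::euclidean_space"
  assumes "AE x in M. \<rho> *\<^sub>R dw x = f x"
    and "f \<in> borel_measurable M" "w \<in> borel_measurable M" "dw \<in> borel_measurable M"
  shows "(LINT x|M. f x \<bullet> w x) = \<rho> * (LINT x|M. w x \<bullet> dw x)"
proof -
  have "(LINT x|M. f x \<bullet> w x) = (LINT x|M. \<rho> * (w x \<bullet> dw x))"
  proof (rule integral_cong_AE)
    show "AE x in M. f x \<bullet> w x = \<rho> * (w x \<bullet> dw x)"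
      using assms(1) by eventually_elim (metis inner_commute inner_scaleR_left)
  qed (use assms in auto)
  then show ?thesis by simp
qed

text \<open>Off the interface each point carries either a Dirichlet or a zero-traction condition, so
  one factor of the work vanishes there.\<close>

lemma boundary_pairing:
  assumes X: "fsi_setting X" and sn: "surface_normal (surf X) \<Omega> n" "\<Gamma> X \<subseteq> frontier \<Omega>"
    and L: "L2 (restrict_space (surf X) (frontier \<Omega>)) f" "L2 (restrict_space (surf X) (frontier \<Omega>)) g"
    and z: "AE x in restrict_space (surf X) (frontier \<Omega> - \<Gamma> X). f x = 0 \<or> g x = 0"
  shows "(LINT x|restrict_space (surf X) (frontier \<Omega>). f x \<bullet> g x) = (LINT x|on_\<Gamma> X. f x \<bullet> g x)"
proof (rule integral_restrict_space_subset)
  have s: "sets (surf X) = sets borel" using sn(1) by (simp add: surface_normal_def)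
  show "frontier \<Omega> \<in> sets (surf X)" "\<Gamma> X \<in> sets (surf X)"
    using fsi_settingD(7)[OF X] by (auto simp: s)
  show "(\<lambda>x. f x \<bullet> g x) \<in> borel_measurable (restrict_space (surf X) (frontier \<Omega>))"
    using L2_inner_integrable[OF L] by simp
  show "AE x in restrict_space (surf X) (frontier \<Omega> - \<Gamma> X). f x \<bullet> g x = 0"
    using z by eventually_elim auto
qed (rule sn(2))

text \<open>The pressure does work only against the trace, so incompressibility cancels it and
  viscous dissipation remains.\<close>

lemma inner_sum_columns_fluid:
  fixes g :: "'d::finite \<Rightarrow> real ^ 'd"
  assumes "trc g = 0"
  shows "(\<Sum>j\<in>UNIV. column j (- mat p + c *\<^sub>R symm g) \<bullet> g j) = c * (norm (symm g))\<^sup>2"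
proof -
  have "(\<Sum>j\<in>UNIV. column j (- mat p + c *\<^sub>R symm g) \<bullet> g j)
      = - (\<Sum>j\<in>UNIV. column j (mat p) \<bullet> g j) + c * (\<Sum>j\<in>UNIV. column j (symm g) \<bullet> g j)"
    by (simp add: linear_add[OF linear_column] linear_neg[OF linear_column] column_diff linear_scale[OF linear_column]
        inner_diff_left sum_subtractf sum_distrib_left sum_negf inner_add_left sum.distrib)
  then show ?thesis by (simp add: mat_inner assms symm_inner power2_norm_eq_inner)
qed

lemma inner_sum_columns_structure:
  fixes g h :: "'d::finite \<Rightarrow> real ^ 'd"
  shows "(\<Sum>j\<in>UNIV. column j (c *\<^sub>R symm g + mat (l * trc g)) \<bullet> h j) = c * (symm g \<bullet> symm h) + l * (trc g * trc h)"
proof -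
  have "(\<Sum>j\<in>UNIV. column j (c *\<^sub>R symm g + mat (l * trc g)) \<bullet> h j)
      = c * (\<Sum>j\<in>UNIV. column j (symm g) \<bullet> h j) + (\<Sum>j\<in>UNIV. column j (mat (l * trc g)) \<bullet> h j)"
    by (simp add: linear_add[OF linear_column] linear_scale[OF linear_column] inner_add_left
        sum_distrib_left sum.distrib)
  then show ?thesis by (simp add: mat_inner symm_inner)
qed

lemma mat_diff: "mat p - mat q = (mat (p - q) :: 'a::ring_1 ^ 'n ^ 'n)"
  by (simp add: mat_def vec_eq_iff)

text \<open>Green's formula tested with the velocity error: the momentum equation turns the
  divergence term into the change of kinetic energy, and the constitutive law turns the stress term
  into dissipation.\<close>

lemma fluid_power_balance:
  fixes X :: "'d::finite fsi_data"
  assumes X: "fsi_setting X"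
    and f1: "fluid_strong X a b u\<^sub>1 du\<^sub>1 p\<^sub>1 \<sigma>\<^sub>1" and f2: "fluid_strong X a b u\<^sub>2 du\<^sub>2 p\<^sub>2 \<sigma>\<^sub>2"
  shows "AE t in itv a b.
    \<rho>\<^sub>f X * (LINT x|vol (\<Omega>\<^sub>f X). (u\<^sub>1 t x - u\<^sub>2 t x) \<bullet> (du\<^sub>1 t x - du\<^sub>2 t x))
     + 2 * \<mu>\<^sub>f X * (L2norm (vol (\<Omega>\<^sub>f X)) (symgrad (\<Omega>\<^sub>f X) (\<lambda>x. u\<^sub>1 t x - u\<^sub>2 t x)))\<^sup>2
    = (LINT x|on_\<Gamma> X. (\<sigma>\<^sub>1 t x *v n\<^sub>f X x - \<sigma>\<^sub>2 t x *v n\<^sub>f X x) \<bullet> (u\<^sub>1 t x - u\<^sub>2 t x))"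
proof -
  let ?\<Omega> = "\<Omega>\<^sub>f X" and ?n = "n\<^sub>f X"
  note S = fsi_settingD[OF X]
  note \<Omega> = S(1,2) and sn = S(5)
  have du: "L2L2 (vol ?\<Omega>) a b du\<^sub>1" "L2L2 (vol ?\<Omega>) a b du\<^sub>2"
    using f1 f2 by (auto simp: fluid_strong_def has_tderiv_def)
  show ?thesis
    using f1[unfolded fluid_strong_def, THEN conjunct2, THEN conjunct2]
      f2[unfolded fluid_strong_def, THEN conjunct2, THEN conjunct2] AE_itv_in[of a b]
  proof eventually_elim
    case (elim t)
    have H: "H1 (surf X) ?\<Omega> (u\<^sub>1 t)" "H1 (surf X) ?\<Omega> (u\<^sub>2 t)"
      and D: "Hdiv (surf X) ?\<Omega> ?n (\<sigma>\<^sub>1 t)" "Hdiv (surf X) ?\<Omega> ?n (\<sigma>\<^sub>2 t)"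
      using elim(1,2) by blast+
    note ae1 = elim(1)[THEN conjunct2, THEN conjunct2, THEN conjunct1]
      and ae2 = elim(2)[THEN conjunct2, THEN conjunct2, THEN conjunct1]
      and bd1 = elim(1)[THEN conjunct2, THEN conjunct2, THEN conjunct2]
      and bd2 = elim(2)[THEN conjunct2, THEN conjunct2, THEN conjunct2]
    note L = H1_L2(1-3)[OF H(1)] H1_L2(1-3)[OF H(2)] Hdiv_L2[OF D(1)] Hdiv_L2[OF D(2)]
    define g where "g = (\<lambda>i x. wpd ?\<Omega> i (u\<^sub>1 t) x - wpd ?\<Omega> i (u\<^sub>2 t) x)"
    have gw: "has_weak_pd ?\<Omega> i (\<lambda>x. u\<^sub>1 t x - u\<^sub>2 t x) (g i)" for i
      unfolding g_def by (rule has_weak_pd_diff[OF \<Omega> H1_L2(4)[OF H(1)] H1_L2(4)[OF H(2)]])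
    have gL: "L2 (vol ?\<Omega>) (g i)" for i using gw[of i] by (simp add: has_weak_pd_def)
    have e: "AE x in vol ?\<Omega>. \<rho>\<^sub>f X *\<^sub>R (du\<^sub>1 t x - du\<^sub>2 t x) = wtdiv ?\<Omega> (\<sigma>\<^sub>1 t) x - wtdiv ?\<Omega> (\<sigma>\<^sub>2 t) x"
      using ae1 ae2 by eventually_elim (simp add: scaleR_diff_right)
    have s: "AE x in vol ?\<Omega>. (\<Sum>j\<in>UNIV. column j (\<sigma>\<^sub>1 t x - \<sigma>\<^sub>2 t x) \<bullet> g j x) = 2 * \<mu>\<^sub>f X * (norm (symm (\<lambda>i. g i x)))\<^sup>2"
      using ae1 ae2
    proof eventually_elim
      case (elim x)
      have "\<sigma>\<^sub>1 t x - \<sigma>\<^sub>2 t x = - (mat (p\<^sub>1 t x) - mat (p\<^sub>2 t x)) + (2 * \<mu>\<^sub>f X) *\<^sub>R (symgrad ?\<Omega> (u\<^sub>1 t) x - symgrad ?\<Omega> (u\<^sub>2 t) x)"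
        using elim by (simp add: scaleR_diff_right)
      also have "\<dots> = - mat (p\<^sub>1 t x - p\<^sub>2 t x) + (2 * \<mu>\<^sub>f X) *\<^sub>R symm (\<lambda>i. g i x)"
        by (simp only: symgrad_symm symm_diff[symmetric] mat_diff g_def)
      finally have 1: "\<sigma>\<^sub>1 t x - \<sigma>\<^sub>2 t x = - mat (p\<^sub>1 t x - p\<^sub>2 t x) + (2 * \<mu>\<^sub>f X) *\<^sub>R symm (\<lambda>i. g i x)" .
      have "trc (\<lambda>i. g i x) = wdiv ?\<Omega> (u\<^sub>1 t) x - wdiv ?\<Omega> (u\<^sub>2 t) x"
        by (simp only: wdiv_trc trc_diff[symmetric] g_def)
      then have "trc (\<lambda>i. g i x) = 0" using elim by simp
      from inner_sum_columns_fluid[OF this] show ?case by (simp only: 1)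
    qed
    have i1: "(LINT x|vol ?\<Omega>. (wtdiv ?\<Omega> (\<sigma>\<^sub>1 t) x - wtdiv ?\<Omega> (\<sigma>\<^sub>2 t) x) \<bullet> (u\<^sub>1 t x - u\<^sub>2 t x))
       = \<rho>\<^sub>f X * (LINT x|vol ?\<Omega>. (u\<^sub>1 t x - u\<^sub>2 t x) \<bullet> (du\<^sub>1 t x - du\<^sub>2 t x))"
      using L(1,4,8,11) L2L2_section[OF du(1)] L2L2_section[OF du(2)] elim(3)
      by (intro momentum_integral[OF e] borel_measurable_diff) (auto simp: L2_def)
    have i2: "(LINT x|vol ?\<Omega>. (\<Sum>j\<in>UNIV. column j (\<sigma>\<^sub>1 t x - \<sigma>\<^sub>2 t x) \<bullet> g j x))
       = 2 * \<mu>\<^sub>f X * (L2norm (vol ?\<Omega>) (symgrad ?\<Omega> (\<lambda>x. u\<^sub>1 t x - u\<^sub>2 t x)))\<^sup>2"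
    proof -
      have "(LINT x|vol ?\<Omega>. (\<Sum>j\<in>UNIV. column j (\<sigma>\<^sub>1 t x - \<sigma>\<^sub>2 t x) \<bullet> g j x))
         = (LINT x|vol ?\<Omega>. 2 * \<mu>\<^sub>f X * (norm (symm (\<lambda>i. g i x)))\<^sup>2)"
      proof (rule integral_cong_AE[OF _ _ s])
        have "integrable (vol ?\<Omega>) (\<lambda>x. \<Sum>j\<in>UNIV. column j (\<sigma>\<^sub>1 t x - \<sigma>\<^sub>2 t x) \<bullet> g j x)"
          by (intro Bochner_Integration.integrable_sum L2_inner_integrable L2_bounded_linear[OF bounded_linear_column]
              L2_diff L gL)
        then show "(\<lambda>x. \<Sum>j\<in>UNIV. column j (\<sigma>\<^sub>1 t x - \<sigma>\<^sub>2 t x) \<bullet> g j x) \<in> borel_measurable (vol ?\<Omega>)" by simp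
        show "(\<lambda>x. 2 * \<mu>\<^sub>f X * (norm (symm (\<lambda>i. g i x)))\<^sup>2) \<in> borel_measurable (vol ?\<Omega>)"
          using L2_symm[of "vol ?\<Omega>" g, OF gL] by (auto simp: L2_def)
      qed
      then show ?thesis by (simp add: L2norm_symgrad[OF \<Omega> gw] L2norm_sq)
    qed
    have "(LINT x|restrict_space (surf X) (frontier ?\<Omega>). (\<sigma>\<^sub>1 t x *v ?n x - \<sigma>\<^sub>2 t x *v ?n x) \<bullet> (u\<^sub>1 t x - u\<^sub>2 t x))
       = (LINT x|on_\<Gamma> X. (\<sigma>\<^sub>1 t x *v ?n x - \<sigma>\<^sub>2 t x *v ?n x) \<bullet> (u\<^sub>1 t x - u\<^sub>2 t x))"
    \<comment> \<open>Both solutions carry the same type of condition at each point of the outer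
      boundary, so their difference inherits it.\<close>
    proof (rule boundary_pairing[OF X sn S(8) L2_diff[OF L(9) L(12)] L2_diff[OF L(3) L(6)]])
      show "AE x in restrict_space (surf X) (frontier ?\<Omega> - \<Gamma> X).
          \<sigma>\<^sub>1 t x *v ?n x - \<sigma>\<^sub>2 t x *v ?n x = 0 \<or> u\<^sub>1 t x - u\<^sub>2 t x = 0"
        using bd1 bd2 by eventually_elim (auto split: if_splits)
    qed
    with Green_diff[OF \<Omega> sn D H] show ?case unfolding i1 i2[unfolded g_def] by simp
  qed
qed

text \<open>The representatives \<open>H\<close> and \<open>G\<close> are left open so that the pair
  from \<open>structure_error_weak_pd\<close> fits, for which \<open>G\<close> is the time
  derivative of \<open>H\<close>; the elastic power then is itself a time derivative.\<close>

lemma structure_power_balance: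
  fixes X :: "'d::finite fsi_data"
  assumes X: "fsi_setting X"
    and f1: "structure_strong X a b \<eta>\<^sub>1 \<xi>\<^sub>1 d\<xi>\<^sub>1 \<sigma>\<^sub>1" and f2: "structure_strong X a b \<eta>\<^sub>2 \<xi>\<^sub>2 d\<xi>\<^sub>2 \<sigma>\<^sub>2"
    and H: "\<And>i. AE t in itv a b. has_weak_pd (\<Omega>\<^sub>s X) i (\<lambda>x. \<eta>\<^sub>1 t x - \<eta>\<^sub>2 t x) (H i t)"
    and G: "\<And>i. AE t in itv a b. has_weak_pd (\<Omega>\<^sub>s X) i (\<lambda>x. \<xi>\<^sub>1 t x - \<xi>\<^sub>2 t x) (G i t)"
  shows "AE t in itv a b.
    \<rho>\<^sub>s X * (LINT x|vol (\<Omega>\<^sub>s X). (\<xi>\<^sub>1 t x - \<xi>\<^sub>2 t x) \<bullet> (d\<xi>\<^sub>1 t x - d\<xi>\<^sub>2 t x))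
     + (2 * \<mu>\<^sub>s X * (LINT x|vol (\<Omega>\<^sub>s X). symm (\<lambda>i. H i t x) \<bullet> symm (\<lambda>i. G i t x))
     + lam\<^sub>s X * (LINT x|vol (\<Omega>\<^sub>s X). trc (\<lambda>i. H i t x) \<bullet> trc (\<lambda>i. G i t x)))
    = (LINT x|on_\<Gamma> X. (\<sigma>\<^sub>1 t x *v n\<^sub>s X x - \<sigma>\<^sub>2 t x *v n\<^sub>s X x) \<bullet> (\<xi>\<^sub>1 t x - \<xi>\<^sub>2 t x))"
proof -
  let ?\<Omega> = "\<Omega>\<^sub>s X" and ?n = "n\<^sub>s X"
  note S = fsi_settingD[OF X]
  note \<Omega> = S(3,4) and sn = S(6)
  have du: "L2L2 (vol ?\<Omega>) a b d\<xi>\<^sub>1" "L2L2 (vol ?\<Omega>) a b d\<xi>\<^sub>2"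
    using f1 f2 by (auto simp: structure_strong_def has_tderiv_def)
  have HG: "AE t in itv a b. \<forall>i\<in>UNIV. has_weak_pd ?\<Omega> i (\<lambda>x. \<eta>\<^sub>1 t x - \<eta>\<^sub>2 t x) (H i t)"
    "AE t in itv a b. \<forall>i\<in>UNIV. has_weak_pd ?\<Omega> i (\<lambda>x. \<xi>\<^sub>1 t x - \<xi>\<^sub>2 t x) (G i t)"
    by (rule AE_finite_allI[OF finite H]) (rule AE_finite_allI[OF finite G])
  show ?thesis
    using f1[unfolded structure_strong_def, THEN conjunct2, THEN conjunct2, THEN conjunct2, THEN conjunct2]
      f2[unfolded structure_strong_def, THEN conjunct2, THEN conjunct2, THEN conjunct2, THEN conjunct2]
      HG AE_itv_in[of a b]
  proof eventually_elim
    case (elim t)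
    have E: "H1 (surf X) ?\<Omega> (\<eta>\<^sub>1 t)" "H1 (surf X) ?\<Omega> (\<eta>\<^sub>2 t)"
      and Z: "H1 (surf X) ?\<Omega> (\<xi>\<^sub>1 t)" "H1 (surf X) ?\<Omega> (\<xi>\<^sub>2 t)"
      and D: "Hdiv (surf X) ?\<Omega> ?n (\<sigma>\<^sub>1 t)" "Hdiv (surf X) ?\<Omega> ?n (\<sigma>\<^sub>2 t)"
      using elim(1,2) by blast+
    note ae1 = elim(1)[THEN conjunct2, THEN conjunct2, THEN conjunct2, THEN conjunct1]
      and ae2 = elim(2)[THEN conjunct2, THEN conjunct2, THEN conjunct2, THEN conjunct1]
      and bd1 = elim(1)[THEN conjunct2, THEN conjunct2, THEN conjunct2, THEN conjunct2]
      and bd2 = elim(2)[THEN conjunct2, THEN conjunct2, THEN conjunct2, THEN conjunct2]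
    note L = H1_L2(1-3)[OF Z(1)] H1_L2(1-3)[OF Z(2)] Hdiv_L2[OF D(1)] Hdiv_L2[OF D(2)]
    define k where "k = (\<lambda>i x. wpd ?\<Omega> i (\<eta>\<^sub>1 t) x - wpd ?\<Omega> i (\<eta>\<^sub>2 t) x)"
    define g where "g = (\<lambda>i x. wpd ?\<Omega> i (\<xi>\<^sub>1 t) x - wpd ?\<Omega> i (\<xi>\<^sub>2 t) x)"
    have kw: "has_weak_pd ?\<Omega> i (\<lambda>x. \<eta>\<^sub>1 t x - \<eta>\<^sub>2 t x) (k i)" for i
      unfolding k_def by (rule has_weak_pd_diff[OF \<Omega> H1_L2(4)[OF E(1)] H1_L2(4)[OF E(2)]])
    have gw: "has_weak_pd ?\<Omega> i (\<lambda>x. \<xi>\<^sub>1 t x - \<xi>\<^sub>2 t x) (g i)" for i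
      unfolding g_def by (rule has_weak_pd_diff[OF \<Omega> H1_L2(4)[OF Z(1)] H1_L2(4)[OF Z(2)]])
    have gL: "L2 (vol ?\<Omega>) (g i)" for i using gw[of i] by (simp add: has_weak_pd_def)
    have Hw: "has_weak_pd ?\<Omega> i (\<lambda>x. \<eta>\<^sub>1 t x - \<eta>\<^sub>2 t x) (H i t)"
      and Gw: "has_weak_pd ?\<Omega> i (\<lambda>x. \<xi>\<^sub>1 t x - \<xi>\<^sub>2 t x) (G i t)" for i using elim(3,4) by auto
    have HL: "L2 (vol ?\<Omega>) (H i t)" and GL: "L2 (vol ?\<Omega>) (G i t)" for i
      using Hw[of i] Gw[of i] by (auto simp: has_weak_pd_def)
    \<comment> \<open>The derivatives coming from Green's formula and the prescribed ones are two
      representatives of the same gradient.\<close>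
    have Hk: "AE x in vol ?\<Omega>. \<forall>i\<in>UNIV. k i x = H i t x"
      by (rule AE_finite_allI[OF finite]) (rule has_weak_pd_unique[OF \<Omega> kw Hw])
    have Gg: "AE x in vol ?\<Omega>. \<forall>i\<in>UNIV. g i x = G i t x"
      by (rule AE_finite_allI[OF finite]) (rule has_weak_pd_unique[OF \<Omega> gw Gw])
    have e: "AE x in vol ?\<Omega>. \<rho>\<^sub>s X *\<^sub>R (d\<xi>\<^sub>1 t x - d\<xi>\<^sub>2 t x) = wtdiv ?\<Omega> (\<sigma>\<^sub>1 t) x - wtdiv ?\<Omega> (\<sigma>\<^sub>2 t) x"
      using ae1 ae2 by eventually_elim (simp add: scaleR_diff_right)
    have s: "AE x in vol ?\<Omega>. (\<Sum>j\<in>UNIV. column j (\<sigma>\<^sub>1 t x - \<sigma>\<^sub>2 t x) \<bullet> g j x)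
       = 2 * \<mu>\<^sub>s X * (symm (\<lambda>i. H i t x) \<bullet> symm (\<lambda>i. G i t x)) + lam\<^sub>s X * (trc (\<lambda>i. H i t x) \<bullet> trc (\<lambda>i. G i t x))"
      using ae1 ae2 Hk Gg
    proof eventually_elim
      case (elim x)
      have "\<sigma>\<^sub>1 t x - \<sigma>\<^sub>2 t x = (2 * \<mu>\<^sub>s X) *\<^sub>R (symgrad ?\<Omega> (\<eta>\<^sub>1 t) x - symgrad ?\<Omega> (\<eta>\<^sub>2 t) x)
          + (mat (lam\<^sub>s X * wdiv ?\<Omega> (\<eta>\<^sub>1 t) x) - mat (lam\<^sub>s X * wdiv ?\<Omega> (\<eta>\<^sub>2 t) x))"
        using elim by (simp add: scaleR_diff_right)
      also have "\<dots> = (2 * \<mu>\<^sub>s X) *\<^sub>R symm (\<lambda>i. k i x) + mat (lam\<^sub>s X * trc (\<lambda>i. k i x))"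
        by (simp only: symgrad_symm symm_diff[symmetric] mat_diff k_def right_diff_distrib[symmetric] wdiv_trc trc_diff[symmetric])
      also have "(\<lambda>i. k i x) = (\<lambda>i. H i t x)" using elim by auto
      finally show ?case
        using elim(4) by (simp add: inner_sum_columns_structure)
    qed
    have i1: "(LINT x|vol ?\<Omega>. (wtdiv ?\<Omega> (\<sigma>\<^sub>1 t) x - wtdiv ?\<Omega> (\<sigma>\<^sub>2 t) x) \<bullet> (\<xi>\<^sub>1 t x - \<xi>\<^sub>2 t x))
       = \<rho>\<^sub>s X * (LINT x|vol ?\<Omega>. (\<xi>\<^sub>1 t x - \<xi>\<^sub>2 t x) \<bullet> (d\<xi>\<^sub>1 t x - d\<xi>\<^sub>2 t x))"
      using L(1,4,8,11) L2L2_section[OF du(1)] L2L2_section[OF du(2)] elim(5)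
      by (intro momentum_integral[OF e] borel_measurable_diff) (auto simp: L2_def)
    have i2: "(LINT x|vol ?\<Omega>. (\<Sum>j\<in>UNIV. column j (\<sigma>\<^sub>1 t x - \<sigma>\<^sub>2 t x) \<bullet> g j x))
       = 2 * \<mu>\<^sub>s X * (LINT x|vol ?\<Omega>. symm (\<lambda>i. H i t x) \<bullet> symm (\<lambda>i. G i t x))
       + lam\<^sub>s X * (LINT x|vol ?\<Omega>. trc (\<lambda>i. H i t x) \<bullet> trc (\<lambda>i. G i t x))"
    proof -
      have iS: "integrable (vol ?\<Omega>) (\<lambda>x. symm (\<lambda>i. H i t x) \<bullet> symm (\<lambda>i. G i t x))"
        by (rule L2_inner_integrable[OF L2_symm[OF HL] L2_symm[OF GL]])
      have iT: "integrable (vol ?\<Omega>) (\<lambda>x. trc (\<lambda>i. H i t x) \<bullet> trc (\<lambda>i. G i t x))"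
        by (rule L2_inner_integrable[OF L2_trc[OF HL] L2_trc[OF GL]])
      have "(LINT x|vol ?\<Omega>. (\<Sum>j\<in>UNIV. column j (\<sigma>\<^sub>1 t x - \<sigma>\<^sub>2 t x) \<bullet> g j x))
         = (LINT x|vol ?\<Omega>. 2 * \<mu>\<^sub>s X * (symm (\<lambda>i. H i t x) \<bullet> symm (\<lambda>i. G i t x)) + lam\<^sub>s X * (trc (\<lambda>i. H i t x) \<bullet> trc (\<lambda>i. G i t x)))"
      proof (rule integral_cong_AE[OF _ _ s])
        have "integrable (vol ?\<Omega>) (\<lambda>x. \<Sum>j\<in>UNIV. column j (\<sigma>\<^sub>1 t x - \<sigma>\<^sub>2 t x) \<bullet> g j x)"
          by (intro Bochner_Integration.integrable_sum L2_inner_integrable L2_bounded_linear[OF bounded_linear_column]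
              L2_diff L gL)
        then show "(\<lambda>x. \<Sum>j\<in>UNIV. column j (\<sigma>\<^sub>1 t x - \<sigma>\<^sub>2 t x) \<bullet> g j x) \<in> borel_measurable (vol ?\<Omega>)" by simp
        show "(\<lambda>x. 2 * \<mu>\<^sub>s X * (symm (\<lambda>i. H i t x) \<bullet> symm (\<lambda>i. G i t x)) + lam\<^sub>s X * (trc (\<lambda>i. H i t x) \<bullet> trc (\<lambda>i. G i t x)))
            \<in> borel_measurable (vol ?\<Omega>)"
          by (intro borel_measurable_add borel_measurable_times borel_measurable_const borel_measurable_integrable[OF iS]
              borel_measurable_integrable[OF iT])
      qed
      also have "\<dots> = 2 * \<mu>\<^sub>s X * (LINT x|vol ?\<Omega>. symm (\<lambda>i. H i t x) \<bullet> symm (\<lambda>i. G i t x))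
         + lam\<^sub>s X * (LINT x|vol ?\<Omega>. trc (\<lambda>i. H i t x) \<bullet> trc (\<lambda>i. G i t x))"
        using iS iT by (subst Bochner_Integration.integral_add) auto
      finally show ?thesis .
    qed
    have "(LINT x|restrict_space (surf X) (frontier ?\<Omega>). (\<sigma>\<^sub>1 t x *v ?n x - \<sigma>\<^sub>2 t x *v ?n x) \<bullet> (\<xi>\<^sub>1 t x - \<xi>\<^sub>2 t x))
       = (LINT x|on_\<Gamma> X. (\<sigma>\<^sub>1 t x *v ?n x - \<sigma>\<^sub>2 t x *v ?n x) \<bullet> (\<xi>\<^sub>1 t x - \<xi>\<^sub>2 t x))"
    proof (rule boundary_pairing[OF X sn S(9) L2_diff[OF L(9) L(12)] L2_diff[OF L(3) L(6)]])
      show "AE x in restrict_space (surf X) (frontier ?\<Omega> - \<Gamma> X).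
          \<sigma>\<^sub>1 t x *v ?n x - \<sigma>\<^sub>2 t x *v ?n x = 0 \<or> \<xi>\<^sub>1 t x - \<xi>\<^sub>2 t x = 0"
        using bd1 bd2 by eventually_elim (auto split: if_splits)
    qed
    with Green_diff[OF \<Omega> sn D Z] show ?case unfolding i1 i2[unfolded g_def] by simp
  qed
qed

text \<open>Here \<open>F\<close> may be assembled from separate choices at each time and equals a
  measurable function only almost everywhere; completeness of \<open>lebesgue\<close> makes it
  measurable nevertheless. This serves the dissipation in \<open>err_T\<close>.\<close>

lemma lebesgue_integral_itv:
  fixes F q :: "real \<Rightarrow> real"
  assumes q: "integrable (itv a b) q" and eq: "AE t in itv a b. F t = q t"
  shows "(LINT t:{a..b}|lebesgue. F t) = (LINT t|itv a b. q t)"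
proof -
  have m: "(\<lambda>t. indicator {a..b} t *\<^sub>R q t) \<in> borel_measurable lborel"
    using q by (simp add: integrable_restrict_space borel_measurable_integrable)
  then have mq: "(\<lambda>t. indicator {a..b} t *\<^sub>R q t) \<in> borel_measurable lebesgue" by (rule measurable_completion)
  have ae: "AE t in lebesgue. indicator {a..b} t *\<^sub>R q t = indicator {a..b} t *\<^sub>R F t"
    using AE_completion[OF eq[unfolded AE_itv]] by eventually_elim (auto simp: indicator_def)
  have mF: "(\<lambda>t. indicator {a..b} t *\<^sub>R F t) \<in> borel_measurable lebesgue"
    by (rule borel_measurable_AE[OF mq ae])
  have "(LINT t:{a..b}|lebesgue. F t) = (LINT t|lebesgue. indicator {a..b} t *\<^sub>R q t)"
    unfolding set_lebesgue_integral_def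
    by (rule integral_cong_AE[OF mF mq]) (use ae in \<open>auto elim: eventually_mono\<close>)
  also have "\<dots> = (LINT t|lborel. indicator {a..b} t *\<^sub>R q t)" by (rule integral_completion[OF m])
  finally show ?thesis by (simp add: integral_restrict_space)
qed

text \<open>The power balance integrated in time, with \<open>has_tderiv_energy\<close> for the
  kinetic part. The boundary power enters through an integrable version \<open>\<beta>\<close>,
  since integrability in time is known for a particular form of the integrand.\<close>

lemma fluid_energy:
  fixes X :: "'d::finite fsi_data"
  assumes X: "fsi_setting X" and ab: "a \<le> b"
    and f1: "fluid_strong X a b u\<^sub>1 du\<^sub>1 p\<^sub>1 \<sigma>\<^sub>1" and f2: "fluid_strong X a b u\<^sub>2 du\<^sub>2 p\<^sub>2 \<sigma>\<^sub>2"
    and \<beta>: "integrable (itv a b) \<beta>"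
      "AE t in itv a b. \<beta> t = (LINT x|on_\<Gamma> X. (\<sigma>\<^sub>1 t x *v n\<^sub>f X x - \<sigma>\<^sub>2 t x *v n\<^sub>f X x) \<bullet> (u\<^sub>1 t x - u\<^sub>2 t x))"
  shows "\<rho>\<^sub>f X / 2 * (L2norm (vol (\<Omega>\<^sub>f X)) (\<lambda>x. u\<^sub>1 b x - u\<^sub>2 b x))\<^sup>2
     + 2 * \<mu>\<^sub>f X * (LINT t:{a..b}|lebesgue. (L2norm (vol (\<Omega>\<^sub>f X)) (symgrad (\<Omega>\<^sub>f X) (\<lambda>x. u\<^sub>1 t x - u\<^sub>2 t x)))\<^sup>2)
    = \<rho>\<^sub>f X / 2 * (L2norm (vol (\<Omega>\<^sub>f X)) (\<lambda>x. u\<^sub>1 a x - u\<^sub>2 a x))\<^sup>2 + (LINT t|itv a b. \<beta> t)"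
proof -
  let ?\<Omega> = "\<Omega>\<^sub>f X"
  note S = fsi_settingD[OF X]
  note \<Omega> = S(1,2)
  note fin = finite_vol[OF \<Omega>]
  have T: "has_tderiv (vol ?\<Omega>) a b (\<lambda>t x. u\<^sub>1 t x - u\<^sub>2 t x) (\<lambda>t x. du\<^sub>1 t x - du\<^sub>2 t x)"
    using f1 f2 by (intro has_tderiv_diff[OF fin]) (auto simp: fluid_strong_def)
  have "\<forall>i. \<exists>G. weak_pd_ae ?\<Omega> i a b u\<^sub>1 G" using f1 unfolding fluid_strong_def by blast
  then obtain G\<^sub>1 where G1: "\<And>i. weak_pd_ae ?\<Omega> i a b u\<^sub>1 (G\<^sub>1 i)" by metis
  have "\<forall>i. \<exists>G. weak_pd_ae ?\<Omega> i a b u\<^sub>2 G" using f2 unfolding fluid_strong_def by blast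
  then obtain G\<^sub>2 where G2: "\<And>i. weak_pd_ae ?\<Omega> i a b u\<^sub>2 (G\<^sub>2 i)" by metis
  define G where "G = (\<lambda>i t x. G\<^sub>1 i t x - G\<^sub>2 i t x)"
  have G: "weak_pd_ae ?\<Omega> i a b (\<lambda>t x. u\<^sub>1 t x - u\<^sub>2 t x) (G i)" for i
    unfolding G_def by (rule weak_pd_ae_diff[OF \<Omega> G1 G2])
  \<comment> \<open>The dissipation written with the jointly measurable gradient, hence integrable
    in time.\<close>
  define q where "q = (\<lambda>t. (L2norm (vol ?\<Omega>) (\<lambda>x. symm (\<lambda>i. G i t x)))\<^sup>2)"
  have qi: "integrable (itv a b) q"
    unfolding q_def by (rule L2L2_norm_integrable[OF fin L2L2_symm]) (use G in \<open>simp add: weak_pd_ae_def\<close>)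
  have "AE t in itv a b. \<forall>i\<in>UNIV. has_weak_pd ?\<Omega> i (\<lambda>x. u\<^sub>1 t x - u\<^sub>2 t x) (G i t)"
    by (rule AE_finite_allI[OF finite]) (use G in \<open>simp add: weak_pd_ae_def\<close>)
  then have q: "AE t in itv a b. (L2norm (vol ?\<Omega>) (symgrad ?\<Omega> (\<lambda>x. u\<^sub>1 t x - u\<^sub>2 t x)))\<^sup>2 = q t"
  proof eventually_elim
    case (elim t)
    have "has_weak_pd ?\<Omega> i (\<lambda>x. u\<^sub>1 t x - u\<^sub>2 t x) (G i t)" for i using elim by blast
    from L2norm_symgrad[OF \<Omega> this] show ?case by (simp add: q_def)
  qed
  have TL: "L2L2 (vol ?\<Omega>) a b (\<lambda>t x. u\<^sub>1 t x - u\<^sub>2 t x)" "L2L2 (vol ?\<Omega>) a b (\<lambda>t x. du\<^sub>1 t x - du\<^sub>2 t x)"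
    using T by (auto simp: has_tderiv_def)
  note ki = L2L2_inner_time_integrable[OF fin TL]
  have "(LINT t|itv a b. \<beta> t) = (LINT t|itv a b. \<rho>\<^sub>f X * (LINT x|vol ?\<Omega>. (u\<^sub>1 t x - u\<^sub>2 t x) \<bullet> (du\<^sub>1 t x - du\<^sub>2 t x)) + 2 * \<mu>\<^sub>f X * q t)"
  proof (rule integral_cong_AE)
    show "\<beta> \<in> borel_measurable (itv a b)" using \<beta>(1) by (rule borel_measurable_integrable)
    show "(\<lambda>t. \<rho>\<^sub>f X * (LINT x|vol ?\<Omega>. (u\<^sub>1 t x - u\<^sub>2 t x) \<bullet> (du\<^sub>1 t x - du\<^sub>2 t x)) + 2 * \<mu>\<^sub>f X * q t) \<in> borel_measurable (itv a b)"
      by (intro borel_measurable_add borel_measurable_times borel_measurable_const borel_measurable_integrable ki qi)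
    show "AE t in itv a b. \<beta> t = \<rho>\<^sub>f X * (LINT x|vol ?\<Omega>. (u\<^sub>1 t x - u\<^sub>2 t x) \<bullet> (du\<^sub>1 t x - du\<^sub>2 t x)) + 2 * \<mu>\<^sub>f X * q t"
      using \<beta>(2) q fluid_power_balance[OF X f1 f2] by eventually_elim simp
  qed
  also have "\<dots> = \<rho>\<^sub>f X * (LINT t|itv a b. LINT x|vol ?\<Omega>. (u\<^sub>1 t x - u\<^sub>2 t x) \<bullet> (du\<^sub>1 t x - du\<^sub>2 t x)) + 2 * \<mu>\<^sub>f X * (LINT t|itv a b. q t)"
    using ki qi by (subst Bochner_Integration.integral_add) auto
  finally show ?thesis
    using has_tderiv_energy[OF fin T ab] lebesgue_integral_itv[OF qi q] by (simp add: field_simps)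
qed

text \<open>The elastic energy has to be evaluated at the end points of a step. Therefore the
  gradients of the displacement error are given at every time, as absolutely continuous functions
  whose derivatives are the gradients of the velocity error.\<close>

lemma structure_error_weak_pd:
  fixes X :: "'d::finite fsi_data"
  assumes X: "fsi_setting X" and ab: "a < b"
    and f1: "structure_strong X a b \<eta>\<^sub>1 \<xi>\<^sub>1 d\<xi>\<^sub>1 \<sigma>\<^sub>1" and f2: "structure_strong X a b \<eta>\<^sub>2 \<xi>\<^sub>2 d\<xi>\<^sub>2 \<sigma>\<^sub>2"
  obtains H G where "\<And>i. has_tderiv (vol (\<Omega>\<^sub>s X)) a b (H i) (G i)"
    "\<And>i t. a \<le> t \<Longrightarrow> t \<le> b \<Longrightarrow> has_weak_pd (\<Omega>\<^sub>s X) i (\<lambda>x. \<eta>\<^sub>1 t x - \<eta>\<^sub>2 t x) (H i t)"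
    "\<And>i. weak_pd_ae (\<Omega>\<^sub>s X) i a b (\<lambda>t x. \<xi>\<^sub>1 t x - \<xi>\<^sub>2 t x) (G i)"
proof -
  let ?\<Omega> = "\<Omega>\<^sub>s X"
  note \<Omega> = fsi_settingD(3,4)[OF X]
  have "\<forall>i. \<exists>G. weak_pd_ae ?\<Omega> i a b \<xi>\<^sub>1 G" using f1 unfolding structure_strong_def by blast
  then obtain G\<^sub>1 where G1: "\<And>i. weak_pd_ae ?\<Omega> i a b \<xi>\<^sub>1 (G\<^sub>1 i)" by metis
  have "\<forall>i. \<exists>G. weak_pd_ae ?\<Omega> i a b \<xi>\<^sub>2 G" using f2 unfolding structure_strong_def by blast
  then obtain G\<^sub>2 where G2: "\<And>i. weak_pd_ae ?\<Omega> i a b \<xi>\<^sub>2 (G\<^sub>2 i)" by metis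
  have "\<forall>i. \<exists>G. weak_pd_ae ?\<Omega> i a b \<eta>\<^sub>1 G" using f1 unfolding structure_strong_def by blast
  then obtain K\<^sub>1 where K1: "\<And>i. weak_pd_ae ?\<Omega> i a b \<eta>\<^sub>1 (K\<^sub>1 i)" by metis
  have "\<forall>i. \<exists>G. weak_pd_ae ?\<Omega> i a b \<eta>\<^sub>2 G" using f2 unfolding structure_strong_def by blast
  then obtain K\<^sub>2 where K2: "\<And>i. weak_pd_ae ?\<Omega> i a b \<eta>\<^sub>2 (K\<^sub>2 i)" by metis
  define G where "G = (\<lambda>i t x. G\<^sub>1 i t x - G\<^sub>2 i t x)"
  have G: "weak_pd_ae ?\<Omega> i a b (\<lambda>t x. \<xi>\<^sub>1 t x - \<xi>\<^sub>2 t x) (G i)" for i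
    unfolding G_def by (rule weak_pd_ae_diff[OF \<Omega> G1 G2])
  have T: "has_tderiv (vol ?\<Omega>) a b (\<lambda>t x. \<eta>\<^sub>1 t x - \<eta>\<^sub>2 t x) (\<lambda>t x. \<xi>\<^sub>1 t x - \<xi>\<^sub>2 t x)"
    using f1 f2 by (intro has_tderiv_diff[OF finite_vol[OF \<Omega>]]) (auto simp: structure_strong_def)
  have "\<exists>H. has_tderiv (vol ?\<Omega>) a b H (G i) \<and> (\<forall>t. a \<le> t \<and> t \<le> b \<longrightarrow> has_weak_pd ?\<Omega> i (\<lambda>x. \<eta>\<^sub>1 t x - \<eta>\<^sub>2 t x) (H t))" for i
    by (rule has_weak_pd_everywhere[OF \<Omega> T ab weak_pd_ae_diff[OF \<Omega> K1 K2] G]) blast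
  then obtain H where "\<And>i. has_tderiv (vol ?\<Omega>) a b (H i) (G i)"
    "\<And>i t. a \<le> t \<Longrightarrow> t \<le> b \<Longrightarrow> has_weak_pd ?\<Omega> i (\<lambda>x. \<eta>\<^sub>1 t x - \<eta>\<^sub>2 t x) (H i t)" by metis
  then show ?thesis using G by (rule that)
qed

text \<open>By linearity, the symmetric gradient and the divergence of the displacement error have
  those of the velocity error as time derivatives. The elastic power is thus the derivative of half
  the squared energy norm, and no dissipation appears.\<close>

lemma structure_energy:
  fixes X :: "'d::finite fsi_data"
  assumes X: "fsi_setting X" and ab: "a < b"
    and f1: "structure_strong X a b \<eta>\<^sub>1 \<xi>\<^sub>1 d\<xi>\<^sub>1 \<sigma>\<^sub>1" and f2: "structure_strong X a b \<eta>\<^sub>2 \<xi>\<^sub>2 d\<xi>\<^sub>2 \<sigma>\<^sub>2"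
    and \<beta>: "integrable (itv a b) \<beta>"
      "AE t in itv a b. \<beta> t = (LINT x|on_\<Gamma> X. (\<sigma>\<^sub>1 t x *v n\<^sub>s X x - \<sigma>\<^sub>2 t x *v n\<^sub>s X x) \<bullet> (\<xi>\<^sub>1 t x - \<xi>\<^sub>2 t x))"
  shows "\<rho>\<^sub>s X / 2 * (L2norm (vol (\<Omega>\<^sub>s X)) (\<lambda>x. \<xi>\<^sub>1 b x - \<xi>\<^sub>2 b x))\<^sup>2
     + 1 / 2 * (energy_norm X (\<lambda>x. \<eta>\<^sub>1 b x - \<eta>\<^sub>2 b x))\<^sup>2
    = \<rho>\<^sub>s X / 2 * (L2norm (vol (\<Omega>\<^sub>s X)) (\<lambda>x. \<xi>\<^sub>1 a x - \<xi>\<^sub>2 a x))\<^sup>2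
     + 1 / 2 * (energy_norm X (\<lambda>x. \<eta>\<^sub>1 a x - \<eta>\<^sub>2 a x))\<^sup>2 + (LINT t|itv a b. \<beta> t)"
proof -
  let ?\<Omega> = "\<Omega>\<^sub>s X"
  note S = fsi_settingD[OF X]
  note \<Omega> = S(3,4)
  note fin = finite_vol[OF \<Omega>]
  have le: "a \<le> b" using ab by simp
  have T: "has_tderiv (vol ?\<Omega>) a b (\<lambda>t x. \<xi>\<^sub>1 t x - \<xi>\<^sub>2 t x) (\<lambda>t x. d\<xi>\<^sub>1 t x - d\<xi>\<^sub>2 t x)"
    using f1 f2 by (intro has_tderiv_diff[OF fin]) (auto simp: structure_strong_def)
  obtain H G where HG: "\<And>i. has_tderiv (vol ?\<Omega>) a b (H i) (G i)"
    and Hw: "\<And>i t. a \<le> t \<Longrightarrow> t \<le> b \<Longrightarrow> has_weak_pd ?\<Omega> i (\<lambda>x. \<eta>\<^sub>1 t x - \<eta>\<^sub>2 t x) (H i t)"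
    and G: "\<And>i. weak_pd_ae ?\<Omega> i a b (\<lambda>t x. \<xi>\<^sub>1 t x - \<xi>\<^sub>2 t x) (G i)"
    by (rule structure_error_weak_pd[OF X ab f1 f2]) blast
  note sT = has_tderiv_symm[OF fin HG] and tT = has_tderiv_trc[OF fin HG]
  have TL: "L2L2 (vol ?\<Omega>) a b (\<lambda>t x. \<xi>\<^sub>1 t x - \<xi>\<^sub>2 t x)" "L2L2 (vol ?\<Omega>) a b (\<lambda>t x. d\<xi>\<^sub>1 t x - d\<xi>\<^sub>2 t x)"
    using T by (auto simp: has_tderiv_def)
  have sL: "L2L2 (vol ?\<Omega>) a b (\<lambda>t x. symm (\<lambda>i. H i t x))" "L2L2 (vol ?\<Omega>) a b (\<lambda>t x. symm (\<lambda>i. G i t x))"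
    using sT by (auto simp: has_tderiv_def)
  have tL: "L2L2 (vol ?\<Omega>) a b (\<lambda>t x. trc (\<lambda>i. H i t x))" "L2L2 (vol ?\<Omega>) a b (\<lambda>t x. trc (\<lambda>i. G i t x))"
    using tT by (auto simp: has_tderiv_def)
  note ki = L2L2_inner_time_integrable[OF fin TL] and si = L2L2_inner_time_integrable[OF fin sL]
    and ti = L2L2_inner_time_integrable[OF fin tL]
  let ?k = "\<lambda>t. LINT x|vol ?\<Omega>. (\<xi>\<^sub>1 t x - \<xi>\<^sub>2 t x) \<bullet> (d\<xi>\<^sub>1 t x - d\<xi>\<^sub>2 t x)"
    and ?s = "\<lambda>t. LINT x|vol ?\<Omega>. symm (\<lambda>i. H i t x) \<bullet> symm (\<lambda>i. G i t x)"
    and ?t = "\<lambda>t. LINT x|vol ?\<Omega>. trc (\<lambda>i. H i t x) \<bullet> trc (\<lambda>i. G i t x)"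
  have bal: "AE t in itv a b. \<rho>\<^sub>s X * ?k t + (2 * \<mu>\<^sub>s X * ?s t + lam\<^sub>s X * ?t t)
      = (LINT x|on_\<Gamma> X. (\<sigma>\<^sub>1 t x *v n\<^sub>s X x - \<sigma>\<^sub>2 t x *v n\<^sub>s X x) \<bullet> (\<xi>\<^sub>1 t x - \<xi>\<^sub>2 t x))"
  proof (rule structure_power_balance[OF X f1 f2])
    show "AE t in itv a b. has_weak_pd ?\<Omega> i (\<lambda>x. \<eta>\<^sub>1 t x - \<eta>\<^sub>2 t x) (H i t)" for i
      using AE_itv_in[of a b] by eventually_elim (use Hw in blast)
    show "AE t in itv a b. has_weak_pd ?\<Omega> i (\<lambda>x. \<xi>\<^sub>1 t x - \<xi>\<^sub>2 t x) (G i t)" for i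
      using G[of i] by (simp add: weak_pd_ae_def)
  qed
  have "(LINT t|itv a b. \<beta> t) = (LINT t|itv a b. \<rho>\<^sub>s X * ?k t + (2 * \<mu>\<^sub>s X * ?s t + lam\<^sub>s X * ?t t))"
  proof (rule integral_cong_AE)
    show "\<beta> \<in> borel_measurable (itv a b)" using \<beta>(1) by (rule borel_measurable_integrable)
    show "(\<lambda>t. \<rho>\<^sub>s X * ?k t + (2 * \<mu>\<^sub>s X * ?s t + lam\<^sub>s X * ?t t)) \<in> borel_measurable (itv a b)"
      by (intro borel_measurable_add borel_measurable_times borel_measurable_const borel_measurable_integrable ki si ti)
    show "AE t in itv a b. \<beta> t = \<rho>\<^sub>s X * ?k t + (2 * \<mu>\<^sub>s X * ?s t + lam\<^sub>s X * ?t t)"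
      using \<beta>(2) bal by eventually_elim simp
  qed
  also have "\<dots> = \<rho>\<^sub>s X * (LINT t|itv a b. ?k t) + (2 * \<mu>\<^sub>s X * (LINT t|itv a b. ?s t) + lam\<^sub>s X * (LINT t|itv a b. ?t t))"
    using ki si ti by (simp add: Bochner_Integration.integral_add)
  finally have *: "(LINT t|itv a b. \<beta> t) = \<dots>" .
  note Ea = energy_norm_weak_pd[OF \<Omega> Hw[OF order_refl le] S(14,15)]
    and Eb = energy_norm_weak_pd[OF \<Omega> Hw[OF le order_refl] S(14,15)]
  define A B C D E F where "A = (L2norm (vol ?\<Omega>) (\<lambda>x. \<xi>\<^sub>1 b x - \<xi>\<^sub>2 b x))\<^sup>2"
    and "B = (L2norm (vol ?\<Omega>) (\<lambda>x. \<xi>\<^sub>1 a x - \<xi>\<^sub>2 a x))\<^sup>2"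
    and "C = (L2norm (vol ?\<Omega>) (\<lambda>x. symm (\<lambda>i. H i b x)))\<^sup>2" and "D = (L2norm (vol ?\<Omega>) (\<lambda>x. symm (\<lambda>i. H i a x)))\<^sup>2"
    and "E = (L2norm (vol ?\<Omega>) (\<lambda>x. trc (\<lambda>i. H i b x)))\<^sup>2" and "F = (L2norm (vol ?\<Omega>) (\<lambda>x. trc (\<lambda>i. H i a x)))\<^sup>2"
  have v: "(LINT t|itv a b. ?k t) = (A - B) / 2" "(LINT t|itv a b. ?s t) = (C - D) / 2" "(LINT t|itv a b. ?t t) = (E - F) / 2"
    using has_tderiv_energy[OF fin T le] has_tderiv_energy[OF fin sT le] has_tderiv_energy[OF fin tT le]
    unfolding A_def B_def C_def D_def E_def F_def by simp_all
  show ?thesis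
    unfolding Ea Eb * v unfolding A_def[symmetric] B_def[symmetric] C_def[symmetric] D_def[symmetric] E_def[symmetric] F_def[symmetric]
    by (simp add: field_simps)
qed

section \<open>The Robin transmission step\<close>

text \<open>Both Robin conditions complete a square: \<open>b \<bullet> a + L/2 |a|\<^sup>2 + 1/(2L) |b|\<^sup>2 = 1/(2L) |L a + b|\<^sup>2\<close>.
  The two right-hand sides are \<open>A + B\<close> and \<open>A - B\<close>, so the parallelogram law applies to their sum.\<close>

lemma robin_pointwise:
  fixes a b c d p q r w :: "'a::real_inner"
  assumes L: "L > 0"
    and 1: "L *\<^sub>R a + b = (L / 2) *\<^sub>R (p + q) + (1 / 2) *\<^sub>R (r + w)"
    and 2: "L *\<^sub>R c - d = (L / 2) *\<^sub>R (p + q) - (1 / 2) *\<^sub>R (r + w)"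
  shows "b \<bullet> a - d \<bullet> c + (L / 2 * ((norm a)\<^sup>2 + (norm c)\<^sup>2) + 1 / (2 * L) * ((norm b)\<^sup>2 + (norm d)\<^sup>2))
    \<le> L / 2 * ((norm p)\<^sup>2 + (norm q)\<^sup>2) + 1 / (2 * L) * ((norm r)\<^sup>2 + (norm w)\<^sup>2)"
proof -
  define A B where "A = (L / 2) *\<^sub>R (p + q)" and "B = (1 / 2) *\<^sub>R (r + w)"
  have sq: "(norm (b + L *\<^sub>R a))\<^sup>2 = (norm b)\<^sup>2 + 2 * L * (b \<bullet> a) + L\<^sup>2 * (norm a)\<^sup>2"
    "(norm (- d + L *\<^sub>R c))\<^sup>2 = (norm d)\<^sup>2 - 2 * L * (d \<bullet> c) + L\<^sup>2 * (norm c)\<^sup>2"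
    using norm_add_scaleR_sq[of b L a] norm_add_scaleR_sq[of "- d" L c] by simp_all
  have eq: "b + L *\<^sub>R a = A + B" "- d + L *\<^sub>R c = A - B"
    using 1 2 by (simp_all add: A_def B_def add.commute)
  have par: "(norm (A + B))\<^sup>2 + (norm (A - B))\<^sup>2 = 2 * ((norm A)\<^sup>2 + (norm B)\<^sup>2)"
    using norm_add_scaleR_sq[of A 1 B] norm_add_scaleR_sq[of A "-1" B] by simp
  have two: "(norm (x + y))\<^sup>2 \<le> 2 * ((norm x)\<^sup>2 + (norm y)\<^sup>2)" for x y :: 'a
    using norm_add_sq_le[of 1 x y] by simp
  have nA: "(norm A)\<^sup>2 \<le> L\<^sup>2 / 2 * ((norm p)\<^sup>2 + (norm q)\<^sup>2)"
    using mult_left_mono[OF two[of p q], of "L\<^sup>2 / 4"] L by (simp add: A_def power_mult_distrib power_divide)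
  have nB: "(norm B)\<^sup>2 \<le> 1 / 2 * ((norm r)\<^sup>2 + (norm w)\<^sup>2)"
    using two[of r w] by (simp add: B_def power_mult_distrib power_divide)
  have "2 * L * (b \<bullet> a - d \<bullet> c + (L / 2 * ((norm a)\<^sup>2 + (norm c)\<^sup>2) + 1 / (2 * L) * ((norm b)\<^sup>2 + (norm d)\<^sup>2)))
      = (norm (b + L *\<^sub>R a))\<^sup>2 + (norm (- d + L *\<^sub>R c))\<^sup>2"
    unfolding sq using L by (simp add: field_simps power2_eq_square)
  also have "\<dots> = 2 * ((norm A)\<^sup>2 + (norm B)\<^sup>2)" unfolding eq by (rule par)
  also have "\<dots> \<le> 2 * (L\<^sup>2 / 2 * ((norm p)\<^sup>2 + (norm q)\<^sup>2) + 1 / 2 * ((norm r)\<^sup>2 + (norm w)\<^sup>2))"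
    by (intro mult_left_mono add_mono nA nB) simp
  also have "\<dots> = 2 * L * (L / 2 * ((norm p)\<^sup>2 + (norm q)\<^sup>2) + 1 / (2 * L) * ((norm r)\<^sup>2 + (norm w)\<^sup>2))"
    using L by (simp add: field_simps power2_eq_square)
  finally show ?thesis using L by simp
qed

text \<open>The integrand of S at one time; velocities come first, normal stresses last. These
  weights are the ones with which the boundary work completes the squares of the Robin
  expressions.\<close>

definition robin_norm ::
    "real \<Rightarrow> 'a measure \<Rightarrow> ('a \<Rightarrow> 'b::euclidean_space) \<Rightarrow> ('a \<Rightarrow> 'b) \<Rightarrow> ('a \<Rightarrow> 'b) \<Rightarrow> ('a \<Rightarrow> 'b) \<Rightarrow> real" where
  "robin_norm L M f g h k = L / 2 * ((L2norm M f)\<^sup>2 + (L2norm M g)\<^sup>2) + 1 / (2 * L) * ((L2norm M h)\<^sup>2 + (L2norm M k)\<^sup>2)"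

lemma
  assumes "L2 M f" "L2 M g" "L2 M h" "L2 M k"
  shows robin_norm_integrable:
      "integrable M (\<lambda>x. L / 2 * ((norm (f x))\<^sup>2 + (norm (g x))\<^sup>2) + 1 / (2 * L) * ((norm (h x))\<^sup>2 + (norm (k x))\<^sup>2))"
    and robin_norm_integral:
      "robin_norm L M f g h k = (LINT x|M. L / 2 * ((norm (f x))\<^sup>2 + (norm (g x))\<^sup>2) + 1 / (2 * L) * ((norm (h x))\<^sup>2 + (norm (k x))\<^sup>2))"
proof -
  have i: "integrable M (\<lambda>x. (norm (f x))\<^sup>2 + (norm (g x))\<^sup>2)" "integrable M (\<lambda>x. (norm (h x))\<^sup>2 + (norm (k x))\<^sup>2)"
    using assms by (auto simp: L2_def)
  show "integrable M (\<lambda>x. L / 2 * ((norm (f x))\<^sup>2 + (norm (g x))\<^sup>2) + 1 / (2 * L) * ((norm (h x))\<^sup>2 + (norm (k x))\<^sup>2))"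
    by (intro Bochner_Integration.integrable_add integrable_mult_right i)
  show "robin_norm L M f g h k = (LINT x|M. L / 2 * ((norm (f x))\<^sup>2 + (norm (g x))\<^sup>2) + 1 / (2 * L) * ((norm (h x))\<^sup>2 + (norm (k x))\<^sup>2))"
    unfolding robin_norm_def L2norm_sq
      Bochner_Integration.integral_add[OF integrable_mult_right[OF i(1), of "L / 2"] integrable_mult_right[OF i(2), of "1 / (2 * L)"]]
      integral_mult_right_zero
    using assms by (simp add: L2_def)
qed

text \<open>Primes mark the errors of the previous step. Each of the four old quantities is such an
  error plus an increment of the exact solution, and Young's inequality separates the two with one
  common weight.\<close>

lemma robin_step:
  fixes a b c d a' b' c' d' \<delta>a \<delta>b \<delta>c \<delta>d :: "'a \<Rightarrow> 'b::euclidean_space"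
  assumes L: "L > 0" and e: "e > 0"
    and new: "L2 M a" "L2 M b" "L2 M c" "L2 M d"
    and old: "L2 M a'" "L2 M b'" "L2 M c'" "L2 M d'"
    and \<delta>: "L2 M \<delta>a" "L2 M \<delta>b" "L2 M \<delta>c" "L2 M \<delta>d"
    and eq: "AE x in M. L *\<^sub>R a x + b x = (L / 2) *\<^sub>R ((a' x + \<delta>a x) + (c' x + \<delta>c x)) + (1 / 2) *\<^sub>R ((b' x + \<delta>b x) + (d' x + \<delta>d x))
       \<and> L *\<^sub>R c x - d x = (L / 2) *\<^sub>R ((a' x + \<delta>a x) + (c' x + \<delta>c x)) - (1 / 2) *\<^sub>R ((b' x + \<delta>b x) + (d' x + \<delta>d x))"
  shows "(LINT x|M. b x \<bullet> a x) - (LINT x|M. d x \<bullet> c x) + robin_norm L M a c b d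
    \<le> (1 + e) * robin_norm L M a' c' b' d' + (1 + 1 / e) * robin_norm L M \<delta>a \<delta>c \<delta>b \<delta>d"
proof -
  let ?R = "\<lambda>f g h k x. L / 2 * ((norm (f x))\<^sup>2 + (norm (g x))\<^sup>2) + 1 / (2 * L) * ((norm (h x))\<^sup>2 + (norm (k x))\<^sup>2)"
  have rearrange: "l * ((k * A + s * B) + (k * C + s * D)) + r * ((k * E + s * F) + (k * G + s * H))
      = k * (l * (A + C) + r * (E + G)) + s * (l * (B + D) + r * (F + H))"
    for A B C D E F G H k l r s :: real by (simp add: algebra_simps)
  note i = L2_inner_integrable[OF new(2,1)] L2_inner_integrable[OF new(4,3)]
    robin_norm_integrable[OF new(1,3,2,4), of L] robin_norm_integrable[OF old(1,3,2,4), of L]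
    robin_norm_integrable[OF \<delta>(1,3,2,4), of L]
  have "(LINT x|M. b x \<bullet> a x - d x \<bullet> c x + ?R a c b d x) \<le> (LINT x|M. (1 + e) * ?R a' c' b' d' x + (1 + 1 / e) * ?R \<delta>a \<delta>c \<delta>b \<delta>d x)"
  proof (rule integral_mono_AE)
    show "integrable M (\<lambda>x. b x \<bullet> a x - d x \<bullet> c x + ?R a c b d x)"
      by (intro Bochner_Integration.integrable_add Bochner_Integration.integrable_diff i)
    show "integrable M (\<lambda>x. (1 + e) * ?R a' c' b' d' x + (1 + 1 / e) * ?R \<delta>a \<delta>c \<delta>b \<delta>d x)"
      by (intro Bochner_Integration.integrable_add integrable_mult_right i)
    show "AE x in M. b x \<bullet> a x - d x \<bullet> c x + ?R a c b d x \<le> (1 + e) * ?R a' c' b' d' x + (1 + 1 / e) * ?R \<delta>a \<delta>c \<delta>b \<delta>d x"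
      using eq
    proof eventually_elim
      case (elim x)
      note n = norm_add_sq_le[OF e]
      have "b x \<bullet> a x - d x \<bullet> c x + ?R a c b d x
        \<le> L / 2 * ((norm (a' x + \<delta>a x))\<^sup>2 + (norm (c' x + \<delta>c x))\<^sup>2) + 1 / (2 * L) * ((norm (b' x + \<delta>b x))\<^sup>2 + (norm (d' x + \<delta>d x))\<^sup>2)"
        using elim by (intro robin_pointwise[OF L]) blast+
      also have "\<dots> \<le> L / 2 * (((1 + e) * (norm (a' x))\<^sup>2 + (1 + 1 / e) * (norm (\<delta>a x))\<^sup>2) + ((1 + e) * (norm (c' x))\<^sup>2 + (1 + 1 / e) * (norm (\<delta>c x))\<^sup>2))
         + 1 / (2 * L) * (((1 + e) * (norm (b' x))\<^sup>2 + (1 + 1 / e) * (norm (\<delta>b x))\<^sup>2) + ((1 + e) * (norm (d' x))\<^sup>2 + (1 + 1 / e) * (norm (\<delta>d x))\<^sup>2))"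
        using L by (intro add_mono mult_left_mono n) auto
      also have "\<dots> = (1 + e) * ?R a' c' b' d' x + (1 + 1 / e) * ?R \<delta>a \<delta>c \<delta>b \<delta>d x"
        by (rule rearrange)
      finally show ?case .
    qed
  qed
  moreover have "(LINT x|M. b x \<bullet> a x - d x \<bullet> c x + ?R a c b d x)
      = (LINT x|M. b x \<bullet> a x) - (LINT x|M. d x \<bullet> c x) + robin_norm L M a c b d"
    unfolding robin_norm_integral[OF new(1,3,2,4)]
    by (subst Bochner_Integration.integral_add, intro Bochner_Integration.integrable_diff i, rule i,
        subst Bochner_Integration.integral_diff, rule i, rule i, rule refl)
  moreover have "(LINT x|M. (1 + e) * ?R a' c' b' d' x + (1 + 1 / e) * ?R \<delta>a \<delta>c \<delta>b \<delta>d x)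
      = (1 + e) * robin_norm L M a' c' b' d' + (1 + 1 / e) * robin_norm L M \<delta>a \<delta>c \<delta>b \<delta>d"
    unfolding robin_norm_integral[OF old(1,3,2,4)] robin_norm_integral[OF \<delta>(1,3,2,4)]
    by (subst Bochner_Integration.integral_add, (intro integrable_mult_right i)+, simp only: integral_mult_right_zero)
  ultimately show ?thesis by linarith
qed

text \<open>The bound is taken over the whole window from \<open>c\<close> to \<open>d\<close>
  rather than from \<open>r\<close> to \<open>t\<close>, so that it does not vary with
  \<open>t\<close> inside a time step.\<close>

lemma
  assumes M: "finite_measure M" and v: "has_tderiv M a b v dv" and *: "a \<le> c" "c \<le> r" "r \<le> t" "t \<le> d" "d \<le> b"
    and h: "t - r \<le> h"
  shows has_tderiv_increment_L2: "L2 M (\<lambda>x. v t x - v r x)"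
    and has_tderiv_increment_norm: "(L2norm M (\<lambda>x. v t x - v r x))\<^sup>2 \<le> h * (LINT s|itv c d. (L2norm M (dv s))\<^sup>2)"
proof -
  show L: "L2 M (\<lambda>x. v t x - v r x)"
    by (intro L2_diff has_tderiv_L2[OF M v]) (use * in auto)
  have dv: "L2L2 M a b dv" using v by (simp add: has_tderiv_def)
  have dv': "L2L2 M c d dv" by (rule L2L2_sub[OF M dv]) (use * in auto)
  have "(LINT x|M. (norm (v t x - v r x))\<^sup>2) \<le> (LINT x|M. h * (LINT s|itv c d. (norm (dv s x))\<^sup>2))"
  proof (rule integral_mono_AE)
    show "integrable M (\<lambda>x. (norm (v t x - v r x))\<^sup>2)" using L by (simp add: L2_def)
    show "integrable M (\<lambda>x. h * (LINT s|itv c d. (norm (dv s x))\<^sup>2))"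
      using L2L2_inner_space_integrable[OF M dv' dv'] by (simp add: power2_norm_eq_inner)
    show "AE x in M. (norm (v t x - v r x))\<^sup>2 \<le> h * (LINT s|itv c d. (norm (dv s x))\<^sup>2)"
      using has_tderiv_increment_le[OF M v] L2L2_AE_time[OF M dv']
    proof eventually_elim
      case (elim x)
      have "(norm (v t x - v r x))\<^sup>2 \<le> (t - r) * (LINT s|itv r t. (norm (dv s x))\<^sup>2)"
        using elim(1)[rule_format, of r t] * by linarith
      also have "\<dots> \<le> h * (LINT s|itv c d. (norm (dv s x))\<^sup>2)"
      proof (intro mult_mono itv_integral_mono_set)
        show "integrable (itv c d) (\<lambda>s. (norm (dv s x))\<^sup>2)" using elim(2) by (simp add: L2_def)
        show "0 \<le> (LINT s|itv r t. (norm (dv s x))\<^sup>2)" by simp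
      qed (use * h in auto)
      finally show ?case .
    qed
  qed
  also have "\<dots> = h * (LINT x|M. LINT s|itv c d. dv s x \<bullet> dv s x)" by (simp add: power2_norm_eq_inner)
  also have "\<dots> = h * (LINT s|itv c d. (L2norm M (dv s))\<^sup>2)"
    by (simp only: L2L2_inner_Fubini[OF M dv' dv'] L2norm_sq power2_norm_eq_inner)
  finally show "(L2norm M (\<lambda>x. v t x - v r x))\<^sup>2 \<le> h * (LINT s|itv c d. (L2norm M (dv s))\<^sup>2)"
    by (simp only: L2norm_sq)
qed

text \<open>The windows of two steps cover almost every point at most twice.\<close>

lemma sum_overlapping_integrals:
  fixes f :: "real \<Rightarrow> real"
  assumes f: "integrable (itv 0 (real N * h)) f" "\<And>t. 0 \<le> f t" and h: "h \<ge> 0"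
  shows "(\<Sum>n<N. LINT t|itv (real (n - 1) * h) (real (Suc n) * h). f t) \<le> 2 * (LINT t|itv 0 (real N * h). f t)"
proof -
  define I where "I = (\<lambda>k. LINT t|itv 0 (real k * h). f t)"
  have le: "real i * h \<le> real j * h" if "i \<le> j" for i j using that h by (intro mult_right_mono) auto
  have I0: "0 \<le> I k" for k unfolding I_def by (rule integral_nonneg_AE) (use f in simp)
  have eq: "(LINT t|itv (real (n - 1) * h) (real (Suc n) * h). f t) = I (Suc n) - I (n - 1)" if "n < N" for n
  proof -
    have "integrable (itv 0 (real (Suc n) * h)) f"
      by (rule itv_integrable_sub[OF f(1)]) (use le[of "Suc n" N] that in auto)
    from itv_integral_split[OF this, of "real (n - 1) * h"] show ?thesis
      using le[of "n - 1" "Suc n"] h by (simp add: I_def)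
  qed
  \<comment> \<open>Telescoping with gap two leaves two terms at each end. At the lower end both are
    \<open>I 0\<close>, since natural subtraction gives \<open>0 - 1 = 0\<close>.\<close>
  have tel: "(\<Sum>n<m. I (Suc n) - I (n - 1)) = I m + I (m - 1) - 2 * I 0" for m
    by (induction m) auto
  have mono: "I (N - 1) \<le> I N"
    unfolding I_def by (rule itv_integral_mono_set[OF f(1)]) (use le[of "N - 1" N] f in auto)
  have "(\<Sum>n<N. LINT t|itv (real (n - 1) * h) (real (Suc n) * h). f t) = (\<Sum>n<N. I (Suc n) - I (n - 1))"
    by (intro sum.cong refl) (use eq in auto)
  also have "\<dots> \<le> 2 * I N" using tel[of N] I0[of 0] mono by linarith
  finally show ?thesis by (simp add: I_def)
qed

text \<open>A growth factor \<open>1 + 1/N\<close> over exactly \<open>N\<close> steps accumulates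
  to at most \<open>exp 1\<close>, whatever \<open>N\<close> is; in particular no exponential in the
  final time arises.\<close>

lemma discrete_Gronwall:
  fixes F K :: "nat \<Rightarrow> real"
  assumes N: "N \<ge> 1" and F0: "F 0 = 0" and K: "\<And>n. 0 \<le> K n"
    and step: "\<And>n. n < N \<Longrightarrow> F (Suc n) \<le> (1 + 1 / real N) * F n + K n"
  shows "F N \<le> exp 1 * (\<Sum>n<N. K n)"
proof -
  have g: "F n \<le> (1 + 1 / real N) ^ n * (\<Sum>k<n. K k)" if "n \<le> N" for n
    using that
  proof (induction n)
    case (Suc n)
    define r where "r = 1 + 1 / real N"
    have r: "r \<ge> 1" by (simp add: r_def)
    have "F (Suc n) \<le> r * F n + K n" using step Suc by (simp add: r_def)
    also have "\<dots> \<le> r * (r ^ n * (\<Sum>k<n. K k)) + K n"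
      using Suc r by (intro add_mono mult_left_mono) (auto simp: r_def)
    \<comment> \<open>The new term is enlarged by \<open>r ^ Suc n >= 1\<close> so that all terms
      share one power.\<close>
    also have "\<dots> \<le> r * (r ^ n * (\<Sum>k<n. K k)) + r ^ Suc n * K n"
      using mult_right_mono[OF one_le_power[OF r, of "Suc n"] K[of n]] by simp
    finally show ?case unfolding r_def[symmetric] by (simp add: algebra_simps)
  qed (simp add: F0)
  have "(1 + 1 / real N) ^ N \<le> exp (1 / real N) ^ N" by (intro power_mono) auto
  also have "\<dots> = exp 1" using N by (simp add: exp_of_nat_mult[symmetric])
  finally have "(1 + 1 / real N) ^ N * (\<Sum>k<N. K k) \<le> exp 1 * (\<Sum>k<N. K k)"
    by (rule mult_right_mono) (intro sum_nonneg K)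
  with g[of N] show ?thesis by simp
qed

lemma itv_shift:
  fixes f :: "real \<Rightarrow> real"
  assumes "integrable (itv a b) f"
  shows "integrable (itv (a + h) (b + h)) (\<lambda>t. f (t - h))"
    and "(LINT t|itv (a + h) (b + h). f (t - h)) = (LINT t|itv a b. f t)"
proof -
  \<comment> \<open>The shape \<open>- h + 1 * t\<close> is that of the affine transformation rule
    for Lebesgue measure.\<close>
  have ind: "(\<lambda>t. indicator {a + h..b + h} t *\<^sub>R f (t - h)) = (\<lambda>t. indicator {a..b} (- h + 1 * t) *\<^sub>R f (- h + 1 * t))"
  proof
    fix t
    have "- h + 1 * t = t - h" "(t \<in> {a + h..b + h}) = (t - h \<in> {a..b})" by auto
    then show "indicator {a + h..b + h} t *\<^sub>R f (t - h) = indicator {a..b} (- h + 1 * t) *\<^sub>R f (- h + 1 * t)"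
      by (simp only: indicator_def)
  qed
  have i: "integrable lborel (\<lambda>t. indicator {a..b} t *\<^sub>R f t)" using assms by (simp add: integrable_restrict_space)
  show "integrable (itv (a + h) (b + h)) (\<lambda>t. f (t - h))"
  proof -
    have "integrable lborel (\<lambda>t. indicator {a + h..b + h} t *\<^sub>R f (t - h))"
      unfolding ind by (rule lborel_integrable_real_affine[OF i]) simp
    then show ?thesis by (simp add: integrable_restrict_space)
  qed
  have "(LINT t|lborel. indicator {a + h..b + h} t *\<^sub>R f (t - h)) = (LINT t|lborel. indicator {a..b} t *\<^sub>R f t)"
    unfolding ind using lborel_integral_real_affine[of 1 "\<lambda>t. indicator {a..b} t *\<^sub>R f t" "- h"]
    by (simp only: abs_one scaleR_one one_neq_zero not_False_eq_True simp_thms)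
  then show "(LINT t|itv (a + h) (b + h). f (t - h)) = (LINT t|itv a b. f t)"
    by (simp add: integral_restrict_space)
qed

lemma AE_itv_shift:
  assumes "AE t in itv a b. P t"
  shows "AE t in itv (a + h) (b + h). P (t - h)"
proof -
  \<comment> \<open>\<open>P\<close> need not be a measurable predicate, so the translation is
    applied to a measurable null set covering its exceptions.\<close>
  from assms[unfolded AE_itv] obtain N where N:
    "{t \<in> space lborel. \<not> (a \<le> t \<and> t \<le> b \<longrightarrow> P t)} \<subseteq> N" "emeasure lborel N = 0" "N \<in> sets lborel"
    by (rule AE_E)
  then have "AE t in lborel. t \<notin> N" by (intro AE_not_in null_setsI)
  moreover have "Measurable.pred borel (\<lambda>t. t \<notin> N)" using N(3) by simp
  ultimately have "AE t in lborel. - h + 1 * t \<notin> N"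
    using AE_borel_affine[of 1 "\<lambda>t. t \<notin> N" "- h"] by linarith
  then show ?thesis
    unfolding AE_itv
  proof (rule eventually_mono)
    fix t assume t: "- h + 1 * t \<notin> N"
    have "- h + 1 * t = t - h" by simp
    with t have "t - h \<notin> N" by simp
    then have "a \<le> t - h \<and> t - h \<le> b \<longrightarrow> P (t - h)" using N(1) by auto
    then show "a + h \<le> t \<and> t \<le> b + h \<longrightarrow> P (t - h)" by (simp add: le_diff_eq diff_le_eq)
  qed
qed

section \<open>The error recursion\<close>

locale fsi_splitting =
  fixes X :: "'d::finite fsi_data" and L \<Delta>t T :: real and N :: nat
    and U :: "'d vfield" and P :: "'d sfield" and \<sigma>F :: "'d tfield"
    and \<Psi> :: "'d vfield" and \<Xi> :: "'d vfield" and \<sigma>S :: "'d tfield"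
    and u :: "nat \<Rightarrow> 'd vfield" and p :: "nat \<Rightarrow> 'd sfield" and \<sigma>f :: "nat \<Rightarrow> 'd tfield"
    and \<eta> :: "nat \<Rightarrow> 'd vfield" and \<xi> :: "nat \<Rightarrow> 'd vfield" and \<sigma>s :: "nat \<Rightarrow> 'd tfield"
  assumes X: "fsi_setting X" and L: "L > 0" and dt: "\<Delta>t > 0" and N: "N \<ge> 1" and T: "T = real N * \<Delta>t"
    and sol: "FSI_solution X T U P \<sigma>F \<Psi> \<Xi> \<sigma>S"
    and init: "u 0 0 = U 0" "\<sigma>f 0 0 = \<sigma>F 0" "\<eta> 0 0 = \<Psi> 0" "\<xi> 0 0 = \<Xi> 0" "\<sigma>s 0 0 = \<sigma>S 0"
    and split: "splitting_solution X L \<Delta>t N u p \<sigma>f \<eta> \<xi> \<sigma>s"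
begin

text \<open>The structure stress is tested with \<open>- n\<^sub>s\<close> instead of
  \<open>n\<^sub>f\<close>: only \<open>\<sigma>s n *v n\<^sub>s\<close> is known to be measurable.\<close>

definition e_u :: "nat \<Rightarrow> 'd vfield" where
  "e_u n t x = (if n = 0 then 0 else U t x - u n t x)"

definition e_\<xi> :: "nat \<Rightarrow> 'd vfield" where
  "e_\<xi> n t x = (if n = 0 then 0 else \<Xi> t x - \<xi> n t x)"

definition e_f :: "nat \<Rightarrow> 'd vfield" where
  "e_f n t x = (if n = 0 then 0 else \<sigma>F t x *v n\<^sub>f X x - \<sigma>f n t x *v n\<^sub>f X x)"

definition e_s :: "nat \<Rightarrow> 'd vfield" where
  "e_s n t x = (if n = 0 then 0 else \<sigma>S t x *v n\<^sub>f X x + \<sigma>s n t x *v n\<^sub>s X x)"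

definition s_norm :: "nat \<Rightarrow> real \<Rightarrow> real" where
  "s_norm n t = robin_norm L (on_\<Gamma> X) (e_u n t) (e_\<xi> n t) (e_f n t) (e_s n t)"

text \<open>The form of S on which the recursion runs; it differs from \<open>err_S\<close> only in
  the normal used for the structure stress, a gap closed by \<open>err_S_le\<close>.\<close>

definition S_norm :: "nat \<Rightarrow> real" where
  "S_norm n = (if n = 0 then 0 else LINT t|itv (real (n - 1) * \<Delta>t) (real n * \<Delta>t). s_norm n t)"

definition dU :: "'d vfield" where "dU = tderiv (on_\<Gamma> X) 0 T U"
definition d\<Xi> :: "'d vfield" where "d\<Xi> = tderiv (on_\<Gamma> X) 0 T \<Xi>"
definition dF :: "'d vfield" where "dF = tderiv (on_\<Gamma> X) 0 T (\<lambda>t x. \<sigma>F t x *v n\<^sub>f X x)"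
definition dS :: "'d vfield" where "dS = tderiv (on_\<Gamma> X) 0 T (\<lambda>t x. \<sigma>S t x *v n\<^sub>f X x)"

definition data_norm :: "real \<Rightarrow> real" where
  "data_norm t = L * (L2norm (on_\<Gamma> X) (dU t))\<^sup>2 + L * (L2norm (on_\<Gamma> X) (d\<Xi> t))\<^sup>2
     + 1 / L * (L2norm (on_\<Gamma> X) (dF t))\<^sup>2 + 1 / L * (L2norm (on_\<Gamma> X) (dS t))\<^sup>2"

section \<open>Integrability of the interface traces and errors\<close>

lemma fin: "finite_measure (on_\<Gamma> X)"
  by (rule finite_on_\<Gamma>[OF X])

lemma time_mono: "m \<le> n \<Longrightarrow> real m * \<Delta>t \<le> real n * \<Delta>t"
  using dt by (intro mult_right_mono) auto

lemma time_le_T: "n \<le> N \<Longrightarrow> real n * \<Delta>t \<le> T"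
  using time_mono[of n N] by (simp add: T)

lemma time_nonneg: "0 \<le> real n * \<Delta>t"
  using dt by simp

lemma time_Suc: "real (Suc n) * \<Delta>t = real n * \<Delta>t + \<Delta>t"
  by (simp add: algebra_simps)

lemma exact_tderiv:
  "has_tderiv (on_\<Gamma> X) 0 T U dU" "has_tderiv (on_\<Gamma> X) 0 T \<Xi> d\<Xi>"
  "has_tderiv (on_\<Gamma> X) 0 T (\<lambda>t x. \<sigma>F t x *v n\<^sub>f X x) dF" "has_tderiv (on_\<Gamma> X) 0 T (\<lambda>t x. \<sigma>S t x *v n\<^sub>f X x) dS"
  unfolding dU_def d\<Xi>_def dF_def dS_def
  using sol by (auto intro!: H1t_tderiv simp: FSI_solution_def)

lemma exact_L2L2:
  assumes "0 \<le> a" "b \<le> T"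
  shows "L2L2 (on_\<Gamma> X) a b U" "L2L2 (on_\<Gamma> X) a b \<Xi>"
    "L2L2 (on_\<Gamma> X) a b (\<lambda>t x. \<sigma>F t x *v n\<^sub>f X x)" "L2L2 (on_\<Gamma> X) a b (\<lambda>t x. \<sigma>S t x *v n\<^sub>f X x)"
  using exact_tderiv by (auto intro!: L2L2_sub[OF fin _ assms] simp: has_tderiv_def)

lemma fluid_stepD:
  assumes "n < N"
  defines "a \<equiv> real n * \<Delta>t" and "b \<equiv> real (Suc n) * \<Delta>t"
  shows "fluid_eqs X a b (u (Suc n)) (p (Suc n)) (\<sigma>f (Suc n))"
    "AE x in vol (\<Omega>\<^sub>f X). u (Suc n) a x = u n a x"
    "L2L2 (on_\<Gamma> X) a b (u (Suc n))" "L2L2 (on_\<Gamma> X) a b (\<lambda>t x. \<sigma>f (Suc n) t x *v n\<^sub>f X x)"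
    "AE t in itv a b. AE x in on_\<Gamma> X.
           L *\<^sub>R u (Suc n) t x + \<sigma>f (Suc n) t x *v n\<^sub>f X x = robin_data L \<Delta>t u \<sigma>f \<xi> \<sigma>s n (n\<^sub>f X) t x"
  using split assms(1) unfolding splitting_solution_def fluid_step_def a_def b_def Let_def by blast+

lemma structure_stepD:
  assumes "n < N"
  defines "a \<equiv> real n * \<Delta>t" and "b \<equiv> real (Suc n) * \<Delta>t"
  shows "structure_eqs X a b (\<eta> (Suc n)) (\<xi> (Suc n)) (\<sigma>s (Suc n))"
    "AE x in vol (\<Omega>\<^sub>s X). \<xi> (Suc n) a x = \<xi> n a x \<and> \<eta> (Suc n) a x = \<eta> n a x"
    "L2L2 (on_\<Gamma> X) a b (\<xi> (Suc n))" "L2L2 (on_\<Gamma> X) a b (\<lambda>t x. \<sigma>s (Suc n) t x *v n\<^sub>s X x)"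
    "AE t in itv a b. AE x in on_\<Gamma> X.
           L *\<^sub>R \<xi> (Suc n) t x + \<sigma>s (Suc n) t x *v n\<^sub>s X x = robin_data L \<Delta>t u \<sigma>f \<xi> \<sigma>s n (n\<^sub>s X) t x"
  using split assms(1) unfolding splitting_solution_def structure_step_def a_def b_def Let_def by blast+

lemma error_L2L2:
  assumes "n < N"
  defines "a \<equiv> real n * \<Delta>t" and "b \<equiv> real (Suc n) * \<Delta>t"
  shows "L2L2 (on_\<Gamma> X) a b (e_u (Suc n))" "L2L2 (on_\<Gamma> X) a b (e_\<xi> (Suc n))"
    "L2L2 (on_\<Gamma> X) a b (e_f (Suc n))" "L2L2 (on_\<Gamma> X) a b (e_s (Suc n))"
proof -
  have "0 \<le> a" "b \<le> T" using assms(1) time_nonneg[of n] time_le_T[of "Suc n"] by (auto simp: a_def b_def)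
  note ex = exact_L2L2[OF this]
  note f = fluid_stepD(3,4)[OF assms(1), folded a_def b_def] and s = structure_stepD(3,4)[OF assms(1), folded a_def b_def]
  show "L2L2 (on_\<Gamma> X) a b (e_u (Suc n))" using L2L2_diff[OF ex(1) f(1)] by (simp add: e_u_def[abs_def])
  show "L2L2 (on_\<Gamma> X) a b (e_\<xi> (Suc n))" using L2L2_diff[OF ex(2) s(1)] by (simp add: e_\<xi>_def[abs_def])
  show "L2L2 (on_\<Gamma> X) a b (e_f (Suc n))" using L2L2_diff[OF ex(3) f(2)] by (simp add: e_f_def[abs_def])
  show "L2L2 (on_\<Gamma> X) a b (e_s (Suc n))" using L2L2_add[OF ex(4) s(2)] by (simp add: e_s_def[abs_def])
qed

lemma s_norm_integrable:
  assumes "n < N"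
  shows "integrable (itv (real n * \<Delta>t) (real (Suc n) * \<Delta>t)) (s_norm (Suc n))"
  unfolding s_norm_def[abs_def] robin_norm_def
  by (intro Bochner_Integration.integrable_add integrable_mult_right L2L2_norm_integrable[OF fin] error_L2L2[OF assms])

lemma s_norm_0: "s_norm 0 t = 0"
  by (simp add: s_norm_def robin_norm_def e_u_def[abs_def] e_\<xi>_def[abs_def] e_f_def[abs_def] e_s_def[abs_def] L2norm_def)

text \<open>The time at which \<open>shift\<close> evaluates the data of superscript
  \<open>n\<close>. For \<open>n = 0\<close> it is frozen at the initial time, and the errors with
  superscript 0 vanish identically.\<close>

definition prev :: "nat \<Rightarrow> real \<Rightarrow> real" where
  "prev n t = (if n = 0 then 0 else t - \<Delta>t)"

lemma prev_bounds:
  assumes "real n * \<Delta>t \<le> t" "t \<le> real (Suc n) * \<Delta>t"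
  shows "real (n - 1) * \<Delta>t \<le> prev n t" "prev n t \<le> t" "t - prev n t \<le> \<Delta>t"
  using assms dt by (cases n; auto simp: prev_def algebra_simps)+

text \<open>Almost every time of the previous interval is good, and translation by one step
  preserves this.\<close>

lemma prev_error_L2:
  assumes "n < N"
  shows "AE t in itv (real n * \<Delta>t) (real (Suc n) * \<Delta>t). L2 (on_\<Gamma> X) (e_u n (prev n t)) \<and> L2 (on_\<Gamma> X) (e_f n (prev n t))
      \<and> L2 (on_\<Gamma> X) (e_\<xi> n (prev n t)) \<and> L2 (on_\<Gamma> X) (e_s n (prev n t))"
proof (cases n)
  case 0
  then show ?thesis
    by (simp add: e_u_def[abs_def] e_\<xi>_def[abs_def] e_f_def[abs_def] e_s_def[abs_def] L2_zero)
next
  case (Suc m)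
  then have m: "m < N" using assms by simp
  have "AE t in itv (real m * \<Delta>t) (real n * \<Delta>t). L2 (on_\<Gamma> X) (e_u n t) \<and> L2 (on_\<Gamma> X) (e_f n t)
      \<and> L2 (on_\<Gamma> X) (e_\<xi> n t) \<and> L2 (on_\<Gamma> X) (e_s n t)"
    using L2L2_AE_space[OF fin error_L2L2(1)[OF m]] L2L2_AE_space[OF fin error_L2L2(2)[OF m]]
      L2L2_AE_space[OF fin error_L2L2(3)[OF m]] L2L2_AE_space[OF fin error_L2L2(4)[OF m]] unfolding Suc
    by eventually_elim blast
  from AE_itv_shift[OF this, of \<Delta>t] show ?thesis
    unfolding prev_def time_Suc Suc by simp
qed

section \<open>Consistency error and the inequality on one step\<close>

lemma data_norm_integrable: "integrable (itv 0 T) data_norm"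
proof -
  have "L2L2 (on_\<Gamma> X) 0 T dU" "L2L2 (on_\<Gamma> X) 0 T d\<Xi>" "L2L2 (on_\<Gamma> X) 0 T dF" "L2L2 (on_\<Gamma> X) 0 T dS"
    using exact_tderiv by (auto simp: has_tderiv_def)
  then show ?thesis
    unfolding data_norm_def[abs_def]
    by (intro Bochner_Integration.integrable_add integrable_mult_right L2L2_norm_integrable[OF fin])
qed

lemma data_norm_nonneg: "0 \<le> data_norm t"
  using L by (simp add: data_norm_def)

text \<open>The window covers the current and the previous step, because \<open>prev n t\<close> may
  lie in the latter. For \<open>n = 0\<close> natural subtraction shortens it to the first
  step.\<close>

definition \<kappa> :: "nat \<Rightarrow> real" where
  "\<kappa> n = (LINT t|itv (real (n - 1) * \<Delta>t) (real (Suc n) * \<Delta>t). data_norm t)"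

lemma \<kappa>_nonneg: "0 \<le> \<kappa> n"
  unfolding \<kappa>_def by (rule integral_nonneg_AE) (simp add: data_norm_nonneg)

text \<open>Both times lie in the window of \<open>\<kappa> n\<close>, at most one step apart. The
  factor 1/2 stems from the weights of \<open>robin_norm\<close>, which are half of those in
  \<open>data_norm\<close>.\<close>

lemma increments:
  assumes n: "n < N" and t: "real n * \<Delta>t \<le> t" "t \<le> real (Suc n) * \<Delta>t"
  shows "L2 (on_\<Gamma> X) (\<lambda>x. U t x - U (prev n t) x)" "L2 (on_\<Gamma> X) (\<lambda>x. \<Xi> t x - \<Xi> (prev n t) x)"
    "L2 (on_\<Gamma> X) (\<lambda>x. \<sigma>F t x *v n\<^sub>f X x - \<sigma>F (prev n t) x *v n\<^sub>f X x)"
    "L2 (on_\<Gamma> X) (\<lambda>x. \<sigma>S t x *v n\<^sub>f X x - \<sigma>S (prev n t) x *v n\<^sub>f X x)"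
    "robin_norm L (on_\<Gamma> X) (\<lambda>x. U t x - U (prev n t) x) (\<lambda>x. \<Xi> t x - \<Xi> (prev n t) x)
       (\<lambda>x. \<sigma>F t x *v n\<^sub>f X x - \<sigma>F (prev n t) x *v n\<^sub>f X x) (\<lambda>x. \<sigma>S t x *v n\<^sub>f X x - \<sigma>S (prev n t) x *v n\<^sub>f X x)
     \<le> \<Delta>t / 2 * \<kappa> n" (is "?R \<le> _")
proof -
  let ?lo = "real (n - 1) * \<Delta>t" and ?hi = "real (Suc n) * \<Delta>t"
  have hi: "?hi \<le> T" using n by (intro time_le_T) simp
  note inc = has_tderiv_increment_L2[OF fin _ time_nonneg prev_bounds(1,2)[OF t] t(2) hi prev_bounds(3)[OF t]]
  note nrm = has_tderiv_increment_norm[OF fin _ time_nonneg prev_bounds(1,2)[OF t] t(2) hi prev_bounds(3)[OF t]]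
  show "L2 (on_\<Gamma> X) (\<lambda>x. U t x - U (prev n t) x)" "L2 (on_\<Gamma> X) (\<lambda>x. \<Xi> t x - \<Xi> (prev n t) x)"
    "L2 (on_\<Gamma> X) (\<lambda>x. \<sigma>F t x *v n\<^sub>f X x - \<sigma>F (prev n t) x *v n\<^sub>f X x)"
    "L2 (on_\<Gamma> X) (\<lambda>x. \<sigma>S t x *v n\<^sub>f X x - \<sigma>S (prev n t) x *v n\<^sub>f X x)"
    using inc[OF exact_tderiv(1)] inc[OF exact_tderiv(2)] inc[OF exact_tderiv(3)] inc[OF exact_tderiv(4)] by blast+
  define A B C D where "A = (LINT s|itv ?lo ?hi. (L2norm (on_\<Gamma> X) (dU s))\<^sup>2)"
    and "B = (LINT s|itv ?lo ?hi. (L2norm (on_\<Gamma> X) (d\<Xi> s))\<^sup>2)"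
    and "C = (LINT s|itv ?lo ?hi. (L2norm (on_\<Gamma> X) (dF s))\<^sup>2)"
    and "D = (LINT s|itv ?lo ?hi. (L2norm (on_\<Gamma> X) (dS s))\<^sup>2)"
  have L2L2: "L2L2 (on_\<Gamma> X) 0 T dU" "L2L2 (on_\<Gamma> X) 0 T d\<Xi>" "L2L2 (on_\<Gamma> X) 0 T dF" "L2L2 (on_\<Gamma> X) 0 T dS"
    using exact_tderiv by (auto simp: has_tderiv_def)
  have i: "integrable (itv ?lo ?hi) (\<lambda>s. (L2norm (on_\<Gamma> X) (w s))\<^sup>2)" if "L2L2 (on_\<Gamma> X) 0 T w" for w :: "'d vfield"
    by (rule L2L2_norm_integrable[OF fin L2L2_sub[OF fin that time_nonneg hi]])
  have \<kappa>: "\<kappa> n = L * A + L * B + 1 / L * C + 1 / L * D"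
    unfolding \<kappa>_def data_norm_def A_def B_def C_def D_def
    using i[OF L2L2(1)] i[OF L2L2(2)] i[OF L2L2(3)] i[OF L2L2(4)] by (simp add: Bochner_Integration.integral_add)
  have "?R \<le> L / 2 * (\<Delta>t * A + \<Delta>t * B) + 1 / (2 * L) * (\<Delta>t * C + \<Delta>t * D)"
    unfolding robin_norm_def A_def B_def C_def D_def
    using L by (intro add_mono mult_left_mono nrm exact_tderiv) auto
  also have "\<dots> = \<Delta>t / 2 * \<kappa> n"
    unfolding \<kappa> using L by (simp add: field_simps)
  finally show "?R \<le> \<Delta>t / 2 * \<kappa> n" .
qed

lemma matrix_vector_neg: "A *v (- x) = - (A *v (x :: real ^ 'n))" for A :: "real ^ 'n ^ 'm"
  by (simp add: vec_eq_iff matrix_vector_mult_def sum_negf)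

text \<open>Here \<open>y\<close> and \<open>z\<close> are the common exact velocity and normal
  stress at the current time, primed letters the exact values at the previous time, and
  \<open>a\<close> to \<open>d\<close> the old errors. Halving \<open>y\<close> matches it with the
  two averaged velocities, and likewise for \<open>z\<close>; the reversed normal flips the sign of
  the stresses.\<close>

lemma robin_data_split:
  fixes y z :: "real ^ 'n"
  shows "L *\<^sub>R y + z - ((L / 2) *\<^sub>R (y' - a) + (L / 2) *\<^sub>R (y'' - c) + (1 / 2) *\<^sub>R (z' - b) + (1 / 2) *\<^sub>R (z'' - d))
      = (L / 2) *\<^sub>R (a + (y - y') + (c + (y - y''))) + (1 / 2) *\<^sub>R (b + (z - z') + (d + (z - z'')))"
    and "L *\<^sub>R y - z - ((L / 2) *\<^sub>R (y' - a) + (L / 2) *\<^sub>R (y'' - c) + (1 / 2) *\<^sub>R (b - z') + (1 / 2) *\<^sub>R (d - z''))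
      = (L / 2) *\<^sub>R (a + (y - y') + (c + (y - y''))) - (1 / 2) *\<^sub>R (b + (z - z') + (d + (z - z'')))"
  by (simp_all add: vec_eq_iff field_simps)

text \<open>Data of superscript \<open>n\<close> are exact values minus errors; for
  \<open>n = 0\<close> this is the assumption on the initial data.\<close>

lemma shift_prev:
  "shift \<Delta>t u n t x = U (prev n t) x - e_u n (prev n t) x"
  "shift \<Delta>t \<xi> n t x = \<Xi> (prev n t) x - e_\<xi> n (prev n t) x"
  "shift \<Delta>t \<sigma>f n t x *v n\<^sub>f X x = \<sigma>F (prev n t) x *v n\<^sub>f X x - e_f n (prev n t) x"
  "n\<^sub>f X x = - n\<^sub>s X x \<Longrightarrow> shift \<Delta>t \<sigma>s n t x *v n\<^sub>s X x = e_s n (prev n t) x - \<sigma>S (prev n t) x *v n\<^sub>f X x"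
  by (auto simp: shift_def prev_def e_u_def e_\<xi>_def e_f_def e_s_def init matrix_vector_neg)

text \<open>\<open>robin_step\<close> with weight \<open>1/N\<close>, where the increments of the
  exact traces act as the consistency terms.\<close>

lemma step_inequality:
  assumes n: "n < N"
  shows "AE t in itv (real n * \<Delta>t) (real (Suc n) * \<Delta>t).
    (LINT x|on_\<Gamma> X. e_f (Suc n) t x \<bullet> e_u (Suc n) t x) - (LINT x|on_\<Gamma> X. e_s (Suc n) t x \<bullet> e_\<xi> (Suc n) t x) + s_norm (Suc n) t
     \<le> (1 + 1 / real N) * s_norm n (prev n t) + (1 + real N) * (\<Delta>t / 2 * \<kappa> n)"
proof -
  let ?a = "real n * \<Delta>t" and ?b = "real (Suc n) * \<Delta>t"
  have hi: "?b \<le> T" using n by (intro time_le_T) simp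
  have "AE t in itv 0 T. AE x in on_\<Gamma> X. U t x = \<Xi> t x \<and> \<sigma>F t x *v n\<^sub>f X x = \<sigma>S t x *v n\<^sub>f X x"
    using sol by (simp add: FSI_solution_def)
  from AE_itv_sub[OF this time_nonneg hi]
  have cpl: "AE t in itv ?a ?b. AE x in on_\<Gamma> X. U t x = \<Xi> t x \<and> \<sigma>F t x *v n\<^sub>f X x = \<sigma>S t x *v n\<^sub>f X x" .
  show ?thesis
    using cpl fluid_stepD(5)[OF n] structure_stepD(5)[OF n] prev_error_L2[OF n]
      L2L2_AE_space[OF fin error_L2L2(1)[OF n]] L2L2_AE_space[OF fin error_L2L2(2)[OF n]]
      L2L2_AE_space[OF fin error_L2L2(3)[OF n]] L2L2_AE_space[OF fin error_L2L2(4)[OF n]] AE_itv_in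
  proof eventually_elim
    case (elim t)
    note t = elim(9)[THEN conjunct1] elim(9)[THEN conjunct2]
    note inc = increments[OF n t]
    have "(LINT x|on_\<Gamma> X. e_f (Suc n) t x \<bullet> e_u (Suc n) t x) - (LINT x|on_\<Gamma> X. e_s (Suc n) t x \<bullet> e_\<xi> (Suc n) t x)
        + robin_norm L (on_\<Gamma> X) (e_u (Suc n) t) (e_\<xi> (Suc n) t) (e_f (Suc n) t) (e_s (Suc n) t)
      \<le> (1 + 1 / real N) * robin_norm L (on_\<Gamma> X) (e_u n (prev n t)) (e_\<xi> n (prev n t)) (e_f n (prev n t)) (e_s n (prev n t))
       + (1 + 1 / (1 / real N)) * robin_norm L (on_\<Gamma> X) (\<lambda>x. U t x - U (prev n t) x) (\<lambda>x. \<Xi> t x - \<Xi> (prev n t) x)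
       (\<lambda>x. \<sigma>F t x *v n\<^sub>f X x - \<sigma>F (prev n t) x *v n\<^sub>f X x) (\<lambda>x. \<sigma>S t x *v n\<^sub>f X x - \<sigma>S (prev n t) x *v n\<^sub>f X x)"
    proof (rule robin_step[OF L])
      show "1 / real N > 0" using N by simp
      show "L2 (on_\<Gamma> X) (e_u n (prev n t))" "L2 (on_\<Gamma> X) (e_f n (prev n t))"
        "L2 (on_\<Gamma> X) (e_\<xi> n (prev n t))" "L2 (on_\<Gamma> X) (e_s n (prev n t))" using elim(4) by blast+
      show "AE x in on_\<Gamma> X.
         L *\<^sub>R e_u (Suc n) t x + e_f (Suc n) t x =
         (L / 2) *\<^sub>R (e_u n (prev n t) x + (U t x - U (prev n t) x) + (e_\<xi> n (prev n t) x + (\<Xi> t x - \<Xi> (prev n t) x))) +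
         (1 / 2) *\<^sub>R (e_f n (prev n t) x + (\<sigma>F t x *v n\<^sub>f X x - \<sigma>F (prev n t) x *v n\<^sub>f X x)
           + (e_s n (prev n t) x + (\<sigma>S t x *v n\<^sub>f X x - \<sigma>S (prev n t) x *v n\<^sub>f X x))) \<and>
         L *\<^sub>R e_\<xi> (Suc n) t x - e_s (Suc n) t x =
         (L / 2) *\<^sub>R (e_u n (prev n t) x + (U t x - U (prev n t) x) + (e_\<xi> n (prev n t) x + (\<Xi> t x - \<Xi> (prev n t) x))) -
         (1 / 2) *\<^sub>R (e_f n (prev n t) x + (\<sigma>F t x *v n\<^sub>f X x - \<sigma>F (prev n t) x *v n\<^sub>f X x)
           + (e_s n (prev n t) x + (\<sigma>S t x *v n\<^sub>f X x - \<sigma>S (prev n t) x *v n\<^sub>f X x)))"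
        using elim(1) elim(2) elim(3) fsi_settingD(10)[OF X]
      proof eventually_elim
        case (elim x)
        have ns: "n\<^sub>s X x = - n\<^sub>f X x" using elim(4) by simp
        \<comment> \<open>Each Robin condition contains both stresses with its own normal, whereas
          the errors pair the discrete fluid stress with \<open>n\<^sub>f\<close> and the discrete
          structure stress with \<open>n\<^sub>s\<close>; the mixed products are converted by a
          change of sign.\<close>
        have s_nf: "shift \<Delta>t \<sigma>s n t x *v n\<^sub>f X x = \<sigma>S (prev n t) x *v n\<^sub>f X x - e_s n (prev n t) x"
          using shift_prev(4)[OF elim(4), of n t] by (simp add: elim(4) matrix_vector_neg)
        have f_ns: "shift \<Delta>t \<sigma>f n t x *v n\<^sub>s X x = e_f n (prev n t) x - \<sigma>F (prev n t) x *v n\<^sub>f X x"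
          using shift_prev(3)[of n t x] by (simp add: ns matrix_vector_neg)
        have 1: "\<sigma>f (Suc n) t x *v n\<^sub>f X x = robin_data L \<Delta>t u \<sigma>f \<xi> \<sigma>s n (n\<^sub>f X) t x - L *\<^sub>R u (Suc n) t x"
          and 2: "\<sigma>s (Suc n) t x *v n\<^sub>s X x = robin_data L \<Delta>t u \<sigma>f \<xi> \<sigma>s n (n\<^sub>s X) t x - L *\<^sub>R \<xi> (Suc n) t x"
          using elim(2,3) by (simp_all add: algebra_simps)
        \<comment> \<open>The coupling conditions at the current time let one velocity and one
          normal stress represent both sides, which is why the exact solution satisfies both Robin
          conditions.\<close>
        have half: "\<Xi> t x = U t x" "\<sigma>S t x *v n\<^sub>f X x = \<sigma>F t x *v n\<^sub>f X x" using elim(1) by simp_all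
        define y z where "y = U t x" and "z = \<sigma>F t x *v n\<^sub>f X x"
        have "L *\<^sub>R e_u (Suc n) t x + e_f (Suc n) t x = L *\<^sub>R y + z - robin_data L \<Delta>t u \<sigma>f \<xi> \<sigma>s n (n\<^sub>f X) t x"
          by (simp add: e_u_def e_f_def 1 y_def z_def algebra_simps)
        moreover have "L *\<^sub>R e_\<xi> (Suc n) t x - e_s (Suc n) t x = L *\<^sub>R y - z - robin_data L \<Delta>t u \<sigma>f \<xi> \<sigma>s n (n\<^sub>s X) t x"
          by (simp add: e_\<xi>_def e_s_def 2 half y_def z_def algebra_simps)
        ultimately show ?case
          unfolding robin_data_def shift_prev(1-3) shift_prev(4)[OF elim(4)] s_nf f_ns half
            y_def[symmetric] z_def[symmetric] robin_data_split by blast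
      qed
    qed (fact elim inc)+
    also have "\<dots> \<le> (1 + 1 / real N) * s_norm n (prev n t) + (1 + real N) * (\<Delta>t / 2 * \<kappa> n)"
      unfolding s_norm_def using mult_left_mono[OF inc(5), of "1 + real N"] by simp
    finally show ?case unfolding s_norm_def .
  qed
qed


section \<open>Energy balance of the errors over one step\<close>

abbreviation E_err :: "nat \<Rightarrow> real" where "E_err \<equiv> err_E X \<Delta>t U \<Psi> \<Xi> u \<eta> \<xi>"
abbreviation T_err :: "nat \<Rightarrow> real" where "T_err \<equiv> err_T X \<Delta>t U u"

lemma strong_exact:
  "fluid_strong X 0 T U (tderiv (vol (\<Omega>\<^sub>f X)) 0 T U) P \<sigma>F"
  "structure_strong X 0 T \<Psi> \<Xi> (tderiv (vol (\<Omega>\<^sub>s X)) 0 T \<Xi>) \<sigma>S"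
  using sol by (auto intro!: fluid_eqs_strong structure_eqs_strong[OF X] simp: FSI_solution_def)

lemma sections:
  assumes "n \<le> N"
  defines "t \<equiv> real n * \<Delta>t"
  shows "U t \<in> borel_measurable (vol (\<Omega>\<^sub>f X))" "\<Xi> t \<in> borel_measurable (vol (\<Omega>\<^sub>s X))" "\<Psi> t \<in> borel_measurable (vol (\<Omega>\<^sub>s X))"
    "n > 0 \<Longrightarrow> u n t \<in> borel_measurable (vol (\<Omega>\<^sub>f X))" "n > 0 \<Longrightarrow> \<xi> n t \<in> borel_measurable (vol (\<Omega>\<^sub>s X))"
    "n > 0 \<Longrightarrow> \<eta> n t \<in> borel_measurable (vol (\<Omega>\<^sub>s X))"
proof -
  have t: "0 \<le> t" "t \<le> T" using assms time_nonneg time_le_T by auto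
  show "U t \<in> borel_measurable (vol (\<Omega>\<^sub>f X))" "\<Xi> t \<in> borel_measurable (vol (\<Omega>\<^sub>s X))" "\<Psi> t \<in> borel_measurable (vol (\<Omega>\<^sub>s X))"
    using strong_exact L2L2_section[OF _ t] by (auto simp: fluid_strong_def structure_strong_def has_tderiv_def)
  assume "n > 0"
  then obtain m where m: "n = Suc m" "m < N" using assms(1) by (cases n) auto
  have t': "real m * \<Delta>t \<le> t" "t \<le> real (Suc m) * \<Delta>t" using time_mono[of m n] by (auto simp: t_def m)
  show "u n t \<in> borel_measurable (vol (\<Omega>\<^sub>f X))"
    using fluid_eqs_strong[OF fluid_stepD(1)[OF m(2)]] L2L2_section[OF _ t'] unfolding m
    by (auto simp: fluid_strong_def has_tderiv_def)
  show "\<xi> n t \<in> borel_measurable (vol (\<Omega>\<^sub>s X))" "\<eta> n t \<in> borel_measurable (vol (\<Omega>\<^sub>s X))"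
    using structure_eqs_strong[OF X structure_stepD(1)[OF m(2)]] L2L2_section[OF _ t'] unfolding m
    by (auto simp: structure_strong_def has_tderiv_def)
qed

text \<open>Consecutive iterates agree at the grid point almost everywhere, and the energy contains
  weak gradients, so one replaces the other through congruence of the norms. For
  \<open>n = 0\<close> the initial data are exact and both sides vanish.\<close>

lemma E_err_start:
  assumes n: "n < N"
  defines "a \<equiv> real n * \<Delta>t" and "b \<equiv> real (Suc n) * \<Delta>t"
  shows "\<rho>\<^sub>f X / 2 * (L2norm (vol (\<Omega>\<^sub>f X)) (\<lambda>x. U a x - u (Suc n) a x))\<^sup>2
      + \<rho>\<^sub>s X / 2 * (L2norm (vol (\<Omega>\<^sub>s X)) (\<lambda>x. \<Xi> a x - \<xi> (Suc n) a x))\<^sup>2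
      + 1 / 2 * (energy_norm X (\<lambda>x. \<Psi> a x - \<eta> (Suc n) a x))\<^sup>2 = E_err n"
proof -
  note S = fsi_settingD[OF X]
  have ab: "a < b" using dt by (simp add: a_def b_def algebra_simps)
  then have le: "a \<le> b" by simp
  have b: "0 \<le> a" "b \<le> T" using n time_nonneg[of n] time_le_T[of "Suc n"] by (auto simp: a_def b_def)
  note fs = fluid_eqs_strong[OF fluid_stepD(1)[OF n], folded a_def b_def]
    and ss = structure_eqs_strong[OF X structure_stepD(1)[OF n], folded a_def b_def]
  have um: "u (Suc n) a \<in> borel_measurable (vol (\<Omega>\<^sub>f X))"
    using fs L2L2_section[OF _ order_refl le] by (auto simp: fluid_strong_def has_tderiv_def)
  have sm: "\<xi> (Suc n) a \<in> borel_measurable (vol (\<Omega>\<^sub>s X))" "\<eta> (Suc n) a \<in> borel_measurable (vol (\<Omega>\<^sub>s X))"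
    using ss L2L2_section[OF _ order_refl le] by (auto simp: structure_strong_def has_tderiv_def)
  note m = sections[of n, folded a_def]
  have n': "n \<le> N" using n by simp
  note fi = fluid_stepD(2)[OF n, folded a_def] and si = structure_stepD(2)[OF n, folded a_def]
  \<comment> \<open>\<open>energy_norm_cong\<close> asks for weak derivatives of the displacement
    error at the grid point itself.\<close>
  obtain H G where H: "\<And>i t. a \<le> t \<Longrightarrow> t \<le> b \<Longrightarrow> has_weak_pd (\<Omega>\<^sub>s X) i (\<lambda>x. \<Psi> t x - \<eta> (Suc n) t x) (H i t)"
    by (rule structure_error_weak_pd[OF X ab structure_strong_sub[OF X strong_exact(2) b(1) le b(2)] ss]) blast
  show ?thesis
  proof (cases "n = 0")
    case True
    then have a0: "a = 0" by (simp add: a_def)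
    have z: "AE x in vol (\<Omega>\<^sub>f X). U a x - u (Suc n) a x = 0" "AE x in vol (\<Omega>\<^sub>s X). \<Xi> a x - \<xi> (Suc n) a x = 0"
      "AE x in vol (\<Omega>\<^sub>s X). \<Psi> a x - \<eta> (Suc n) a x = 0"
      using fi si by (auto simp: a0 True init elim: eventually_mono)
    have "L2norm (vol (\<Omega>\<^sub>f X)) (\<lambda>x. U a x - u (Suc n) a x) = L2norm (vol (\<Omega>\<^sub>f X)) (\<lambda>x. 0 :: real ^ 'd)"
      by (rule L2norm_AE_cong[OF _ _ z(1)]) (use m(1)[OF n'] um in auto)
    moreover have "L2norm (vol (\<Omega>\<^sub>s X)) (\<lambda>x. \<Xi> a x - \<xi> (Suc n) a x) = L2norm (vol (\<Omega>\<^sub>s X)) (\<lambda>x. 0 :: real ^ 'd)"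
      by (rule L2norm_AE_cong[OF _ _ z(2)]) (use m(2)[OF n'] sm in auto)
    moreover have "(energy_norm X (\<lambda>x. \<Psi> a x - \<eta> (Suc n) a x))\<^sup>2 = 0"
      by (rule energy_norm_AE_zero[OF S(3,4,14,15) _ z(3)]) (use m(3)[OF n'] sm in auto)
    ultimately show ?thesis using True by (simp add: err_E_def L2norm_def)
  next
    case False
    then have n0: "n > 0" by simp
    have "L2norm (vol (\<Omega>\<^sub>f X)) (\<lambda>x. U a x - u (Suc n) a x) = L2norm (vol (\<Omega>\<^sub>f X)) (\<lambda>x. U a x - u n a x)"
    proof (rule L2norm_AE_cong)
      show "AE x in vol (\<Omega>\<^sub>f X). U a x - u (Suc n) a x = U a x - u n a x" using fi by eventually_elim simp
    qed (use m(1,4)[OF n'] n0 um in auto)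
    moreover have "L2norm (vol (\<Omega>\<^sub>s X)) (\<lambda>x. \<Xi> a x - \<xi> (Suc n) a x) = L2norm (vol (\<Omega>\<^sub>s X)) (\<lambda>x. \<Xi> a x - \<xi> n a x)"
    proof (rule L2norm_AE_cong)
      show "AE x in vol (\<Omega>\<^sub>s X). \<Xi> a x - \<xi> (Suc n) a x = \<Xi> a x - \<xi> n a x" using si by eventually_elim simp
    qed (use m(2,5)[OF n'] n0 sm in auto)
    moreover have "(energy_norm X (\<lambda>x. \<Psi> a x - \<eta> (Suc n) a x))\<^sup>2 = (energy_norm X (\<lambda>x. \<Psi> a x - \<eta> n a x))\<^sup>2"
    proof (rule energy_norm_cong[OF S(3,4) H[OF order_refl le] S(14,15)])
      show "AE x in vol (\<Omega>\<^sub>s X). \<Psi> a x - \<eta> (Suc n) a x = \<Psi> a x - \<eta> n a x" using si by eventually_elim simp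
      show "(\<lambda>x. \<Psi> a x - \<eta> n a x) \<in> borel_measurable (vol (\<Omega>\<^sub>s X))" using m(3,6)[OF n'] n0 by simp
    qed
    ultimately show ?thesis using False by (simp add: err_E_def Let_def a_def)
  qed
qed

text \<open>The sum of the two energy balances. The structure power enters with a minus sign because
  the outward normal of the structure is opposite to the one underlying \<open>e_s\<close>.\<close>

lemma energy_step:
  assumes n: "n < N"
  defines "a \<equiv> real n * \<Delta>t" and "b \<equiv> real (Suc n) * \<Delta>t"
  shows "E_err (Suc n) + T_err (Suc n) = E_err n + (LINT t|itv a b. LINT x|on_\<Gamma> X. e_f (Suc n) t x \<bullet> e_u (Suc n) t x)
     - (LINT t|itv a b. LINT x|on_\<Gamma> X. e_s (Suc n) t x \<bullet> e_\<xi> (Suc n) t x)"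
proof -
  note S = fsi_settingD[OF X]
  have ab: "a < b" using dt by (simp add: a_def b_def algebra_simps)
  then have le: "a \<le> b" by simp
  have b: "0 \<le> a" "b \<le> T" using n time_nonneg[of n] time_le_T[of "Suc n"] by (auto simp: a_def b_def)
  note fs = fluid_eqs_strong[OF fluid_stepD(1)[OF n], folded a_def b_def]
    and ss = structure_eqs_strong[OF X structure_stepD(1)[OF n], folded a_def b_def]
  note fx = fluid_strong_sub[OF X strong_exact(1) b(1) le b(2)] and sx = structure_strong_sub[OF X strong_exact(2) b(1) le b(2)]
  note LL = error_L2L2[OF n, folded a_def b_def]
  let ?f = "\<lambda>t. LINT x|on_\<Gamma> X. e_f (Suc n) t x \<bullet> e_u (Suc n) t x"
    and ?s = "\<lambda>t. LINT x|on_\<Gamma> X. e_s (Suc n) t x \<bullet> e_\<xi> (Suc n) t x"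
  have fi: "integrable (itv a b) ?f" and si: "integrable (itv a b) ?s"
    by (rule L2L2_inner_time_integrable[OF fin LL(3,1)], rule L2L2_inner_time_integrable[OF fin LL(4,2)])
  have fluid: "\<rho>\<^sub>f X / 2 * (L2norm (vol (\<Omega>\<^sub>f X)) (\<lambda>x. U b x - u (Suc n) b x))\<^sup>2
     + 2 * \<mu>\<^sub>f X * (LINT t:{a..b}|lebesgue. (L2norm (vol (\<Omega>\<^sub>f X)) (symgrad (\<Omega>\<^sub>f X) (\<lambda>x. U t x - u (Suc n) t x)))\<^sup>2)
    = \<rho>\<^sub>f X / 2 * (L2norm (vol (\<Omega>\<^sub>f X)) (\<lambda>x. U a x - u (Suc n) a x))\<^sup>2 + (LINT t|itv a b. ?f t)"
    by (rule fluid_energy[OF X le fx fs fi]) (simp add: e_f_def e_u_def)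
  have struct: "\<rho>\<^sub>s X / 2 * (L2norm (vol (\<Omega>\<^sub>s X)) (\<lambda>x. \<Xi> b x - \<xi> (Suc n) b x))\<^sup>2
     + 1 / 2 * (energy_norm X (\<lambda>x. \<Psi> b x - \<eta> (Suc n) b x))\<^sup>2
    = \<rho>\<^sub>s X / 2 * (L2norm (vol (\<Omega>\<^sub>s X)) (\<lambda>x. \<Xi> a x - \<xi> (Suc n) a x))\<^sup>2
     + 1 / 2 * (energy_norm X (\<lambda>x. \<Psi> a x - \<eta> (Suc n) a x))\<^sup>2 + (LINT t|itv a b. - ?s t)"
  proof (rule structure_energy[OF X ab sx ss])
    show "integrable (itv a b) (\<lambda>t. - ?s t)" using si by simp
    show "AE t in itv a b. - ?s t = (LINT x|on_\<Gamma> X. (\<sigma>S t x *v n\<^sub>s X x - \<sigma>s (Suc n) t x *v n\<^sub>s X x) \<bullet> (\<Xi> t x - \<xi> (Suc n) t x))"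
      using sx[unfolded structure_strong_def, THEN conjunct2, THEN conjunct2, THEN conjunct2, THEN conjunct2]
        L2L2_AE_space[OF fin LL(2)] L2L2_AE_space[OF fin LL(4)] AE_itv_in[of a b]
    proof eventually_elim
      case (elim t)
      \<comment> \<open>The regularity of the exact structure stress on the interface is stated with
        \<open>n\<^sub>f\<close>; measurability with \<open>n\<^sub>s\<close> comes from its normal
        trace.\<close>
      have "Hdiv (surf X) (\<Omega>\<^sub>s X) (n\<^sub>s X) (\<sigma>S t)" using elim(1) by blast
      from Hdiv_L2(3)[OF this]
      have "(\<lambda>x. \<sigma>S t x *v n\<^sub>s X x) \<in> borel_measurable (restrict_space (surf X) (frontier (\<Omega>\<^sub>s X)))"
        by (simp add: L2_def)
      then have m1: "(\<lambda>x. \<sigma>S t x *v n\<^sub>s X x) \<in> borel_measurable (on_\<Gamma> X)"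
        by (rule measurable_restrict_mono[OF _ S(9)])
      have m2: "(\<lambda>x. \<sigma>s (Suc n) t x *v n\<^sub>s X x) \<in> borel_measurable (on_\<Gamma> X)"
        by (rule L2L2_section[OF structure_stepD(4)[OF n, folded a_def b_def]]) (use elim(4) in auto)
      have m3: "e_s (Suc n) t \<in> borel_measurable (on_\<Gamma> X)" "e_\<xi> (Suc n) t \<in> borel_measurable (on_\<Gamma> X)"
        using elim(2,3) by (auto simp: L2_def)
      have "(LINT x|on_\<Gamma> X. (\<sigma>S t x *v n\<^sub>s X x - \<sigma>s (Suc n) t x *v n\<^sub>s X x) \<bullet> e_\<xi> (Suc n) t x)
        = (LINT x|on_\<Gamma> X. - (e_s (Suc n) t x \<bullet> e_\<xi> (Suc n) t x))"
      proof (rule integral_cong_AE)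
        show "AE x in on_\<Gamma> X. (\<sigma>S t x *v n\<^sub>s X x - \<sigma>s (Suc n) t x *v n\<^sub>s X x) \<bullet> e_\<xi> (Suc n) t x
            = - (e_s (Suc n) t x \<bullet> e_\<xi> (Suc n) t x)"
          using S(10) by eventually_elim (simp add: e_s_def matrix_vector_neg inner_add_left inner_diff_left)
      qed (use m1 m2 m3 in auto)
      then show ?case by (simp add: e_\<xi>_def)
    qed
  qed
  have "E_err (Suc n) = \<rho>\<^sub>f X / 2 * (L2norm (vol (\<Omega>\<^sub>f X)) (\<lambda>x. U b x - u (Suc n) b x))\<^sup>2
      + \<rho>\<^sub>s X / 2 * (L2norm (vol (\<Omega>\<^sub>s X)) (\<lambda>x. \<Xi> b x - \<xi> (Suc n) b x))\<^sup>2
      + 1 / 2 * (energy_norm X (\<lambda>x. \<Psi> b x - \<eta> (Suc n) b x))\<^sup>2"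
    unfolding err_E_def Let_def b_def by (simp only: nat.simps if_False)
  moreover have "T_err (Suc n) = 2 * \<mu>\<^sub>f X * (LINT t:{a..b}|lebesgue. (L2norm (vol (\<Omega>\<^sub>f X)) (symgrad (\<Omega>\<^sub>f X) (\<lambda>x. U t x - u (Suc n) t x)))\<^sup>2)"
    unfolding err_T_def a_def b_def by (simp only: diff_Suc_1)
  moreover have "(LINT t|itv a b. - ?s t) = - (LINT t|itv a b. ?s t)" by simp
  ultimately show ?thesis
    using fluid struct E_err_start[OF n, folded a_def] by linarith
qed

section \<open>Error recursion and summation\<close>

lemma E_err_nonneg: "0 \<le> E_err n"
  using fsi_settingD[OF X] by (simp add: err_E_def Let_def)

lemma T_err_nonneg: "0 \<le> T_err n"
  using fsi_settingD[OF X] unfolding err_T_def set_lebesgue_integral_def by (intro mult_nonneg_nonneg Bochner_Integration.integral_nonneg) auto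

text \<open>Translation by one step maps the previous interval onto the current one; for
  \<open>n = 0\<close> there are no errors yet and both integrals are zero.\<close>

lemma S_norm_prev:
  assumes n: "n < N"
  shows "integrable (itv (real n * \<Delta>t) (real (Suc n) * \<Delta>t)) (\<lambda>t. s_norm n (prev n t))"
    and "(LINT t|itv (real n * \<Delta>t) (real (Suc n) * \<Delta>t). s_norm n (prev n t)) = S_norm n"
proof -
  have "integrable (itv (real n * \<Delta>t) (real (Suc n) * \<Delta>t)) (\<lambda>t. s_norm n (prev n t)) \<and>
    (LINT t|itv (real n * \<Delta>t) (real (Suc n) * \<Delta>t). s_norm n (prev n t)) = S_norm n"
  proof (cases n)
    case 0
    then show ?thesis by (simp add: s_norm_0 S_norm_def)
  next
    case (Suc m)
    have m: "m < N" using n Suc by simp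
    from itv_shift[OF s_norm_integrable[OF m], of \<Delta>t] show ?thesis
      unfolding Suc prev_def S_norm_def time_Suc[of m] time_Suc[of "Suc m"] by simp
  qed
  then show "integrable (itv (real n * \<Delta>t) (real (Suc n) * \<Delta>t)) (\<lambda>t. s_norm n (prev n t))"
    "(LINT t|itv (real n * \<Delta>t) (real (Suc n) * \<Delta>t). s_norm n (prev n t)) = S_norm n" by blast+
qed

text \<open>The inequality of \<open>step_inequality\<close> integrated over one step: the boundary
  work on its left is the one in \<open>energy_step\<close> and is eliminated. The length of the
  step supplies the second power of the step size.\<close>

lemma error_recursion:
  assumes n: "n < N"
  shows "E_err (Suc n) + T_err (Suc n) + S_norm (Suc n)
    \<le> E_err n + (1 + 1 / real N) * S_norm n + (1 + real N) * (\<Delta>t\<^sup>2 / 2 * \<kappa> n)"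
proof -
  let ?I = "itv (real n * \<Delta>t) (real (Suc n) * \<Delta>t)"
  let ?f = "\<lambda>t. LINT x|on_\<Gamma> X. e_f (Suc n) t x \<bullet> e_u (Suc n) t x"
    and ?s = "\<lambda>t. LINT x|on_\<Gamma> X. e_s (Suc n) t x \<bullet> e_\<xi> (Suc n) t x"
  note LL = error_L2L2[OF n]
  have i: "integrable ?I ?f" "integrable ?I ?s" "integrable ?I (s_norm (Suc n))" "integrable ?I (\<lambda>t. s_norm n (prev n t))"
    by (rule L2L2_inner_time_integrable[OF fin LL(3,1)], rule L2L2_inner_time_integrable[OF fin LL(4,2)],
        rule s_norm_integrable[OF n], rule S_norm_prev(1)[OF n])
  interpret finite_measure ?I by (rule finite_itv)
  have c: "integrable ?I (\<lambda>t. (1 + real N) * (\<Delta>t / 2 * \<kappa> n))" by (rule integrable_const)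
  have meas: "measure ?I (space ?I) = \<Delta>t"
    using time_mono[of n "Suc n"] dt by (simp add: measure_restrict_space space_itv algebra_simps)
  have "(LINT t|?I. ?f t - ?s t + s_norm (Suc n) t) \<le> (LINT t|?I. (1 + 1 / real N) * s_norm n (prev n t) + (1 + real N) * (\<Delta>t / 2 * \<kappa> n))"
    using step_inequality[OF n]
    by (intro integral_mono_AE Bochner_Integration.integrable_add Bochner_Integration.integrable_diff integrable_mult_right i c)
  also have "\<dots> = (1 + 1 / real N) * S_norm n + (1 + real N) * (\<Delta>t\<^sup>2 / 2 * \<kappa> n)"
    using i(4) c meas S_norm_prev(2)[OF n] by (simp add: power2_eq_square)
  finally have "(LINT t|?I. ?f t) - (LINT t|?I. ?s t) + S_norm (Suc n) \<le> \<dots>"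
    using i by (simp add: S_norm_def)
  with energy_step[OF n] show ?thesis by linarith
qed

lemma \<kappa>_sum: "(\<Sum>n<N. \<kappa> n) \<le> 2 * (LINT t|itv 0 T. data_norm t)"
  using sum_overlapping_integrals[of N \<Delta>t data_norm] data_norm_integrable data_norm_nonneg dt
  by (simp add: \<kappa>_def T[symmetric])

lemma error_bound:
  "E_err N + (\<Sum>n=1..N. T_err n) + S_norm N \<le> 2 * exp 1 * T * \<Delta>t * (LINT t|itv 0 T. data_norm t)"
proof -
  define F where "F = (\<lambda>n. E_err n + (\<Sum>k=1..n. T_err k) + S_norm n)"
  define K where "K = (\<lambda>n. (1 + real N) * (\<Delta>t\<^sup>2 / 2 * \<kappa> n))"
  let ?D = "LINT t|itv 0 T. data_norm t"
  have D: "0 \<le> ?D" by (rule integral_nonneg_AE) (simp add: data_norm_nonneg)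
  have "F N \<le> exp 1 * (\<Sum>n<N. K n)"
  proof (rule discrete_Gronwall[OF N])
    show "F 0 = 0" by (simp add: F_def err_E_def S_norm_def)
    show "0 \<le> K n" for n using \<kappa>_nonneg[of n] by (simp add: K_def)
    fix n assume n: "n < N"
    have nn: "0 \<le> E_err n + (\<Sum>k=1..n. T_err k)"
      by (intro add_nonneg_nonneg sum_nonneg E_err_nonneg T_err_nonneg)
    have "F (Suc n) \<le> E_err n + (\<Sum>k=1..n. T_err k) + (1 + 1 / real N) * S_norm n + K n"
      using error_recursion[OF n] by (simp add: F_def K_def)
    \<comment> \<open>Only the interface part carries the growth factor; granting it to the
      nonnegative energy and dissipation as well yields a recursion for a single quantity.\<close>
    also have "\<dots> \<le> (1 + 1 / real N) * F n + K n"
      using mult_right_mono[OF _ nn, of 1 "1 + 1 / real N"] by (simp add: F_def distrib_left)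
    finally show "F (Suc n) \<le> (1 + 1 / real N) * F n + K n" .
  qed
  also have "(\<Sum>n<N. K n) = (1 + real N) * (\<Delta>t\<^sup>2 / 2) * (\<Sum>n<N. \<kappa> n)"
    by (simp add: K_def sum_distrib_left mult_ac)
  also have "\<dots> \<le> (1 + real N) * (\<Delta>t\<^sup>2 / 2) * (2 * ?D)"
    by (intro mult_left_mono \<kappa>_sum) auto
  \<comment> \<open>Here \<open>N >= 1\<close> enters; one factor \<open>N * \<Delta>t\<close> then
    becomes \<open>T\<close>, and the overall factor 2 joins \<open>exp 1\<close> in the
    constant.\<close>
  also have "\<dots> \<le> (2 * real N) * (\<Delta>t\<^sup>2 / 2) * (2 * ?D)"
    using N D by (intro mult_right_mono) auto
  finally show ?thesis
    unfolding F_def by (simp add: T power2_eq_square mult_ac)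
qed

section \<open>Return to the quantities of the statement\<close>

lemma data_norm_eq:
  "(LINT t|itv 0 T. data_norm t) = L * (L2L2norm (on_\<Gamma> X) 0 T dU)\<^sup>2 + L * (L2L2norm (on_\<Gamma> X) 0 T d\<Xi>)\<^sup>2
     + 1 / L * (L2L2norm (on_\<Gamma> X) 0 T dF)\<^sup>2 + 1 / L * (L2L2norm (on_\<Gamma> X) 0 T dS)\<^sup>2"
proof -
  have "L2L2 (on_\<Gamma> X) 0 T dU" "L2L2 (on_\<Gamma> X) 0 T d\<Xi>" "L2L2 (on_\<Gamma> X) 0 T dF" "L2L2 (on_\<Gamma> X) 0 T dS"
    using exact_tderiv by (auto simp: has_tderiv_def)
  note i = this[THEN L2L2_norm_integrable[OF fin]]
  show ?thesis unfolding data_norm_def L2L2norm_sq using i by (simp add: Bochner_Integration.integral_add)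
qed

text \<open>In \<^const>\<open>err_S\<close> the structure stress is multiplied by \<open>n\<^sub>f\<close>, which may spoil measurability on a
  null set; the Bochner integral is then \<open>0\<close> by convention, so an inequality survives.\<close>

lemma err_S_le: "err_S X L \<Delta>t U \<sigma>F \<Xi> \<sigma>S u \<sigma>f \<xi> \<sigma>s N \<le> S_norm N"
proof -
  obtain m where m: "N = Suc m" "m < N" using N by (cases N) auto
  let ?a = "real m * \<Delta>t" and ?b = "real (Suc m) * \<Delta>t"
  let ?M = "on_\<Gamma> X"
  have NS: "real (N - 1) * \<Delta>t = ?a" "real N * \<Delta>t = ?b" by (simp_all add: m)
  note i = L2L2_norm_integrable[OF fin error_L2L2(1)[OF m(2)]] L2L2_norm_integrable[OF fin error_L2L2(2)[OF m(2)]]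
    L2L2_norm_integrable[OF fin error_L2L2(3)[OF m(2)]] L2L2_norm_integrable[OF fin error_L2L2(4)[OF m(2)]]
  have eu: "L2norm ?M (\<lambda>x. U s x - u N s x) = L2norm ?M (e_u (Suc m) s)" for s
    by (simp add: e_u_def[abs_def] m)
  have ex: "L2norm ?M (\<lambda>x. \<Xi> s x - \<xi> N s x) = L2norm ?M (e_\<xi> (Suc m) s)" for s
    by (simp add: e_\<xi>_def[abs_def] m)
  have ef: "L2norm ?M (\<lambda>x. (\<sigma>F s x - \<sigma>f N s x) *v n\<^sub>f X x) = L2norm ?M (e_f (Suc m) s)" for s
    by (simp add: e_f_def[abs_def] m matrix_vector_mult_diff_rdistrib)
  have es: "(L2norm ?M (\<lambda>x. (\<sigma>S s x - \<sigma>s N s x) *v n\<^sub>f X x))\<^sup>2 \<le> (L2norm ?M (e_s (Suc m) s))\<^sup>2"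
    if s: "L2 ?M (e_s (Suc m) s)" for s
    unfolding L2norm_sq
  \<comment> \<open>This rule asks for integrability of the majorant only, which suits a left
    integrand of unknown measurability.\<close>
  proof (rule integral_mono_AE')
    show "integrable ?M (\<lambda>x. (norm (e_s (Suc m) s x))\<^sup>2)" using s by (simp add: L2_def)
    show "AE x in ?M. (norm ((\<sigma>S s x - \<sigma>s N s x) *v n\<^sub>f X x))\<^sup>2 \<le> (norm (e_s (Suc m) s x))\<^sup>2"
      using fsi_settingD(10)[OF X]
    proof eventually_elim
      case (elim x)
      have "(\<sigma>S s x - \<sigma>s N s x) *v n\<^sub>f X x = e_s (Suc m) s x"
        by (simp add: e_s_def m elim matrix_vector_neg matrix_vector_mult_diff_rdistrib)
      then show ?case by simp
    qed
  qed simp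
  have "(LINT s|itv ?a ?b. (L2norm ?M (e_f (Suc m) s))\<^sup>2 + (L2norm ?M (\<lambda>x. (\<sigma>S s x - \<sigma>s N s x) *v n\<^sub>f X x))\<^sup>2)
     \<le> (LINT s|itv ?a ?b. (L2norm ?M (e_f (Suc m) s))\<^sup>2 + (L2norm ?M (e_s (Suc m) s))\<^sup>2)"
  proof (rule integral_mono_AE')
    show "integrable (itv ?a ?b) (\<lambda>s. (L2norm ?M (e_f (Suc m) s))\<^sup>2 + (L2norm ?M (e_s (Suc m) s))\<^sup>2)"
      by (intro Bochner_Integration.integrable_add i)
    show "AE s in itv ?a ?b. (L2norm ?M (e_f (Suc m) s))\<^sup>2 + (L2norm ?M (\<lambda>x. (\<sigma>S s x - \<sigma>s N s x) *v n\<^sub>f X x))\<^sup>2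
      \<le> (L2norm ?M (e_f (Suc m) s))\<^sup>2 + (L2norm ?M (e_s (Suc m) s))\<^sup>2"
      using L2L2_AE_space[OF fin error_L2L2(4)[OF m(2)]] by eventually_elim (simp add: es)
  qed simp
  then have "1 / (2 * L) * (LINT s|itv ?a ?b. (L2norm ?M (e_f (Suc m) s))\<^sup>2 + (L2norm ?M (\<lambda>x. (\<sigma>S s x - \<sigma>s N s x) *v n\<^sub>f X x))\<^sup>2)
     \<le> 1 / (2 * L) * (LINT s|itv ?a ?b. (L2norm ?M (e_f (Suc m) s))\<^sup>2 + (L2norm ?M (e_s (Suc m) s))\<^sup>2)"
    using L by (intro mult_left_mono) auto
  moreover have "S_norm N = L / 2 * (LINT s|itv ?a ?b. (L2norm ?M (e_u (Suc m) s))\<^sup>2 + (L2norm ?M (e_\<xi> (Suc m) s))\<^sup>2)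
     + 1 / (2 * L) * (LINT s|itv ?a ?b. (L2norm ?M (e_f (Suc m) s))\<^sup>2 + (L2norm ?M (e_s (Suc m) s))\<^sup>2)"
    unfolding S_norm_def m s_norm_def robin_norm_def using i by (simp add: Bochner_Integration.integral_add)
  ultimately show ?thesis
    unfolding err_S_def Let_def NS set_integral_itv eu ex ef using N by simp
qed

lemma error_estimate:
  "E_err N + (\<Sum>n=1..N. T_err n) + err_S X L \<Delta>t U \<sigma>F \<Xi> \<sigma>S u \<sigma>f \<xi> \<sigma>s N
   \<le> 2 * exp 1 * T * \<Delta>t *
     (L * (L2L2norm (on_\<Gamma> X) 0 T (tderiv (on_\<Gamma> X) 0 T U))\<^sup>2
    + L * (L2L2norm (on_\<Gamma> X) 0 T (tderiv (on_\<Gamma> X) 0 T \<Xi>))\<^sup>2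
    + 1 / L * (L2L2norm (on_\<Gamma> X) 0 T (tderiv (on_\<Gamma> X) 0 T (\<lambda>t x. \<sigma>F t x *v n\<^sub>f X x)))\<^sup>2
    + 1 / L * (L2L2norm (on_\<Gamma> X) 0 T (tderiv (on_\<Gamma> X) 0 T (\<lambda>t x. \<sigma>S t x *v n\<^sub>f X x)))\<^sup>2)"
  using error_bound err_S_le unfolding data_norm_eq dU_def d\<Xi>_def dF_def dS_def by linarith

end

theorem theorem4p2:
  fixes X :: "'d::finite fsi_data"
  assumes "fsi_setting X"
  shows "\<exists>C>0. \<forall>L \<Delta>t T :: real. \<forall>N :: nat.
    \<forall>(U :: 'd vfield) (P :: 'd sfield) (\<sigma>F :: 'd tfield) (\<Psi> :: 'd vfield) (\<Xi> :: 'd vfield) (\<sigma>S :: 'd tfield).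
    \<forall>(u :: nat \<Rightarrow> 'd vfield) (p :: nat \<Rightarrow> 'd sfield) (\<sigma>f :: nat \<Rightarrow> 'd tfield)
     (\<eta> :: nat \<Rightarrow> 'd vfield) (\<xi> :: nat \<Rightarrow> 'd vfield) (\<sigma>s :: nat \<Rightarrow> 'd tfield).
      L > 0 \<and> \<Delta>t > 0 \<and> N \<ge> 1 \<and> T = real N * \<Delta>t \<and>
      FSI_solution X T U P \<sigma>F \<Psi> \<Xi> \<sigma>S \<and>
      u 0 0 = U 0 \<and> \<sigma>f 0 0 = \<sigma>F 0 \<and> \<eta> 0 0 = \<Psi> 0 \<and> \<xi> 0 0 = \<Xi> 0 \<and> \<sigma>s 0 0 = \<sigma>S 0 \<and>
      splitting_solution X L \<Delta>t N u p \<sigma>f \<eta> \<xi> \<sigma>s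
      \<longrightarrow>
      err_E X \<Delta>t U \<Psi> \<Xi> u \<eta> \<xi> N + (\<Sum>n=1..N. err_T X \<Delta>t U u n) + err_S X L \<Delta>t U \<sigma>F \<Xi> \<sigma>S u \<sigma>f \<xi> \<sigma>s N
      \<le> C * T * \<Delta>t *
         (L * (L2L2norm (on_\<Gamma> X) 0 T (tderiv (on_\<Gamma> X) 0 T U))\<^sup>2
        + L * (L2L2norm (on_\<Gamma> X) 0 T (tderiv (on_\<Gamma> X) 0 T \<Xi>))\<^sup>2
        + 1 / L * (L2L2norm (on_\<Gamma> X) 0 T (tderiv (on_\<Gamma> X) 0 T (\<lambda>t x. \<sigma>F t x *v n\<^sub>f X x)))\<^sup>2
        + 1 / L * (L2L2norm (on_\<Gamma> X) 0 T (tderiv (on_\<Gamma> X) 0 T (\<lambda>t x. \<sigma>S t x *v n\<^sub>f X x)))\<^sup>2)"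
proof (intro exI[of _ "2 * exp 1"] conjI allI impI, goal_cases)
  case (2 L \<Delta>t T N U P \<sigma>F \<Psi> \<Xi> \<sigma>S u p \<sigma>f \<eta> \<xi> \<sigma>s)
  then have "fsi_splitting X L \<Delta>t T N U P \<sigma>F \<Psi> \<Xi> \<sigma>S u p \<sigma>f \<eta> \<xi> \<sigma>s"
    using assms by (intro fsi_splitting.intro) blast+
  then show ?case by (rule fsi_splitting.error_estimate)
qed simp

end
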